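(* Let $A\subseteq\mathcal{T}_n\setminus\mathcal{S}_n$ be an independent set and let $G\le\mathcal{S}_n$. The following are equivalent: (1) $\langle A\cup G\rangle\setminus G=\langle A\cup\mathcal{S}_n\rangle\setminus\mathcal{S}_n$; (2) $(a,G)$ is an $\mathcal{S}_n$-pair for every $a\in A$.
   Context: $\Omega=\{1,\ldots,n\}$, $\mathcal{T}_n$ is the monoid of all maps $\Omega\to\Omega$, $\mathcal{S}_n$ the symmetric group, $\langle\cdot\rangle$ the generated semigroup. A set $A\subseteq\mathcal{T}_n\setminus\mathcal{S}_n$ is independent if for all distinct $a,b\in A$ we have $a\notin\langle b,\mathcal{S}_n\rangle$. For $a\in\mathcal{T}_n\setminus\mathcal{S}_n$, $(a,G)$ is an $\mathcal{S}_n$-pair if $\langle a,G\rangle\setminus G=\langle a,\mathcal{S}_n\rangle\setminus\mathcal{S}_n$. *)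

theory Defs
  imports Main
begin

text \<open>Transformations of Omega = {1..n}, represented as maps nat => nat that send
  {1..n} into itself and fix every point outside {1..n} (so that equality of
  transformations is equality of functions).\<close>

definition Tn :: "nat \<Rightarrow> (nat \<Rightarrow> nat) set" where
  "Tn n = {f. f ` {1..n} \<subseteq> {1..n} \<and> (\<forall>x. x \<notin> {1..n} \<longrightarrow> f x = x)}"

definition Sn :: "nat \<Rightarrow> (nat \<Rightarrow> nat) set" where
  "Sn n = {f \<in> Tn n. bij_betw f {1..n} {1..n}}"

inductive_set gen :: "('a \<Rightarrow> 'a) set \<Rightarrow> ('a \<Rightarrow> 'a) set" for X where
  base: "f \<in> X \<Longrightarrow> f \<in> gen X"
| comp: "f \<in> gen X \<Longrightarrow> g \<in> gen X \<Longrightarrow> f \<circ> g \<in> gen X"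

definition sym_subgroup :: "nat \<Rightarrow> (nat \<Rightarrow> nat) set \<Rightarrow> bool" where
  "sym_subgroup n G \<longleftrightarrow> G \<subseteq> Sn n \<and> id \<in> G \<and>
     (\<forall>f\<in>G. \<forall>g\<in>G. f \<circ> g \<in> G) \<and> (\<forall>f\<in>G. \<exists>g\<in>G. f \<circ> g = id \<and> g \<circ> f = id)"

definition independent :: "nat \<Rightarrow> (nat \<Rightarrow> nat) set \<Rightarrow> bool" where
  "independent n A \<longleftrightarrow> A \<subseteq> Tn n - Sn n \<and>
     (\<forall>a\<in>A. \<forall>b\<in>A. a \<noteq> b \<longrightarrow> a \<notin> gen (insert b (Sn n)))"

definition Sn_pair :: "nat \<Rightarrow> (nat \<Rightarrow> nat) \<Rightarrow> (nat \<Rightarrow> nat) set \<Rightarrow> bool" where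
  "Sn_pair n a G \<longleftrightarrow> a \<in> Tn n - Sn n \<and> sym_subgroup n G \<and>
     gen (insert a G) - G = gen (insert a (Sn n)) - Sn n"

end

theory Submission
  imports Defs "HOL-Computational_Algebra.Primes" "HOL-Combinatorics.Permutations"
begin

text \<open>
  Condition (1) amounts to \<open>g a h \<in> \<langle>A, G\<rangle>\<close> for all \<open>a \<in> A\<close> and all permutations \<open>g\<close>, \<open>h\<close>, and being an
  \<open>S\<^sub>n\<close>-pair amounts to \<open>g a h \<in> \<langle>a, G\<rangle>\<close>, so (2) implies (1). For the converse, a singular map
  \<open>c\<close> generates together with \<open>S\<^sub>n\<close> all maps with a coarser kernel. Hence, by independence, the factor
  from \<open>A\<close> that is applied first in a product equal to \<open>a g\<close> is \<open>a\<close> itself, and \<open>G\<close> is transitive on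
  the partitions of the type of the kernel of \<open>a\<close>. If \<open>G\<close> is also transitive on the \<open>r\<close>-sets, \<open>r\<close>
  being the rank of \<open>a\<close>, then \<open>(a, G)\<close> is an \<open>S\<^sub>n\<close>-pair, by sliding \<open>r\<close> tokens on \<open>n\<close> points.

  Suppose that \<open>G\<close> is not transitive on the \<open>r\<close>-sets, and let \<open>d\<close> be the least number such that it is not
  transitive on the \<open>d\<close>-sets; then \<open>d \<le> r \<le> n - d\<close>. If \<open>d \<ge> 2\<close>, take a prime \<open>p > n / 2\<close>
  (Bertrand's postulate). A \<open>p\<close>-cycle fixes no partition of a type with parts smaller than \<open>p\<close> and fewer than
  \<open>p\<close> singletons; if \<open>G\<close> is transitive on the partitions of such a type, it contains a \<open>p\<close>-cycle and
  Jordan's theorem contradicts the choice of \<open>d\<close>. So every element of \<open>A\<close> of rank at least \<open>d\<close> has a large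
  part or many singletons, and the Livingstone-Wagner theorem sharpens this: \<open>a\<close> has type
  \<open>(n - d + 1, 1, \<dots>, 1)\<close> and any other element of \<open>A\<close> of rank at least \<open>d\<close> would generate \<open>a\<close>. Then all
  \<open>d\<close>-sets are translates of the image of \<open>a\<close>, a contradiction. If \<open>d = 1\<close>, all kernels are uniform, and
  an element of \<open>A\<close> of maximal rank leads to a contradiction in the same way.
\<close>

section \<open>A prime between \<open>n / 2\<close> and \<open>n - 3\<close>\<close>

text \<open>Maps are composed from right to left: in a product the rightmost factor from
  \<open>A\<close> controls the kernel and the leftmost one the image. Independence compares kernels
  only. On the image side, (1) merely covers an \<open>r\<close>-set by a translate of the image of
  some \<open>b\<close> in \<open>A\<close> whose rank may exceed \<open>r\<close>. All such
  competitors have to be excluded, and this is why the possible kernel types must be determined.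

  The bound \<open>r <= n - d\<close> comes from passing to complements. A \<open>p\<close>-cycle by
  itself makes a transitive \<open>G\<close> only \<open>(n - p + 1)\<close>-fold transitive, which
  may be less than \<open>d\<close>. If the cycle fixes at least three points, there are also
  3-cycles, and \<open>G\<close> is homogeneous of every degree. Hence the wish for a prime with
  \<open>p + 3 <= n\<close>, which is slightly more than Bertrand's postulate gives. For
  \<open>n <= 7\<close> there is no such prime, but the weaker degree suffices except for
  \<open>n = 6\<close>, \<open>d = 3\<close>, where the kernel type \<open>(2,2,2)\<close> needs an
  argument of its own.\<close>

lemma central_binomial_Suc:
  "Suc k * (2 * Suc k choose Suc k) = 2 * (2 * k + 1) * (2 * k choose k)"
proof -
  have "Suc k * (Suc (2 * k + 1) choose Suc k) = Suc (2 * k + 1) * ((2 * k + 1) choose k)"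
    by (rule Suc_times_binomial)
  moreover have "(2 * k + 1) choose k = (2 * k + 1) choose Suc k"
    using binomial_symmetric[of k "2 * k + 1"] by simp
  moreover have "Suc k * (Suc (2 * k) choose Suc k) = Suc (2 * k) * ((2 * k) choose k)"
    by (rule Suc_times_binomial)
  ultimately have "Suc k * (2 * Suc k choose Suc k) = 2 * (Suc k * (Suc (2 * k) choose Suc k))"
    by simp
  also have "\<dots> = 2 * (Suc (2 * k) * (2 * k choose k))" by (simp only: Suc_times_binomial)
  finally show ?thesis by simp
qed

lemma four_power_le_central_binomial:
  assumes "k \<ge> 1"
  shows "4 ^ k \<le> 2 * k * (2 * k choose k)"
  using assms
proof (induction k rule: dec_induct)
  case base
  show ?case by (simp add: numeral_2_eq_2)
next
  case (step k)
  have "4 ^ Suc k \<le> 4 * (2 * k * (2 * k choose k))" using step.IH by simp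
  also have "\<dots> \<le> 4 * ((2 * k + 1) * (2 * k choose k))"
    by (intro mult_le_mono le_refl) simp
  also have "\<dots> = 2 * (Suc k * (2 * Suc k choose Suc k))"
    by (simp only: central_binomial_Suc)
  finally show ?case by (simp only: mult.assoc)
qed

lemma prod_primes_dvd:
  fixes P :: "nat set"
  assumes "finite P" "\<And>p. p \<in> P \<Longrightarrow> prime p \<and> p dvd m"
  shows "\<Prod>P dvd m"
  using assms
proof (induction P)
  case (insert p P)
  have "coprime p (\<Prod>P)"
    using insert.hyps insert.prems by (intro prod_coprime_right primes_coprime) auto
  with insert show ?case by (auto intro!: divides_mult)
qed simp

text \<open>Erdos' bound, by strong induction. For \<open>n = 2 * m + 1\<close> the primes in
  \<open>]m + 1, n]\<close> divide \<open>n choose m\<close>, which occurs twice in a row with sum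
  \<open>2 ^ n\<close> and is thus at most \<open>4 ^ m\<close>; the primes up to
  \<open>m + 1\<close> are left to the induction. An even \<open>n > 2\<close> adds no
  prime.\<close>

lemma primorial_le:
  "\<Prod>{p. prime p \<and> p \<le> n} \<le> (4::nat) ^ n"
proof (induction n rule: less_induct)
  case (less n)
  let ?P = "\<lambda>n. {p::nat. prime p \<and> p \<le> n}"
  have fin: "finite (?P n)" for n by (rule finite_subset[of _ "{..n}"]) auto
  consider "n < 2" | "n = 2" | "n > 2" "even n" | m where "n = 2 * m + 1" "m \<ge> 1"
    by (metis One_nat_def Suc_eq_plus1 Suc_leI less_2_cases_iff linorder_neqE_nat neq0_conv
        oddE mult_0_right)
  then show ?case
  proof cases
    case 1
    have "?P n = {}" using 1 by (auto dest: prime_ge_2_nat)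
    then show ?thesis by (simp only: prod.empty) simp
  next
    case 2
    have "?P n = {2}" using 2 by (auto dest: prime_ge_2_nat)
    then show ?thesis using 2 by simp
  next
    case 3
    have "prime p \<and> p \<le> n \<longleftrightarrow> prime p \<and> p \<le> n - 1" for p
      using 3 primes_dvd_imp_eq[of 2 n] by (cases "p = n") auto
    then have "?P n = ?P (n - 1)" by blast
    moreover have "(4::nat) ^ (n - 1) \<le> 4 ^ n" by (rule power_increasing) auto
    moreover have "\<Prod>(?P (n - 1)) \<le> 4 ^ (n - 1)" using 3 by (intro less.IH) simp
    ultimately show ?thesis by (simp only: order.trans)
  next
    case 4
    let ?Q = "{p. prime p \<and> m + 1 < p \<and> p \<le> 2 * m + 1}"
    have finQ: "finite ?Q" by (rule finite_subset[of _ "{..2*m+1}"]) auto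
    have "p dvd (2 * m + 1 choose m)" if p: "prime p" "m + 1 < p" "p \<le> 2 * m + 1" for p
    proof -
      have "fact m * fact (m + 1) * (2 * m + 1 choose m) = (fact (2 * m + 1) :: nat)"
        using binomial_fact_lemma[of m "2 * m + 1"] by (simp add: Suc_diff_le)
      then have "p dvd fact m * fact (m + 1) * (2 * m + 1 choose m)"
        using p by (simp only: prime_dvd_fact_iff)
      with p show ?thesis by (auto simp only: prime_dvd_mult_iff prime_dvd_fact_iff)
    qed
    then have "\<Prod>?Q dvd (2 * m + 1 choose m)" by (intro prod_primes_dvd finQ) auto
    then have "\<Prod>?Q \<le> 2 * m + 1 choose m" by (intro dvd_imp_le) auto
    also have "2 * (2 * m + 1 choose m) \<le> 2 * 4 ^ m"
    proof -
      have "(2 * m + 1 choose m) + (2 * m + 1 choose (m + 1)) = (\<Sum>i\<in>{m, m + 1}. 2 * m + 1 choose i)"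
        by simp
      also have "\<dots> \<le> (\<Sum>i\<le>2 * m + 1. 2 * m + 1 choose i)" by (rule sum_mono2) auto
      also have "\<dots> = 2 ^ (2 * m + 1)" by (rule choose_row_sum)
      finally show ?thesis
        using binomial_symmetric[of m "2 * m + 1"] by (simp add: power_mult Suc_diff_le)
    qed
    then have "2 * m + 1 choose m \<le> 4 ^ m" by simp
    finally have Q: "\<Prod>?Q \<le> 4 ^ m" .
    have "?P n = ?P (m + 1) \<union> ?Q" using 4 by auto
    then have "\<Prod>(?P n) = \<Prod>(?P (m + 1)) * \<Prod>?Q"
      using fin finQ by (simp only:) (rule prod.union_disjoint, auto)
    also have "\<dots> \<le> 4 ^ (m + 1) * 4 ^ m"
      by (rule mult_le_mono[OF _ Q], rule less.IH) (use 4 in auto)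
    also have "\<dots> = 4 ^ n" using 4 by (simp add: power_add mult_2)
    finally show ?thesis .
  qed
qed

text \<open>Legendre's formula. Terms with \<open>p ^ i > n\<close> vanish, so any upper limit
  \<open>N >= n\<close> is allowed and the sums for \<open>2 * k\<close> and \<open>k\<close> can
  share one range.\<close>

lemma multiplicity_fact_nat:
  fixes p :: nat
  assumes p: "prime p" and "n \<le> N"
  shows "multiplicity p (fact n :: nat) = (\<Sum>i=1..N. n div p ^ i)"
  using assms(2)
proof (induction n)
  case (Suc n)
  have p2: "p \<ge> 2" using p by (rule prime_ge_2_nat)
  have "multiplicity p (Suc n) = card {i\<in>{1..N}. p ^ i dvd Suc n}"
  proof -
    have "{i\<in>{1..N}. p ^ i dvd Suc n} = {1..multiplicity p (Suc n)}"
    proof -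
      have "multiplicity p (Suc n) < p ^ multiplicity p (Suc n)" 
        using p2 by (intro less_exp[THEN less_le_trans] power_mono) auto
      also have "\<dots> \<le> Suc n" by (rule dvd_imp_le[OF multiplicity_dvd]) simp
      finally have "multiplicity p (Suc n) \<le> N" using Suc.prems by simp
      then show ?thesis using p2
        by (auto simp: power_dvd_iff_le_multiplicity)
    qed
    then show ?thesis by simp
  qed
  also have "\<dots> = (\<Sum>i=1..N. if p ^ i dvd Suc n then 1 else 0)"
    by (simp add: sum.If_cases Int_def)
  finally have "multiplicity p (Suc n) = (\<Sum>i=1..N. if p ^ i dvd Suc n then 1 else 0)" .
  moreover have "multiplicity p (fact (Suc n) :: nat) = multiplicity p (Suc n) + multiplicity p (fact n :: nat)"
    unfolding fact_Suc of_nat_id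
    using p by (subst prime_elem_multiplicity_mult_distrib) auto
  moreover have "Suc n div p ^ i = (if p ^ i dvd Suc n then 1 else 0) + n div p ^ i" for i
    using p2 by (auto simp: div_Suc dvd_eq_mod_eq_0)
  ultimately show ?case using Suc by (simp add: sum.distrib)
qed simp

lemma multiplicity_central_binomial:
  fixes p :: nat
  assumes p: "prime p"
  shows "multiplicity p (2 * k choose k) = (\<Sum>i=1..2*k. 2 * k div p ^ i - 2 * (k div p ^ i))"
proof -
  have "fact k * fact k * (2 * k choose k) = (fact (2 * k) :: nat)"
    using binomial_fact_lemma[of k "2 * k"] by (simp flip: mult_2)
  then have "multiplicity p (fact (2 * k) :: nat) =
      2 * multiplicity p (fact k :: nat) + multiplicity p (2 * k choose k)"
    using p by (simp add: prime_elem_multiplicity_mult_distrib flip: \<open>_ = fact (2 * k)\<close>)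
  then have "multiplicity p (2 * k choose k) =
      (\<Sum>i=1..2*k. 2 * k div p ^ i) - (\<Sum>i=1..2*k. 2 * (k div p ^ i))"
    using multiplicity_fact_nat[OF p, of "2 * k" "2 * k"] multiplicity_fact_nat[OF p, of k "2 * k"]
    by (simp add: sum_distrib_left)
  \<comment> \<open>The truncated subtraction is exact because
    \<open>2 * (k div q) <= 2 * k div q\<close>.\<close>
  also have "\<dots> = (\<Sum>i=1..2*k. 2 * k div p ^ i - 2 * (k div p ^ i))"
    by (rule sum_subtractf_nat[symmetric])
       (metis div_add1_eq le_add1 mult_2)
  finally show ?thesis .
qed

lemma div_double_le: "2 * k div q - 2 * (k div q) \<le> (1::nat)"
proof (cases "q = 0")
  case False
  have "2 * k < q * (2 * (k div q) + 2)"
  proof -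
    have "q * (k div q) + k mod q = k" by simp
    moreover have "k mod q < q" using False by simp
    ultimately show ?thesis unfolding add_mult_distrib2 by linarith
  qed
  then have "2 * k div q < 2 * (k div q) + 2"
    using False by (simp add: less_mult_imp_div_less mult.commute)
  then show ?thesis by simp
qed simp

text \<open>The summands in the formula for the multiplicity are at most 1 and vanish once
  \<open>p ^ i > 2 * k\<close>, so the multiplicity is at most the largest \<open>L\<close> with
  \<open>p ^ L <= 2 * k\<close>.\<close>

lemma prime_power_central_binomial_le:
  fixes p :: nat
  assumes p: "prime p" and k: "k \<ge> 1"
  shows "p ^ multiplicity p (2 * k choose k) \<le> 2 * k"
proof -
  define L where "L = Max {i. p ^ i \<le> 2 * k}"
  have p2: "p \<ge> 2" using p by (rule prime_ge_2_nat)
  have fin: "finite {i. p ^ i \<le> 2 * k}"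
  proof (rule finite_subset[of _ "{..2*k}"])
    show "{i. p ^ i \<le> 2 * k} \<subseteq> {..2*k}"
    proof clarsimp
      fix i assume "p ^ i \<le> 2 * k"
      moreover have "i < p ^ i" using p2 by (intro less_exp[THEN less_le_trans] power_mono) auto
      ultimately show "i \<le> 2 * k" by simp
    qed
  qed simp
  have "0 \<in> {i. p ^ i \<le> 2 * k}" using k by simp
  then have L: "p ^ L \<le> 2 * k" using Max_in[OF fin] unfolding L_def by blast
  have "multiplicity p (2 * k choose k) \<le> (\<Sum>i=1..2*k. if i \<le> L then 1 else 0)"
    unfolding multiplicity_central_binomial[OF p]
  proof (rule sum_mono)
    fix i
    show "2 * k div p ^ i - 2 * (k div p ^ i) \<le> (if i \<le> L then 1 else 0)"
    proof (cases "i \<le> L")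
      case False
      then have "\<not> p ^ i \<le> 2 * k" using Max_ge[OF fin, of i] by (auto simp: L_def)
      then show ?thesis by simp
    qed (use div_double_le in simp)
  qed
  also have "\<dots> \<le> card {1..L}"
  proof -
    have "card ({1..2*k} \<inter> {i. i \<le> L}) \<le> card {1..L}" by (rule card_mono) auto
    then show ?thesis by (simp add: sum.If_cases)
  qed
  finally have "p ^ multiplicity p (2 * k choose k) \<le> p ^ L"
    using p2 by (intro power_increasing) auto
  with L show ?thesis by linarith
qed


text \<open>Here \<open>2 * k div p = 2\<close> and \<open>k div p = 1\<close>, so the term for
  \<open>i = 1\<close> vanishes; \<open>p >= 3\<close> makes \<open>p ^ 2\<close> exceed
  \<open>2 * k\<close>, so the other terms vanish too. The absence of these primes is the gain in
  Erdos' argument.\<close>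

lemma not_dvd_central_binomial:
  fixes p :: nat
  assumes p: "prime p" and "2 * k < 3 * p" "p \<le> k" "p \<ge> 3"
  shows "multiplicity p (2 * k choose k) = 0"
  unfolding multiplicity_central_binomial[OF p]
proof (rule sum.neutral, rule ballI)
  fix i assume i: "i \<in> {1..2 * k}"
  show "2 * k div p ^ i - 2 * (k div p ^ i) = 0"
  proof (cases "i = 1")
    case True
    have "2 * k div p < 3" using assms by (simp add: less_mult_imp_div_less)
    moreover have "1 \<le> k div p" using assms
      by (metis One_nat_def Suc_leI div_greater_zero_iff prime_gt_0_nat)
    ultimately show ?thesis using True by simp
  next
    case False
    have "2 * k < p * p" using assms(2) mult_le_mono1[OF assms(4), of p] by linarith
    also have "p * p = p ^ 2" by (simp add: power2_eq_square)
    also have "p ^ 2 \<le> p ^ i" using False i assms(4) by (intro power_increasing) auto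
    finally show ?thesis by simp
  qed
qed

lemma multiplicity_central_binomial_le_1:
  fixes p :: nat
  assumes p: "prime p" and k: "k \<ge> 1" and "2 * k < p\<^sup>2"
  shows "multiplicity p (2 * k choose k) \<le> 1"
proof (rule ccontr)
  assume "\<not> ?thesis"
  then have "p ^ 2 \<le> p ^ multiplicity p (2 * k choose k)"
    using prime_gt_0_nat[OF p] by (intro power_increasing) auto
  with prime_power_central_binomial_le[OF p k] assms(3) show False by simp
qed

text \<open>Erdos' proof: without primes in \<open>]k + 2, 2k]\<close>, the central binomial coefficient would be
  too small.\<close>

lemma central_binomial_le:
  assumes k: "k \<ge> 3" and no: "\<And>p. prime p \<Longrightarrow> k + 2 < p \<Longrightarrow> p \<le> 2 * k \<Longrightarrow> False"
    and s: "2 * k < (s + 1)\<^sup>2"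
  shows "2 * k choose k \<le> (2 * k) ^ s * 4 ^ (2 * k div 3) * (k + 2)"
proof -
  let ?C = "2 * k choose k"
  let ?m = "\<lambda>p. p ^ multiplicity p ?C"
  \<comment> \<open>The primes are sorted by their contribution: those in \<open>A\<close> give
    prime powers up to \<open>2 * k\<close>, those in \<open>B\<close> occur at most once and are
    bounded by the primorial, those in \<open>D\<close> do not occur, and by hypothesis
    \<open>E\<close> can only contain \<open>k + 1\<close> or \<open>k + 2\<close>.\<close>
  define A where "A = {p. prime p \<and> p \<le> s \<and> p \<le> 2 * k}"
  define B where "B = {p. prime p \<and> s < p \<and> p \<le> 2 * k div 3}"
  define D where "D = {p. prime p \<and> s < p \<and> 2 * k div 3 < p \<and> p \<le> k}"
  define E where "E = {p. prime p \<and> s < p \<and> 2 * k div 3 < p \<and> k < p \<and> p \<le> 2 * k}"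
  have fin: "finite A" "finite B" "finite D" "finite E"
    unfolding A_def B_def D_def E_def by (auto intro: finite_subset[of _ "{..2*k}"])
  have le1: "?m p \<le> p" if "prime p" "s < p" for p
  proof -
    have "(s + 1)\<^sup>2 \<le> p\<^sup>2" using that by (intro power_mono) auto
    with s have "2 * k < p\<^sup>2" by (rule less_le_trans)
    then have "multiplicity p ?C \<le> 1" using k that
      by (intro multiplicity_central_binomial_le_1) auto
    then have "?m p \<le> p ^ 1" using prime_gt_0_nat[OF that(1)] by (intro power_increasing) auto
    then show ?thesis by simp
  qed
  have pf: "prime_factors ?C \<subseteq> {p. prime p \<and> p \<le> 2 * k}"
  proof
    fix p assume "p \<in> prime_factors ?C"
    then have p: "prime p" "p dvd ?C" by auto
    have "fact k * fact k * ?C = (fact (2 * k) :: nat)"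
      using binomial_fact_lemma[of k "2 * k"] by (simp flip: mult_2)
    then have "p dvd fact (2 * k)" using p(2) by (metis dvd_mult)
    then show "p \<in> {p. prime p \<and> p \<le> 2 * k}" using p(1) by (simp add: prime_dvd_fact_iff)
  qed
  have "?C = (\<Prod>p\<in>prime_factors ?C. ?m p)" by (rule prime_factorization_nat) simp
  also have "\<dots> = (\<Prod>p\<in>{p. prime p \<and> p \<le> 2 * k}. ?m p)"
    using pf by (intro prod.mono_neutral_left)
      (auto simp: prime_factors_multiplicity intro: finite_subset[of _ "{..2*k}"])
  also have "{p. prime p \<and> p \<le> 2 * k} = A \<union> (B \<union> (D \<union> E))"
    unfolding A_def B_def D_def E_def by auto
  also have "(\<Prod>p\<in>A \<union> (B \<union> (D \<union> E)). ?m p) =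
      (\<Prod>p\<in>A. ?m p) * ((\<Prod>p\<in>B. ?m p) * ((\<Prod>p\<in>D. ?m p) * (\<Prod>p\<in>E. ?m p)))"
    using fin by (subst prod.union_disjoint; (subst prod.union_disjoint)?; (subst prod.union_disjoint)?)
      (auto simp: A_def B_def D_def E_def)
  also have "\<dots> \<le> (2 * k) ^ s * (4 ^ (2 * k div 3) * (1 * (k + 2)))"
  proof (intro mult_le_mono)
    have "(\<Prod>p\<in>A. ?m p) \<le> (\<Prod>p\<in>A. 2 * k)"
      using k prime_power_central_binomial_le by (intro prod_mono) (auto simp: A_def)
    also have "\<dots> = (2 * k) ^ card A" by simp
    also have "card A \<le> card {1..s}"
      by (rule card_mono) (auto simp: A_def dest: prime_gt_0_nat)
    then have "(2 * k) ^ card A \<le> (2 * k) ^ s" using k by (intro power_increasing) auto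
    finally show "(\<Prod>p\<in>A. ?m p) \<le> (2 * k) ^ s" .
  next
    have "(\<Prod>p\<in>B. ?m p) \<le> \<Prod>B" using le1 by (intro prod_mono) (auto simp: B_def)
    also have "\<dots> \<le> \<Prod>{p. prime p \<and> p \<le> 2 * k div 3}"
    proof (rule dvd_imp_le)
      show "\<Prod>B dvd \<Prod>{p. prime p \<and> p \<le> 2 * k div 3}"
        by (rule prod_dvd_prod_subset) (auto simp: B_def intro: finite_subset[of _ "{..2*k}"])
      show "0 < \<Prod>{p::nat. prime p \<and> p \<le> 2 * k div 3}"
        by (rule prod_pos) (auto dest: prime_gt_0_nat)
    qed
    also have "\<dots> \<le> 4 ^ (2 * k div 3)" by (rule primorial_le)
    finally show "(\<Prod>p\<in>B. ?m p) \<le> 4 ^ (2 * k div 3)" .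
  next
    have "(\<Prod>p\<in>D. ?m p) = (\<Prod>p\<in>D. 1)"
    proof (rule prod.cong[OF refl])
      fix p assume "p \<in> D"
      then have "prime p" "2 * k < 3 * p" "p \<le> k" unfolding D_def by auto
      moreover have "p \<ge> 3"
      proof (rule ccontr)
        assume "\<not> p \<ge> 3"
        then have "2 * k < 6" using \<open>2 * k < 3 * p\<close> by simp
        with k show False by simp
      qed
      ultimately show "?m p = 1" using not_dvd_central_binomial[of p k] by simp
    qed
    then show "(\<Prod>p\<in>D. ?m p) \<le> 1" by simp
  next
    have "(\<Prod>p\<in>E. ?m p) \<le> \<Prod>E" using le1 by (intro prod_mono) (auto simp: E_def)
    also have "\<Prod>E \<le> k + 2"
    proof -
      \<comment> \<open>Members of \<open>E\<close> are odd, while \<open>k + 1\<close> and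
        \<open>k + 2\<close> have different parity, so \<open>E\<close> has at most one
        element.\<close>
      have "odd p" if "p \<in> E" for p
        using that k primes_dvd_imp_eq[of 2 p] unfolding E_def by auto
      moreover have "p = k + 1 \<or> p = k + 2" if "p \<in> E" for p
        using that no[of p] unfolding E_def by fastforce
      ultimately have "E \<subseteq> {k + 1} \<or> E \<subseteq> {k + 2}" by (cases "even k") fastforce+
      then have "E = {} \<or> E = {k + 1} \<or> E = {k + 2}" by (meson subset_singletonD)
      then show ?thesis by auto
    qed
    finally show "(\<Prod>p\<in>E. ?m p) \<le> k + 2" .
  qed
  finally show ?thesis by (simp only: mult.assoc mult_1)
qed

text \<open>Slightly more than Bertrand's postulate: excluding \<open>k + 1\<close> and
  \<open>k + 2\<close> as well costs only a factor \<open>k + 2\<close> in the estimate. With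
  \<open>k = (n - 3) div 2\<close> the slack becomes \<open>n < 2 * p\<close> and
  \<open>p + 3 <= n\<close>.\<close>

lemma exists_prime_large:
  fixes k :: nat
  assumes x: "2 * k \<ge> 4 ^ 7"
  shows "\<exists>p. prime p \<and> k + 2 < p \<and> p \<le> 2 * k"
proof (rule ccontr)
  assume no: "\<not> ?thesis"
  define x where "x = 2 * k"
  \<comment> \<open>\<open>4 ^ j\<close> is the largest power of 4 not above \<open>x\<close>, so
    that \<open>y = 2 ^ j\<close> and \<open>s + 1 = 2 * y\<close> bracket the square root of
    \<open>x\<close> without real numbers.\<close>
  define j where "j = Max {j. 4 ^ j \<le> x}"
  have fin: "finite {j. (4::nat) ^ j \<le> x}"
  proof (rule finite_subset[of _ "{..x}"])
    show "{j. 4 ^ j \<le> x} \<subseteq> {..x}"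
    proof clarsimp
      fix i assume "4 ^ i \<le> x"
      moreover have "i < 4 ^ i" by (intro less_exp[THEN less_le_trans] power_mono) auto
      ultimately show "i \<le> x" by simp
    qed
  qed simp
  have j7: "j \<ge> 7" unfolding j_def using x by (intro Max_ge fin) (simp add: x_def)
  have jl: "4 ^ j \<le> x"
  proof -
    have "7 \<in> {j. 4 ^ j \<le> x}" using x by (simp add: x_def)
    then have "{j. 4 ^ j \<le> x} \<noteq> {}" by blast
    from Max_in[OF fin this] show ?thesis by (simp add: j_def)
  qed
  have ju: "x < 4 ^ (j + 1)"
  proof (rule ccontr)
    assume "\<not> ?thesis"
    then have "j + 1 \<le> j" unfolding j_def by (intro Max_ge fin) (simp add: j_def)
    then show False by simp
  qed
  define y :: nat where "y = 2 ^ j"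
  have yy: "4 ^ j = y * y" by (simp add: y_def flip: power_mult_distrib)
  define s where "s = 2 * y - 1"
  have y1: "y \<ge> 1" by (simp add: y_def)
  have s: "x < (s + 1)\<^sup>2"
    using ju yy y1 by (simp add: s_def power2_eq_square)
  have k: "k \<ge> 3" using x by simp
  have "4 ^ k \<le> x * ((2 * k) ^ s * 4 ^ (2 * k div 3) * (k + 2))"
    using four_power_le_central_binomial[of k] central_binomial_le[OF k _ s[unfolded x_def]] no k
    unfolding x_def by (meson le_trans mult_le_mono2 One_nat_def one_le_numeral order.trans)
  also have "\<dots> \<le> x * (x ^ s * 4 ^ (2 * k div 3) * x)"
    using k by (intro mult_le_mono le_refl) (auto simp: x_def)
  also have "\<dots> = x ^ (s + 2) * 4 ^ (2 * k div 3)" by (simp add: algebra_simps)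
  \<comment> \<open>Cubing removes the floor in \<open>2 * k div 3\<close>: three times it is at
    most \<open>2 * k\<close>, and then \<open>4 ^ (2 * k)\<close> cancels.\<close>
  finally have "(4 ^ k) ^ 3 \<le> (x ^ (s + 2) * 4 ^ (2 * k div 3)) ^ 3" by (rule power_mono) simp
  also have "\<dots> = x ^ (3 * s + 6) * 4 ^ (3 * (2 * k div 3))"
  proof -
    have "3 * s + 6 = (s + 2) * 3" by simp
    then show ?thesis by (simp only: power_mult_distrib power_mult mult.commute[of 3 "2 * k div 3"])
  qed
  also have "\<dots> \<le> x ^ (3 * s + 6) * 4 ^ (2 * k)"
    by (rule mult_le_mono2, rule power_increasing) auto
  finally have "(4 ^ k) ^ 3 \<le> x ^ (3 * s + 6) * 4 ^ (2 * k)" .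
  moreover have "((4::nat) ^ k) ^ 3 = 4 ^ k * 4 ^ (2 * k)"
    by (simp flip: power_mult power_add)
  ultimately have "4 ^ k * 4 ^ (2 * k) \<le> x ^ (3 * s + 6) * 4 ^ (2 * k)" by (simp only:)
  then have "4 ^ k \<le> x ^ (3 * s + 6)" by simp
  also have "\<dots> < (4 ^ (j + 1)) ^ (3 * s + 6)" using ju by (intro power_strict_mono) auto
  also have "\<dots> = 2 ^ (2 * (j + 1) * (3 * s + 6))"
  proof -
    have "(4::nat) = 2 ^ 2" by simp
    then show ?thesis by (simp only: power_mult)
  qed
  finally have "2 ^ x < (2::nat) ^ (2 * (j + 1) * (3 * s + 6))"
    by (simp add: x_def power_mult)
  then have xx: "x < 2 * (j + 1) * (3 * s + 6)" by (simp add: power_strict_increasing_iff)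
  \<comment> \<open>The threshold \<open>4 ^ 7\<close> comes from here:
    \<open>16 * (j + 1) <= 2 ^ j\<close> holds from \<open>j = 7\<close> on, with equality at 7. It
    leads to \<open>8 * x < 6 * y * y + 3 * y <= 7 * x\<close>.\<close>
  have jy: "16 * (j + 1) \<le> y" unfolding y_def using j7
    by (induction j rule: dec_induct) auto
  have s6: "3 * s + 6 = 6 * y + 3" using y1 by (simp add: s_def)
  have "8 * (2 * (j + 1) * (3 * s + 6)) = 16 * (j + 1) * (6 * y + 3)"
    unfolding s6 by (simp add: algebra_simps)
  also have "\<dots> \<le> y * (6 * y + 3)" using jy by (rule mult_le_mono1)
  also have "\<dots> = 6 * (y * y) + 3 * y" by (simp add: algebra_simps)
  finally have "8 * (2 * (j + 1) * (3 * s + 6)) \<le> 6 * (y * y) + 3 * y" .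
  moreover have "3 * y \<le> y * y" using jy by (intro mult_le_mono1) simp
  moreover have "y * y \<le> x" using jl yy by simp
  ultimately show False using xx by linarith
qed

text \<open>Trial division, phrased with \<open>list_all\<close> so that the simplifier decides it
  for numerals.\<close>

lemma prime_nat_if_no_small_divisor:
  fixes p :: nat
  assumes "1 < p" "p < s * s" "list_all (\<lambda>q. \<not> q dvd p) [2..<s]"
  shows "prime p"
proof (rule ccontr)
  assume "\<not> prime p"
  then obtain a where a: "a dvd p" "a \<noteq> 1" "a \<noteq> p"
    using assms(1) by (auto simp: prime_nat_iff)
  then obtain b where b: "p = a * b" by blast
  have "a \<noteq> 0" "b \<noteq> 0" "b \<noteq> 1" using a b assms(1) by (auto intro: ccontr)
  with a b have ab: "1 < a" "1 < b" by auto
  have "a < s \<or> b < s"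
    using assms(2) b mult_le_mono[of s a s b] by linarith
  then have "\<exists>q\<in>set [2..<s]. q dvd p" using ab b
    by (metis Suc_1 Suc_leI atLeastLessThan_iff dvd_triv_left dvd_triv_right set_upt One_nat_def)
  then show False using assms(3) by (auto simp: list_all_iff)
qed

lemma exists_prime_between:
  fixes n :: nat
  assumes "n \<ge> 8"
  shows "\<exists>p. prime p \<and> n < 2 * p \<and> p + 3 \<le> n"
proof (cases "n < 24646")
  case True
  show ?thesis
  proof (rule ccontr)
    assume no: "\<not> ?thesis"
    \<comment> \<open>In a counterexample every prime \<open>p <= n - 3\<close> satisfies
      \<open>2 * p <= n\<close>. Each prime of the chain below is at most twice its predecessor
      minus 3, so the chain climbs to \<open>2 * 12323 = 24646\<close>.\<close>
    have step: "2 * p \<le> n" if "prime p" "p + 3 \<le> n" for p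
      using no that by (meson not_le)
    have "2 * 5 \<le> n" by (rule step) (use assms in auto)
    then have "2 * 7 \<le> n"
      by (intro step prime_nat_if_no_small_divisor[of _ 3]) simp_all
    then have "2 * 11 \<le> n"
      by (intro step prime_nat_if_no_small_divisor[of _ 4]) simp_all
    then have "2 * 17 \<le> n"
      by (intro step prime_nat_if_no_small_divisor[of _ 5]) simp_all
    then have "2 * 29 \<le> n"
      by (intro step prime_nat_if_no_small_divisor[of _ 6]) simp_all
    then have "2 * 53 \<le> n"
      by (intro step prime_nat_if_no_small_divisor[of _ 8]) simp_all
    then have "2 * 101 \<le> n"
      by (intro step prime_nat_if_no_small_divisor[of _ 11]) simp_all
    then have "2 * 197 \<le> n"
      by (intro step prime_nat_if_no_small_divisor[of _ 15]) simp_all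
    then have "2 * 389 \<le> n"
      by (intro step prime_nat_if_no_small_divisor[of _ 20]) simp_all
    then have "2 * 773 \<le> n"
      by (intro step prime_nat_if_no_small_divisor[of _ 28]) simp_all
    then have "2 * 1543 \<le> n"
      by (intro step prime_nat_if_no_small_divisor[of _ 40]) simp_all
    then have "2 * 3083 \<le> n"
      by (intro step prime_nat_if_no_small_divisor[of _ 56]) simp_all
    then have "2 * 6163 \<le> n"
      by (intro step prime_nat_if_no_small_divisor[of _ 79]) simp_all
    then have "2 * 12323 \<le> n"
      by (intro step prime_nat_if_no_small_divisor[of _ 112]) simp_all
    with True show False by simp
  qed
next
  case False
  define k where "k = (n - 3) div 2"
  have "2 * k \<ge> 4 ^ 7" using False by (simp add: k_def)
  then obtain p where "prime p" "k + 2 < p" "p \<le> 2 * k" using exists_prime_large by blast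
  moreover have "n \<le> 2 * k + 4" "2 * k + 3 \<le> n" using False by (auto simp: k_def)
  ultimately show ?thesis by (intro exI[of _ p]) auto
qed

section \<open>Jordan's theorem on cycles of prime length\<close>

lemma funpow_fixed_mult:
  assumes "(f ^^ k) x = x"
  shows "(f ^^ (a * k)) x = x"
  using assms by (induction a) (auto simp: funpow_add)

lemma funpow_prime_fixed:
  fixes p :: nat
  assumes p: "prime p" and "(f ^^ p) x = x" "(f ^^ k) x = x" "0 < k" "k < p"
  shows "f x = x"
proof -
  have "coprime k p"
    using p assms(4,5) by (metis coprime_commute nat_dvd_not_less prime_imp_coprime)
  then obtain a b where "k * a = p * b + 1"
    using coprime_bezout_strong[of k p] prime_gt_1_nat[OF p] by auto
  then have "(f ^^ (a * k)) x = (f ^^ Suc (b * p)) x" by (simp add: mult.commute)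
  then show ?thesis using assms(2,3) by (simp add: funpow_fixed_mult)
qed

lemma inj_on_funpow_prime:
  fixes p :: nat
  assumes p: "prime p" and cl: "(f ^^ p) x = x" and "f x \<noteq> x"
  shows "inj_on (\<lambda>i. (f ^^ i) x) {..<p}"
proof -
  have *: "i = j" if ij: "i \<le> j" "i < p" "j < p" "(f ^^ i) x = (f ^^ j) x" for i j
  proof (rule ccontr)
    assume "i \<noteq> j"
    have "(f ^^ (p - i + j)) x = (f ^^ (p - i + i)) x" using ij by (simp only: funpow_add o_apply)
    then have "(f ^^ (p - i + j)) x = x" using ij cl by simp
    moreover have "p - i + j = (j - i) + p" using ij by simp
    ultimately have "(f ^^ (j - i)) x = x" using cl by (simp add: funpow_add)
    from funpow_prime_fixed[OF p cl this] ij \<open>i \<noteq> j\<close> assms(3) show False by linarith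
  qed
  show ?thesis
    by (rule inj_onI) (metis * lessThan_iff nat_le_linear)
qed

text \<open>A moved point lies in a cycle of exactly \<open>p\<close> points; deleting such cycles
  one at a time leaves the fixed points. It is applied to tuples under rotation, to cosets and to
  kernels.\<close>

lemma card_mod_prime_fixed_points:
  fixes p :: nat
  assumes p: "prime p" and "finite X" "f ` X \<subseteq> X" "\<And>x. x \<in> X \<Longrightarrow> (f ^^ p) x = x"
  shows "card X mod p = card {x\<in>X. f x = x} mod p"
  using assms(2-4)
proof (induction "card X" arbitrary: X rule: less_induct)
  case less
  show ?case
  proof (cases "\<exists>x\<in>X. f x \<noteq> x")
    case False
    then have "{x\<in>X. f x = x} = X" by auto
    then show ?thesis by simp
  next
    case True
    then obtain x where x: "x \<in> X" "f x \<noteq> x" by blast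
    have pow: "(f ^^ i) y \<in> X" if "y \<in> X" for i y
      using less.prems(2) that by (induction i) auto
    define C where "C = (\<lambda>i. (f ^^ i) x) ` {..<p}"
    have cl: "(f ^^ p) x = x" using less.prems(3) x by simp
    have CX: "C \<subseteq> X" using pow x by (auto simp: C_def)
    have cC: "card C = p"
      using inj_on_funpow_prime[OF p cl x(2)] by (simp add: C_def card_image)
    have p0: "p > 0" using p by (rule prime_gt_0_nat)
    have fC: "f y \<in> X - C" if y: "y \<in> X - C" for y
    proof -
      have "f y \<notin> C"
      proof
        assume "f y \<in> C"
        then obtain i where i: "f y = (f ^^ i) x" "i < p" by (auto simp: C_def)
        have "y = (f ^^ Suc (p - 1)) y" using less.prems(3) y p0 by simp
        also have "\<dots> = (f ^^ (p - 1)) (f y)" by (simp only: funpow_Suc_right o_apply)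
        also have "\<dots> = (f ^^ (p - 1 + i)) x" using i by (simp only: funpow_add o_apply)
        also have "\<dots> = (f ^^ ((p - 1 + i) mod p)) x"
          by (rule funpow_mod_eq[OF cl, symmetric])
        finally have "y \<in> C" using p0 by (auto simp: C_def)
        with y show False by simp
      qed
      with y less.prems(2) show ?thesis by auto
    qed
    have nf: "f y \<noteq> y" if "y \<in> C" for y
    proof
      assume "f y = y"
      from that obtain i where i: "y = (f ^^ i) x" "i < p" by (auto simp: C_def)
      have fy: "(f ^^ k) y = y" for k using \<open>f y = y\<close> by (induction k) auto
      have "x = (f ^^ (p - i + i)) x" using i cl by simp
      also have "\<dots> = y" using i fy by (simp only: funpow_add o_apply)
      finally show False using \<open>f y = y\<close> x by simp
    qed
    have finC: "finite C" by (simp add: C_def)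
    have "card (X - C) < card X"
    proof (rule psubset_card_mono[OF less.prems(1)])
      have "C \<noteq> {}" using cC p0 by auto
      with CX show "X - C \<subset> X" by blast
    qed
    then have "card (X - C) mod p = card {y\<in>X - C. f y = y} mod p"
      using less.hyps[of "X - C"] less.prems fC by blast
    moreover have "{y\<in>X - C. f y = y} = {y\<in>X. f y = y}" using nf by blast
    moreover have "card X = card (X - C) + p"
      using CX cC less.prems(1) card_mono[OF less.prems(1) CX] by (simp add: card_Diff_subset finC)
    ultimately show ?thesis by simp
  qed
qed

text \<open>Two sets of equal size are joined by exchanges of single elements. The hypothesis covers
  sets of every size, so callers that control only one size make \<open>f\<close> constant on all
  other sets.\<close>

lemma exchange_invariant:
  assumes fin: "finite \<Omega>"
    and step: "\<And>X x y. X \<subseteq> \<Omega> \<Longrightarrow> x \<in> X \<Longrightarrow> y \<in> \<Omega> - X \<Longrightarrow> f (insert y (X - {x})) = f X"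
    and ST: "S \<subseteq> \<Omega>" "T \<subseteq> \<Omega>" "card S = card T"
  shows "f S = f T"
  using ST
proof (induction "card (T - S)" arbitrary: S)
  case 0
  have "finite S" "finite T" using 0 fin finite_subset by blast+
  with 0 have "T \<subseteq> S" by simp
  then have "T = S" using 0 \<open>finite S\<close> by (intro card_subset_eq) auto
  then show ?case by simp
next
  case (Suc k)
  have fin': "finite S" "finite T" using Suc.prems fin finite_subset by blast+
  have "T - S \<noteq> {}" using Suc.hyps(2) by (metis card.empty nat.distinct(1))
  then obtain y where y: "y \<in> T" "y \<notin> S" by blast
  have "S - T \<noteq> {}"
  proof
    assume "S - T = {}"
    then have "S = T" using Suc.prems fin' by (intro card_subset_eq) auto
    with y show False by simp
  qed
  then obtain x where x: "x \<in> S" "x \<notin> T" by blast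
  have "f (insert y (S - {x})) = f T"
  proof (rule Suc.hyps(1))
    have "T - insert y (S - {x}) = (T - S) - {y}" using x by blast
    then show "k = card (T - insert y (S - {x}))"
      using Suc.hyps(2) y fin' by (simp add: card_Diff_singleton)
    have "card (insert y (S - {x})) = card S"
      using x y fin' by (simp add: card_Suc_Diff1 del: card_Diff_insert)
    then show "card (insert y (S - {x})) = card T" using Suc.prems by simp
  qed (use Suc.prems y in auto)
  then show ?case using step[of S x y] Suc.prems x y by auto
qed

section \<open>Permutation groups, homogeneity and pointwise stabilisers\<close>

locale perm_group =
  fixes \<Omega> :: "'a set" and G :: "('a \<Rightarrow> 'a) set"
  assumes finite_points: "finite \<Omega>"
    and permutes: "\<And>g. g \<in> G \<Longrightarrow> g permutes \<Omega>"
    and id_mem: "id \<in> G"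
    and comp_mem: "\<And>g h. g \<in> G \<Longrightarrow> h \<in> G \<Longrightarrow> g \<circ> h \<in> G"
    and inv_mem: "\<And>g. g \<in> G \<Longrightarrow> inv g \<in> G"
begin

lemma finite_group: "finite G"
  by (rule finite_subset[OF _ finite_permutations[OF finite_points]]) (use permutes in auto)

lemma bij_mem: "g \<in> G \<Longrightarrow> bij g"
  using permutes permutes_bij by blast

lemma inv_apply [simp]: "g \<in> G \<Longrightarrow> inv g (g x) = x" "g \<in> G \<Longrightarrow> g (inv g x) = x"
  using bij_mem by (auto simp: bij_is_inj bij_is_surj surj_f_inv_f)

lemma image_inv [simp]:
  assumes "g \<in> G"
  shows "inv g ` g ` X = X" "g ` inv g ` X = X"
  using assms by (auto simp: image_image)

lemma card_image_mem: "g \<in> G \<Longrightarrow> card (g ` X) = card X"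
  using bij_mem by (metis bij_is_inj card_image inj_on_subset subset_UNIV)

lemma image_subset: "g \<in> G \<Longrightarrow> X \<subseteq> \<Omega> \<Longrightarrow> g ` X \<subseteq> \<Omega>"
  using permutes permutes_image by blast

lemma apply_mem: "g \<in> G \<Longrightarrow> x \<in> \<Omega> \<Longrightarrow> g x \<in> \<Omega>"
  using image_subset[of g "{x}"] by simp

lemma funpow_mem: "g \<in> G \<Longrightarrow> g ^^ i \<in> G"
  by (induction i) (auto simp: id_mem[unfolded id_def] comp_mem id_def[symmetric] id_mem)

definition homog :: "nat \<Rightarrow> bool" where
  "homog k \<longleftrightarrow> (\<forall>X Y. X \<subseteq> \<Omega> \<and> Y \<subseteq> \<Omega> \<and> card X = k \<and> card Y = k \<longrightarrow> (\<exists>g\<in>G. g ` X = Y))"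

lemma homogD: "homog k \<Longrightarrow> X \<subseteq> \<Omega> \<Longrightarrow> Y \<subseteq> \<Omega> \<Longrightarrow> card X = k \<Longrightarrow> card Y = k \<Longrightarrow> \<exists>g\<in>G. g ` X = Y"
  by (auto simp: homog_def)

text \<open>The indicator of the orbit of \<open>A\<close>. Its values are integers because it gets
  summed and subtracted over families of sets, which turns questions of homogeneity into linear
  algebra.\<close>

lemma orbit_indicator:
  obtains e :: "'a set \<Rightarrow> int"
  where "\<And>g S. g \<in> G \<Longrightarrow> e (g ` S) = e S" "e A = 1" "\<And>B. e B = 1 \<Longrightarrow> \<exists>g\<in>G. g ` A = B"
proof -
  define orb where "orb = (\<lambda>g. g ` A) ` G"
  define e :: "'a set \<Rightarrow> int" where "e S = (if S \<in> orb then 1 else 0)" for S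
  have "e (g ` S) = e S" if g: "g \<in> G" for g S
  proof -
    have *: "h ` T \<in> orb" if T: "T \<in> orb" and h: "h \<in> G" for h T
    proof -
      obtain k where "k \<in> G" "T = k ` A" using T by (auto simp: orb_def)
      then have "h ` T = (h \<circ> k) ` A" "h \<circ> k \<in> G" using comp_mem[OF h] by (simp_all only: image_comp)
      then show ?thesis by (simp only: orb_def) (rule imageI)
    qed
    have "g ` S \<in> orb \<longleftrightarrow> S \<in> orb"
      using *[OF _ g, of S] *[OF _ inv_mem[OF g], of "g ` S"] image_inv(1)[OF g, of S] by auto
    then show ?thesis by (simp add: e_def)
  qed
  moreover have "e A = 1" unfolding e_def orb_def using id_mem by (auto intro!: image_eqI[of _ _ id])
  moreover have "\<exists>g\<in>G. g ` A = B" if "e B = 1" for B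
    using that by (auto simp: e_def orb_def split: if_splits)
  ultimately show ?thesis by (rule that)
qed

text \<open>The pointwise stabiliser of the complement of \<open>\<Gamma>\<close>. Transitivity and
  primitivity on \<open>\<Gamma>\<close> refer to this subgroup, not to the setwise
  stabiliser.\<close>

definition supported :: "'a set \<Rightarrow> ('a \<Rightarrow> 'a) set" where
  "supported \<Gamma> = {g\<in>G. \<forall>x. x \<notin> \<Gamma> \<longrightarrow> g x = x}"

lemma supported_mono: "\<Gamma> \<subseteq> \<Delta> \<Longrightarrow> supported \<Gamma> \<subseteq> supported \<Delta>"
  by (auto simp: supported_def)

lemma supported_id: "id \<in> supported \<Gamma>"
  by (simp add: supported_def id_mem)

lemma supported_comp: "g \<in> supported \<Gamma> \<Longrightarrow> h \<in> supported \<Gamma> \<Longrightarrow> g \<circ> h \<in> supported \<Gamma>"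
  by (auto simp: supported_def comp_mem)

lemma supported_inv: "g \<in> supported \<Gamma> \<Longrightarrow> inv g \<in> supported \<Gamma>"
  by (auto simp: supported_def inv_mem) (metis inv_apply(1))

lemma supported_image:
  assumes "g \<in> supported \<Gamma>"
  shows "g ` \<Gamma> = \<Gamma>"
proof -
  have *: "h x \<in> \<Gamma>" if h: "h \<in> supported \<Gamma>" and x: "x \<in> \<Gamma>" for h x
  proof (rule ccontr)
    assume nx: "h x \<notin> \<Gamma>"
    then have "h (h x) = h x" using h by (simp add: supported_def)
    moreover have "inj h" using h bij_mem bij_is_inj by (auto simp: supported_def)
    ultimately have "h x = x" by (simp add: inj_eq)
    with nx x show False by simp
  qed
  show ?thesis
  proof
    show "g ` \<Gamma> \<subseteq> \<Gamma>" using * assms by auto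
    show "\<Gamma> \<subseteq> g ` \<Gamma>"
    proof
      fix x assume "x \<in> \<Gamma>"
      then have "inv g x \<in> \<Gamma>" using * supported_inv assms by blast
      moreover have "g (inv g x) = x" using assms by (simp add: supported_def)
      ultimately show "x \<in> g ` \<Gamma>" by (metis imageI)
    qed
  qed
qed

lemma supported_points: "supported \<Omega> = G"
  using permutes by (auto simp: supported_def permutes_def)

lemma supported_conj:
  assumes "g \<in> G" "h \<in> supported \<Gamma>"
  shows "g \<circ> h \<circ> inv g \<in> supported (g ` \<Gamma>)"
proof -
  have "g (h (inv g x)) = x" if "x \<notin> g ` \<Gamma>" for x
  proof -
    have "inv g x \<notin> \<Gamma>"
    proof
      assume "inv g x \<in> \<Gamma>"
      then have "g (inv g x) \<in> g ` \<Gamma>" by (rule imageI)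
      with that assms(1) show False by simp
    qed
    then show ?thesis using assms by (simp add: supported_def)
  qed
  moreover have "g \<circ> h \<circ> inv g \<in> G"
    using assms by (intro comp_mem inv_mem) (simp_all add: supported_def)
  ultimately show ?thesis unfolding supported_def by simp
qed

definition transitive_on :: "'a set \<Rightarrow> bool" where
  "transitive_on \<Gamma> \<longleftrightarrow> (\<forall>x\<in>\<Gamma>. \<forall>y\<in>\<Gamma>. \<exists>h\<in>supported \<Gamma>. h x = y)"

text \<open>Absence of nontrivial blocks: every candidate \<open>B\<close> is carried by some
  element to a set that meets \<open>B\<close> without being equal to it.\<close>

definition primitive_on :: "'a set \<Rightarrow> bool" where
  "primitive_on \<Gamma> \<longleftrightarrow> (\<forall>B\<subseteq>\<Gamma>. 2 \<le> card B \<and> B \<noteq> \<Gamma> \<longrightarrow>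
     (\<exists>h\<in>supported \<Gamma>. B \<inter> h ` B \<noteq> {} \<and> h ` B \<noteq> B))"

definition multi_transitive_on :: "nat \<Rightarrow> 'a set \<Rightarrow> bool" where
  "multi_transitive_on l \<Gamma> \<longleftrightarrow> (\<forall>xs ys. distinct xs \<and> distinct ys \<and> length xs = l \<and> length ys = l
     \<and> set xs \<subseteq> \<Gamma> \<and> set ys \<subseteq> \<Gamma> \<longrightarrow> (\<exists>g\<in>supported \<Gamma>. map g xs = ys))"

lemma transitive_onE:
  assumes "transitive_on \<Gamma>" "x \<in> \<Gamma>" "y \<in> \<Gamma>"
  obtains h where "h \<in> supported \<Gamma>" "h x = y"
  using assms that by (auto simp: transitive_on_def)

lemma primitive_onE:
  assumes "primitive_on \<Gamma>" "B \<subseteq> \<Gamma>" "2 \<le> card B" "B \<noteq> \<Gamma>"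
  obtains h where "h \<in> supported \<Gamma>" "B \<inter> h ` B \<noteq> {}" "h ` B \<noteq> B"
proof -
  have "\<exists>h\<in>supported \<Gamma>. B \<inter> h ` B \<noteq> {} \<and> h ` B \<noteq> B"
    using assms by (simp only: primitive_on_def) simp
  then show ?thesis by (elim bexE conjE) (rule that)
qed

lemma transitive_onI:
  assumes "w \<in> \<Gamma>" "\<And>u. u \<in> \<Gamma> \<Longrightarrow> \<exists>h\<in>supported \<Gamma>. h w = u"
  shows "transitive_on \<Gamma>"
  unfolding transitive_on_def
proof (intro ballI)
  fix x y assume "x \<in> \<Gamma>" "y \<in> \<Gamma>"
  then obtain h k where hk: "h \<in> supported \<Gamma>" "h w = x" "k \<in> supported \<Gamma>" "k w = y"
    using assms(2) by meson
  then have "(k \<circ> inv h) x = y" by (auto simp: supported_def)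
  with hk show "\<exists>h\<in>supported \<Gamma>. h x = y" using supported_comp supported_inv by blast
qed

text \<open>Jordan's argument: among the translates of \<open>\<Gamma>\<close> different from \<open>\<Gamma>\<close>, one that meets
  \<open>\<Gamma>\<close> in as many points as possible differs from it in a single point.\<close>

lemma exists_neighbour_translate:
  assumes sub: "\<Gamma> \<subseteq> \<Omega>" "\<Gamma> \<noteq> \<Omega>" and big: "card \<Omega> < 2 * card \<Gamma>"
    and prim: "primitive_on \<Gamma>" and tr: "transitive_on \<Omega>"
  shows "\<exists>g\<in>G. \<exists>x. x \<in> \<Omega> - \<Gamma> \<and> g ` \<Gamma> - \<Gamma> = {x} \<and> \<Gamma> \<inter> g ` \<Gamma> \<noteq> {}"
proof -
  have fin: "finite \<Gamma>" using sub finite_points finite_subset by blast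
  have finI: "finite (g ` \<Gamma>)" for g using fin by simp
  obtain x y where xy: "x \<in> \<Gamma>" "y \<in> \<Omega> - \<Gamma>"
    using sub big fin by (metis Diff_iff all_not_in_conv card.empty mult_0_right not_less_zero psubsetI psubset_imp_ex_mem)
  then obtain g0 where g0: "g0 \<in> G" "g0 x = y"
    using transitive_onE[OF tr, of x y] sub by (auto simp: supported_points)
  let ?P = "\<lambda>g. g \<in> G \<and> g ` \<Gamma> \<noteq> \<Gamma>"
  have P0: "?P g0" using g0 xy by blast
  have bound: "\<forall>g. ?P g \<longrightarrow> card (\<Gamma> \<inter> g ` \<Gamma>) < Suc (card \<Gamma>)"
    using fin by (auto simp: less_Suc_eq_le intro: card_mono)
  obtain g where gm: "?P g \<and> (\<forall>h. ?P h \<longrightarrow> card (\<Gamma> \<inter> h ` \<Gamma>) \<le> card (\<Gamma> \<inter> g ` \<Gamma>))"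
    using ex_has_greatest_nat[of ?P g0 "\<lambda>g. card (\<Gamma> \<inter> g ` \<Gamma>)", OF P0 bound] by (rule exE)
  note g = gm[THEN conjunct1] and max' = gm[THEN conjunct2]
  have gG: "g \<in> G" and g\<Gamma>: "g ` \<Gamma> \<noteq> \<Gamma>" using g by simp_all
  note g = gG g\<Gamma>
  have max: "card (\<Gamma> \<inter> h ` \<Gamma>) \<le> card (\<Gamma> \<inter> g ` \<Gamma>)" if "h \<in> G" "h ` \<Gamma> \<noteq> \<Gamma>" for h
    using max' that by simp
  define A where "A = \<Gamma> \<inter> g ` \<Gamma>"
  define B where "B = \<Gamma> - g ` \<Gamma>"
  have cg: "card (g ` \<Gamma>) = card \<Gamma>" using g by (simp add: card_image_mem)
  have cB: "card B = card \<Gamma> - card A" "card A \<le> card \<Gamma>"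
    using fin unfolding A_def B_def by (auto simp: card_Diff_subset_Int card_mono)
  have cgB: "card (g ` \<Gamma> - \<Gamma>) = card \<Gamma> - card A"
    using fin cg unfolding A_def by (simp add: card_Diff_subset_Int Int_commute)
  have "card (\<Gamma> \<union> g ` \<Gamma>) \<le> card \<Omega>"
    using sub g image_subset finite_points by (intro card_mono) auto
  \<comment> \<open>As \<open>\<Gamma>\<close> contains more than half of the points, no translate
    is disjoint from it.\<close>
  then have A0: "A \<noteq> {}"
    using card_Un_disjoint[of \<Gamma> "g ` \<Gamma>"] fin cg big unfolding A_def by auto
  have "B \<noteq> {}"
  proof
    assume "B = {}"
    then have "\<Gamma> \<subseteq> g ` \<Gamma>" by (auto simp: B_def)
    then have "\<Gamma> = g ` \<Gamma>" using cg finI by (intro card_subset_eq) auto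
    with g show False by simp
  qed
  moreover have "\<not> 2 \<le> card B"
  proof
    assume B2: "2 \<le> card B"
    have "B \<subseteq> \<Gamma>" "B \<noteq> \<Gamma>" using A0 unfolding A_def B_def by auto
    \<comment> \<open>With this \<open>h\<close>, the element
      \<open>inv g \<circ> h \<circ> g\<close> beats the choice of \<open>g\<close>. Its
      intersection has the size of that of the translates of \<open>\<Gamma>\<close> by
      \<open>g\<close> and \<open>h \<circ> g\<close>. These share the \<open>card B\<close> points
      of the first one outside \<open>\<Gamma>\<close>, which \<open>h\<close> fixes, and, as
      \<open>B\<close> overlaps its image under \<open>h\<close>, more than
      \<open>card \<Gamma> - 2 * card B\<close> points inside \<open>\<Gamma>\<close>; together more
      than \<open>card A\<close>.\<close>
    obtain h where h: "h \<in> supported \<Gamma>" "B \<inter> h ` B \<noteq> {}" "h ` B \<noteq> B"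
      by (rule primitive_onE[OF prim \<open>B \<subseteq> \<Gamma>\<close> B2 \<open>B \<noteq> \<Gamma>\<close>])
    have hG: "h \<in> G" using h by (simp add: supported_def)
    have injh: "inj h" using hG bij_mem bij_is_inj by blast
    have h\<Gamma>: "h ` \<Gamma> = \<Gamma>" using h(1) by (rule supported_image)
    let ?k = "inv g \<circ> h \<circ> g"
    have kG: "?k \<in> G" using g hG by (intro comp_mem inv_mem)
    have k1: "g ` ?k ` \<Gamma> = h ` g ` \<Gamma>" using g by (simp add: image_image)
    have "?k ` \<Gamma> \<noteq> \<Gamma>"
    proof
      assume "?k ` \<Gamma> = \<Gamma>"
      then have "h ` g ` \<Gamma> = g ` \<Gamma>" using k1 by simp
      then have "h ` B = B" unfolding B_def using injh h\<Gamma> by (simp add: image_set_diff)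
      with h show False by simp
    qed
    from max[OF kG this] have "card (\<Gamma> \<inter> ?k ` \<Gamma>) \<le> card A" by (simp add: A_def)
    moreover have "card (\<Gamma> \<inter> ?k ` \<Gamma>) = card (g ` \<Gamma> \<inter> h ` g ` \<Gamma>)"
    proof -
      have "g ` (\<Gamma> \<inter> ?k ` \<Gamma>) = g ` \<Gamma> \<inter> h ` g ` \<Gamma>"
        using bij_mem[OF g(1)] k1 by (simp add: image_Int bij_is_inj)
      then show ?thesis using card_image_mem[OF g(1)] by metis
    qed
    ultimately have le: "card (g ` \<Gamma> \<inter> h ` g ` \<Gamma>) \<le> card A" by simp
    have hA: "A \<inter> h ` A = \<Gamma> - (B \<union> h ` B)"
    proof -
      have "h ` A = \<Gamma> - h ` B"
      proof -
        have "A = \<Gamma> - B" unfolding A_def B_def by auto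
        then show ?thesis using injh h\<Gamma> by (simp add: image_set_diff)
      qed
      then show ?thesis unfolding A_def B_def by auto
    qed
    have BhB: "card (B \<union> h ` B) < 2 * card B"
    proof -
      have finB: "finite B" using fin by (simp add: B_def)
      have "card (B \<union> h ` B) + card (B \<inter> h ` B) = card B + card (h ` B)"
        using finB by (intro card_Un_Int[symmetric]) auto
      moreover have "card (B \<inter> h ` B) > 0" using h(2) finB by (simp add: card_gt_0_iff)
      ultimately show ?thesis using card_image_mem[OF hG] by simp
    qed
    have "(g ` \<Gamma> - \<Gamma>) \<union> (A \<inter> h ` A) \<subseteq> g ` \<Gamma> \<inter> h ` g ` \<Gamma>"
    proof -
      have "z \<in> h ` g ` \<Gamma>" if "z \<in> g ` \<Gamma> - \<Gamma>" for z
      proof -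
        have "h z = z" using that h(1) by (auto simp: supported_def)
        then show ?thesis using that by (metis DiffD1 imageI)
      qed
      then show ?thesis unfolding A_def by auto
    qed
    then have "card ((g ` \<Gamma> - \<Gamma>) \<union> (A \<inter> h ` A)) \<le> card A"
      using le finI by (meson card_mono finite_Int le_trans)
    moreover have "card ((g ` \<Gamma> - \<Gamma>) \<union> (A \<inter> h ` A)) = card (g ` \<Gamma> - \<Gamma>) + card (A \<inter> h ` A)"
      using fin finI by (intro card_Un_disjoint) (auto simp: A_def)
    moreover have "card (A \<inter> h ` A) \<ge> card \<Gamma> - card (B \<union> h ` B)"
      unfolding hA by (intro diff_card_le_card_Diff) (use fin in \<open>simp add: B_def\<close>)
    ultimately show False using cgB cB BhB by linarith
  qed
  ultimately have "card B = 1" using fin by (metis B_def One_nat_def card_0_eq finite_Diff less_2_cases not_le)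
  then have "card (g ` \<Gamma> - \<Gamma>) = 1" using cgB cB by simp
  then obtain x where x: "g ` \<Gamma> - \<Gamma> = {x}" by (meson card_1_singletonE)
  moreover have "x \<in> \<Omega> - \<Gamma>" using x image_subset[OF g(1) sub(1)] by blast
  ultimately show ?thesis using g(1) A0 unfolding A_def by blast
qed

text \<open>The group supported on \<open>insert x \<Gamma>\<close> contains
  \<open>supported \<Gamma>\<close> and its conjugate by \<open>g\<close>, whose orbits
  \<open>\<Gamma>\<close> and the translate by \<open>g\<close> overlap and cover everything. Since
  the stabiliser of \<open>x\<close> is transitive on \<open>\<Gamma>\<close>, the action is even
  doubly transitive, hence primitive.\<close>

lemma enlarge:
  assumes sub: "\<Gamma> \<subseteq> \<Omega>" "\<Gamma> \<noteq> \<Omega>" and big: "card \<Omega> < 2 * card \<Gamma>"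
    and prim: "primitive_on \<Gamma>" and tr\<Gamma>: "transitive_on \<Gamma>" and tr: "transitive_on \<Omega>"
  shows "\<exists>x\<in>\<Omega> - \<Gamma>. transitive_on (insert x \<Gamma>) \<and> primitive_on (insert x \<Gamma>)"
proof -
  from exists_neighbour_translate[OF sub big prim tr] obtain g x where
    g: "g \<in> G" and x: "x \<in> \<Omega> - \<Gamma>" "g ` \<Gamma> - \<Gamma> = {x}" and "\<Gamma> \<inter> g ` \<Gamma> \<noteq> {}" by blast
  then obtain w where w: "w \<in> \<Gamma>" "w \<in> g ` \<Gamma>" by blast
  let ?D = "insert x \<Gamma>"
  have gD: "g ` \<Gamma> \<subseteq> ?D" "x \<in> g ` \<Gamma>" using x by auto
  have trD: "transitive_on ?D"
  proof (rule transitive_onI[of w])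
    show "w \<in> ?D" using w by simp
  next
    fix u assume "u \<in> ?D"
    then consider "u \<in> \<Gamma>" | "u \<in> g ` \<Gamma>" using gD by blast
    then show "\<exists>h\<in>supported ?D. h w = u"
    proof cases
      case 1
      then obtain h where "h \<in> supported \<Gamma>" "h w = u" using transitive_onE[OF tr\<Gamma> w(1)] by metis
      then show ?thesis using supported_mono[of \<Gamma> ?D] by blast
    next
      case 2
      then obtain u' w' where uw: "u' \<in> \<Gamma>" "u = g u'" "w' \<in> \<Gamma>" "w = g w'" using w by blast
      then obtain h where h: "h \<in> supported \<Gamma>" "h w' = u'" using transitive_onE[OF tr\<Gamma> uw(3,1)] by metis
      have "g \<circ> h \<circ> inv g \<in> supported ?D"
        using supported_conj[OF g h(1)] supported_mono[OF gD(1)] by blast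
      moreover have "(g \<circ> h \<circ> inv g) w = u" using uw h g by simp
      ultimately show ?thesis by blast
    qed
  qed
  have "primitive_on ?D"
    unfolding primitive_on_def
  proof (intro allI impI, elim conjE)
    fix B assume B: "B \<subseteq> ?D" "2 \<le> card B" "B \<noteq> ?D"
    then obtain c where c: "c \<in> ?D" "c \<notin> B" by blast
    obtain b1 b2 where b: "b1 \<in> B" "b2 \<in> B" "b1 \<noteq> b2"
      using B(2) by (metis card_2_iff' obtain_subset_with_card_n subset_iff)
    obtain k where k: "k \<in> supported ?D" "k b1 = x"
      using transitive_onE[OF trD, of b1 x] b(1) B(1) by auto
    have kG: "k \<in> G" using k by (simp add: supported_def)
    have kD: "k ` ?D = ?D" using k(1) by (rule supported_image)
    have kne: "k y \<in> \<Gamma>" if "y \<in> ?D" "y \<noteq> b1" for y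
    proof -
      have "k y \<noteq> x" using that k kG by (metis inv_apply(1))
      then show ?thesis using kD that by blast
    qed
    obtain h where h: "h \<in> supported \<Gamma>" "h (k b2) = k c"
    proof (rule transitive_onE[OF tr\<Gamma>])
      show "k b2 \<in> \<Gamma>" by (rule kne) (use b B(1) in auto)
      show "k c \<in> \<Gamma>" by (rule kne) (use b c in auto)
    qed
    let ?m = "inv k \<circ> h \<circ> k"
    have m: "?m \<in> supported ?D"
      using k h supported_mono[of \<Gamma> ?D] by (intro supported_comp supported_inv) auto
    have "h x = x" using h x by (simp add: supported_def)
    then have m1: "?m b1 = b1" using k kG by (metis comp_apply inv_apply(1))
    have m2: "?m b2 = c" using h kG by simp
    have "b1 \<in> ?m ` B" using imageI[OF b(1), of ?m] unfolding m1 .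
    moreover have "c \<in> ?m ` B" using imageI[OF b(2), of ?m] unfolding m2 .
    ultimately have "B \<inter> ?m ` B \<noteq> {}" "?m ` B \<noteq> B" using b c by blast+
    with m show "\<exists>h\<in>supported ?D. B \<inter> h ` B \<noteq> {} \<and> h ` B \<noteq> B" by blast
  qed
  with trD x show ?thesis by blast
qed

text \<open>Both tuples are moved so that they start with \<open>x\<close>; the tails then lie in
  \<open>\<Gamma>\<close>, where \<open>supported \<Gamma>\<close>, which fixes \<open>x\<close>, is
  \<open>l\<close>-fold transitive.\<close>

lemma multi_transitive_insert:
  assumes "x \<notin> \<Gamma>" "transitive_on (insert x \<Gamma>)" "multi_transitive_on l \<Gamma>"
  shows "multi_transitive_on (Suc l) (insert x \<Gamma>)"
  unfolding multi_transitive_on_def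
proof (intro allI impI, elim conjE)
  let ?D = "insert x \<Gamma>"
  fix xs ys assume *: "distinct xs" "distinct ys" "length xs = Suc l" "length ys = Suc l"
    "set xs \<subseteq> ?D" "set ys \<subseteq> ?D"
  obtain a as where xs: "xs = a # as" using *(3) by (cases xs) auto
  obtain b bs where ys: "ys = b # bs" using *(4) by (cases ys) auto
  obtain h where h: "h \<in> supported ?D" "h a = x"
    using transitive_onE[OF assms(2), of a x] * xs by auto
  obtain k where k: "k \<in> supported ?D" "k b = x"
    using transitive_onE[OF assms(2), of b x] * ys by auto
  have into: "distinct (map f zs) \<and> set (map f zs) \<subseteq> \<Gamma>"
    if f: "f \<in> supported ?D" "f z = x" and z: "distinct (z # zs)" "set zs \<subseteq> ?D" for f z zs
  proof -
    have fG: "f \<in> G" using f by (simp add: supported_def)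
    have inj: "inj f" using bij_mem[OF fG] bij_is_inj by blast
    have "f y \<in> \<Gamma>" if "y \<in> set zs" for y
    proof -
      have "f y \<noteq> x" using that z f inj by (metis distinct.simps(2) injD)
      moreover have "f y \<in> ?D" using supported_image[OF f(1)] that z by blast
      ultimately show ?thesis by simp
    qed
    then show ?thesis using inj z by (auto simp: distinct_map inj_on_def inj_def)
  qed
  obtain m where m: "m \<in> supported \<Gamma>" "map m (map h as) = map k bs"
    using assms(3) into[OF h, of as] into[OF k, of bs] * xs ys unfolding multi_transitive_on_def
    by (metis (no_types, lifting) length_Cons length_map nat.inject insert_subset list.simps(15))
  have kG: "k \<in> G" using k by (simp add: supported_def)
  let ?g = "inv k \<circ> m \<circ> h"
  have "?g \<in> supported ?D"
    using k h m supported_mono[of \<Gamma> ?D] by (intro supported_comp supported_inv) auto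
  moreover have "map ?g xs = ys"
  proof -
    have "m x = x" using m assms(1) by (simp add: supported_def)
    then have "?g a = b" using h k kG by (metis comp_apply inv_apply(1))
    moreover have "map ?g as = map (inv k) (map m (map h as))" by simp
    then have "map ?g as = map (inv k \<circ> k) bs" unfolding m(2) by simp
    then have "map ?g as = bs" using kG by (simp add: o_def)
    ultimately show ?thesis using xs ys by simp
  qed
  ultimately show "\<exists>g\<in>supported ?D. map g xs = ys" by blast
qed

end

section \<open>Cycles of prime length and multiple transitivity\<close>

lemma funpow_image_eq:
  assumes "f ` B = B"
  shows "(f ^^ k) ` B = B"
proof (induction k)
  case (Suc k)
  have "(f ^^ Suc k) ` B = f ` ((f ^^ k) ` B)" by (simp add: image_image)
  then show ?case using Suc assms by simp
qed simp

context perm_group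
begin

text \<open>Every nontrivial cycle of \<open>\<sigma>\<close> has length \<open>p\<close>, and fewer
  than \<open>2 * p\<close> points leave no room for two of them.\<close>

lemma support_of_prime_order:
  fixes p :: nat
  assumes p: "prime p" and \<sigma>: "\<sigma> permutes \<Omega>" "\<sigma> ^^ p = id" "\<sigma> \<noteq> id" and big: "card \<Omega> < 2 * p"
  shows "card {x. \<sigma> x \<noteq> x} = p"
    and "\<And>x y. \<sigma> x \<noteq> x \<Longrightarrow> \<sigma> y \<noteq> y \<Longrightarrow> \<exists>i<p. (\<sigma> ^^ i) x = y"
proof -
  let ?\<Gamma> = "{x. \<sigma> x \<noteq> x}"
  have inj: "inj \<sigma>" using \<sigma>(1) by (rule permutes_inj)
  have injp: "inj (\<sigma> ^^ i)" for i using inj by (rule inj_fn)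
  have p0: "p > 0" using p by (rule prime_gt_0_nat)
  have cl: "(\<sigma> ^^ p) x = x" for x using \<sigma>(2) by simp
  define C where "C x = (\<lambda>i. (\<sigma> ^^ i) x) ` {..<p}" for x
  have \<Gamma>\<Omega>: "?\<Gamma> \<subseteq> \<Omega>" using \<sigma>(1) by (auto simp: permutes_def)
  have fin: "finite ?\<Gamma>" using \<Gamma>\<Omega> finite_points finite_subset by blast
  have C\<Gamma>: "C x \<subseteq> ?\<Gamma>" if "\<sigma> x \<noteq> x" for x
  proof -
    have "\<sigma> ((\<sigma> ^^ i) x) \<noteq> (\<sigma> ^^ i) x" for i
    proof
      assume "\<sigma> ((\<sigma> ^^ i) x) = (\<sigma> ^^ i) x"
      then have "(\<sigma> ^^ i) (\<sigma> x) = (\<sigma> ^^ i) x" by (simp add: funpow_swap1)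
      then have "\<sigma> x = x" by (rule injD[OF injp])
      with that show False by simp
    qed
    then show ?thesis by (auto simp: C_def)
  qed
  have cC: "card (C x) = p" if "\<sigma> x \<noteq> x" for x
    using inj_on_funpow_prime[OF p cl that] by (simp add: C_def card_image)
  have finC: "finite (C x)" for x by (simp add: C_def)
  show reach: "\<exists>i<p. (\<sigma> ^^ i) x = y" if xy: "\<sigma> x \<noteq> x" "\<sigma> y \<noteq> y" for x y
  proof -
    have "C x \<inter> C y \<noteq> {}"
    proof
      assume "C x \<inter> C y = {}"
      then have "card (C x \<union> C y) = p + p" using cC xy finC by (simp add: card_Un_disjoint)
      moreover have "card (C x \<union> C y) \<le> card \<Omega>"
        using C\<Gamma> xy \<Gamma>\<Omega> finite_points by (intro card_mono) blast+
      ultimately show False using big by simp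
    qed
    then obtain i j where ij: "(\<sigma> ^^ i) x = (\<sigma> ^^ j) y" "i < p" "j < p" by (auto simp: C_def)
    have "y = (\<sigma> ^^ (p - j + j)) y" using ij cl by simp
    also have "\<dots> = (\<sigma> ^^ (p - j + i)) x" using ij(1) by (simp only: funpow_add o_apply)
    also have "\<dots> = (\<sigma> ^^ ((p - j + i) mod p)) x" by (rule funpow_mod_eq[OF cl, symmetric])
    finally show ?thesis using p0 by (intro exI[of _ "(p - j + i) mod p"]) simp
  qed
  obtain x where x: "\<sigma> x \<noteq> x" using \<sigma>(3) by (auto simp: fun_eq_iff)
  have "?\<Gamma> \<subseteq> C x"
  proof
    fix y assume "y \<in> ?\<Gamma>"
    then obtain i where "i < p" "(\<sigma> ^^ i) x = y" using reach[of x y] x by auto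
    then show "y \<in> C x" by (auto simp: C_def)
  qed
  then have "?\<Gamma> = C x" using C\<Gamma>[OF x] by (rule subset_antisym)
  then show "card ?\<Gamma> = p" using cC[OF x] by simp
qed

text \<open>For primitivity, \<open>i\<close> is chosen so that \<open>\<sigma> ^^ i\<close> takes
  one point of \<open>B\<close> to another. As \<open>0 < i < p\<close>, this power generates the
  same cyclic group as \<open>\<sigma>\<close>, so a \<open>B\<close> invariant under it would be
  invariant under the cycle and equal to \<open>\<Gamma>\<close>.\<close>

lemma prime_cycle_transitive_primitive:
  fixes p :: nat
  assumes p: "prime p" and \<sigma>: "\<sigma> \<in> G" "\<sigma> ^^ p = id" "\<sigma> \<noteq> id" and big: "card \<Omega> < 2 * p"
  defines "\<Gamma> \<equiv> {x. \<sigma> x \<noteq> x}"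
  shows "transitive_on \<Gamma>" "primitive_on \<Gamma>"
proof -
  have pow: "\<sigma> ^^ i \<in> supported \<Gamma>" for i
  proof (induction i)
    case 0
    show ?case using supported_id by (simp add: id_def)
  next
    case (Suc i)
    have "\<sigma> \<in> supported \<Gamma>" using \<sigma>(1) by (simp add: supported_def \<Gamma>_def)
    then show ?case unfolding funpow.simps using Suc.IH by (rule supported_comp)
  qed
  have reach: "\<exists>i<p. (\<sigma> ^^ i) x = y" if "x \<in> \<Gamma>" "y \<in> \<Gamma>" for x y
    using support_of_prime_order(2)[OF p permutes[OF \<sigma>(1)] \<sigma>(2,3) big] that
    by (simp add: \<Gamma>_def)
  show "transitive_on \<Gamma>"
    unfolding transitive_on_def using reach pow by blast
  show "primitive_on \<Gamma>"
    unfolding primitive_on_def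
  proof (intro allI impI, elim conjE)
    fix B assume B: "B \<subseteq> \<Gamma>" "2 \<le> card B" "B \<noteq> \<Gamma>"
    obtain b1 b2 where b: "b1 \<in> B" "b2 \<in> B" "b1 \<noteq> b2"
      using B(2) by (metis card_2_iff' obtain_subset_with_card_n subset_iff)
    then obtain i where i: "i < p" "(\<sigma> ^^ i) b1 = b2" using reach[of b1 b2] B(1) by blast
    have "i > 0" using i b by (cases i) auto
    have "coprime i p"
      using p i \<open>i > 0\<close> by (metis coprime_commute nat_dvd_not_less prime_imp_coprime)
    then obtain a c where ac: "i * a = p * c + 1"
      using coprime_bezout_strong[of i p] prime_gt_1_nat[OF p] by auto
    let ?h = "\<sigma> ^^ i"
    have "?h ^^ a = \<sigma> ^^ (p * c + 1)" by (simp only: funpow_mult ac)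
    also have "\<dots> = \<sigma>"
      using \<sigma>(2) by (simp add: funpow_add funpow_mult[symmetric] id_def[symmetric])
    finally have ha: "?h ^^ a = \<sigma>" .
    have "?h ` B \<noteq> B"
    proof
      assume hB: "?h ` B = B"
      have "(?h ^^ k) ` B = B" for k
        using hB by (rule funpow_image_eq)
      then have \<sigma>B: "\<sigma> ` B = B" using ha by metis
      have "(\<sigma> ^^ k) ` B = B" for k
        using \<sigma>B by (rule funpow_image_eq)
      then have "(\<sigma> ^^ k) b1 \<in> B" for k using b(1) by blast
      then have "\<Gamma> \<subseteq> B" using reach[of b1] b(1) B(1) by blast
      with B show False by blast
    qed
    moreover have "b2 \<in> B \<inter> ?h ` B" using b i by blast
    ultimately show "\<exists>h\<in>supported \<Gamma>. B \<inter> h ` B \<noteq> {} \<and> h ` B \<noteq> B" using pow by blast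
  qed
qed

text \<open>Each added point raises the degree of transitivity by one, and the enlarged set still
  has more than half of the points, so the enlargement can be repeated up to
  \<open>\<Omega>\<close>.\<close>

lemma grow_multi_transitive:
  assumes "\<Gamma> \<subseteq> \<Omega>" "card \<Omega> < 2 * card \<Gamma>" "primitive_on \<Gamma>" "transitive_on \<Gamma>" "transitive_on \<Omega>"
    "multi_transitive_on l \<Gamma>"
  shows "multi_transitive_on (card \<Omega> - card \<Gamma> + l) \<Omega>"
  using assms
proof (induction "card \<Omega> - card \<Gamma>" arbitrary: \<Gamma> l)
  case 0
  then have "\<Gamma> = \<Omega>" using finite_points by (intro card_seteq) auto
  then show ?case using 0 by simp
next
  case (Suc k)
  have fin: "finite \<Gamma>" using Suc.prems(1) finite_points finite_subset by blast
  have "\<Gamma> \<noteq> \<Omega>" using Suc.hyps(2) by auto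
  then obtain x where x: "x \<in> \<Omega> - \<Gamma>" "transitive_on (insert x \<Gamma>)" "primitive_on (insert x \<Gamma>)"
    using enlarge[of \<Gamma>] Suc.prems by auto
  have c: "card (insert x \<Gamma>) = Suc (card \<Gamma>)" using x fin by simp
  have mt: "multi_transitive_on (Suc l) (insert x \<Gamma>)"
    using multi_transitive_insert[of x \<Gamma> l] x Suc.prems by auto
  have "multi_transitive_on (card \<Omega> - card (insert x \<Gamma>) + Suc l) \<Omega>"
  proof (rule Suc.hyps(1))
    show "k = card \<Omega> - card (insert x \<Gamma>)" using Suc.hyps(2) c by simp
    show "insert x \<Gamma> \<subseteq> \<Omega>" using x Suc.prems by auto
    show "card \<Omega> < 2 * card (insert x \<Gamma>)" using c Suc.prems by simp
  qed (use x mt Suc.prems in auto)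
  moreover have "card \<Omega> - card (insert x \<Gamma>) + Suc l = card \<Omega> - card \<Gamma> + l"
    using c Suc.hyps(2) by simp
  ultimately show ?case by (simp only:)
qed

lemma homog_if_multi_transitive:
  assumes mt: "multi_transitive_on N \<Omega>" and "d \<le> N" "N \<le> card \<Omega>"
  shows "homog d"
  unfolding homog_def
proof (intro allI impI, elim conjE)
  fix X Y assume XY: "X \<subseteq> \<Omega>" "Y \<subseteq> \<Omega>" "card X = d" "card Y = d"
  have ext: "\<exists>xs zs. distinct (xs @ zs) \<and> set xs = X \<and> length xs = d \<and> length (xs @ zs) = N \<and> set (xs @ zs) \<subseteq> \<Omega>"
    if X: "X \<subseteq> \<Omega>" "card X = d" for X
  proof -
    have fin: "finite X" "finite (\<Omega> - X)" using X finite_points finite_subset by blast+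
    obtain xs where xs: "set xs = X" "distinct xs" using finite_distinct_list[OF fin(1)] by blast
    have "N - d \<le> card (\<Omega> - X)" using X fin assms by (simp add: card_Diff_subset)
    then obtain Z where Z: "Z \<subseteq> \<Omega> - X" "card Z = N - d" "finite Z"
      by (meson obtain_subset_with_card_n)
    obtain zs where zs: "set zs = Z" "distinct zs" using finite_distinct_list[OF Z(3)] by blast
    have "length xs = d" "length zs = N - d" using xs zs X Z distinct_card by fastforce+
    then show ?thesis using xs zs X Z assms(2) by (intro exI[of _ xs] exI[of _ zs]) auto
  qed
  obtain xs xs' where xs: "distinct (xs @ xs')" "set xs = X" "length xs = d" "length (xs @ xs') = N"
    "set (xs @ xs') \<subseteq> \<Omega>" using ext[OF XY(1,3)] by blast
  obtain ys ys' where ys: "distinct (ys @ ys')" "set ys = Y" "length ys = d" "length (ys @ ys') = N"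
    "set (ys @ ys') \<subseteq> \<Omega>" using ext[OF XY(2,4)] by blast
  obtain g where g: "g \<in> supported \<Omega>" "map g (xs @ xs') = ys @ ys'"
    using mt xs ys unfolding multi_transitive_on_def by blast
  then have "map g xs = ys" using xs ys by simp
  then have "g ` X = Y" using xs ys by (metis set_map)
  then show "\<exists>g\<in>G. g ` X = Y" using g by (auto simp: supported_points)
qed

lemma transitive_if_homog:
  assumes "homog 1"
  shows "transitive_on \<Omega>"
  unfolding transitive_on_def supported_points
proof (intro ballI)
  fix x y assume "x \<in> \<Omega>" "y \<in> \<Omega>"
  then obtain g where "g \<in> G" "g ` {x} = {y}" using homogD[OF assms, of "{x}" "{y}"] by auto
  then show "\<exists>g\<in>G. g x = y" by auto
qed

section \<open>Cauchy's theorem and conjugation into a cyclic group\<close>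

lemma cauchy:
  fixes p :: nat
  assumes p: "prime p" and dvd: "p dvd card G"
  shows "\<exists>\<sigma>\<in>G. \<sigma> \<noteq> id \<and> \<sigma> ^^ p = id"
proof -
  \<comment> \<open>McKay's proof: \<open>p\<close>-tuples with product \<open>id\<close> are
    rotated. The first entry is determined by the others, so their number is a power of
    \<open>card G\<close>; the fixed tuples are the constant ones, and their number is divisible by
    \<open>p\<close>, so the tuple of identities is not the only one.\<close>
  define X where "X = {xs. set xs \<subseteq> G \<and> length xs = p \<and> foldr (\<circ>) xs id = id}"
  let ?L = "{ys. set ys \<subseteq> G \<and> length ys = p - 1}"
  have p1: "p > 1" using p by (rule prime_gt_1_nat)
  have foldr_mem: "foldr (\<circ>) ys id \<in> G" if "set ys \<subseteq> G" for ys
    using that by (induction ys) (auto simp: id_mem comp_mem)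
  have foldr_app: "foldr (\<circ>) (xs @ ys) id = foldr (\<circ>) xs id \<circ> foldr (\<circ>) ys id" for xs ys :: "('a \<Rightarrow> 'a) list"
    by (induction xs) (auto simp: comp_assoc)
  have "bij_betw tl X ?L"
  proof (rule bij_betwI[where g = "\<lambda>ys. inv (foldr (\<circ>) ys id) # ys"])
    show "tl \<in> X \<rightarrow> ?L" unfolding X_def by (auto dest: list.set_sel(2)[rotated])
        (metis (no_types, lifting) list.sel(2) list.set_sel(2) subsetD)
    show "(\<lambda>ys. inv (foldr (\<circ>) ys id) # ys) \<in> ?L \<rightarrow> X"
    proof
      fix ys assume ys: "ys \<in> ?L"
      have "foldr (\<circ>) ys id \<in> G" using ys foldr_mem by simp
      then have "inv (foldr (\<circ>) ys id) \<circ> foldr (\<circ>) ys id = id" using bij_mem by (simp add: bij_is_inj)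
      with ys p1 inv_mem foldr_mem show "inv (foldr (\<circ>) ys id) # ys \<in> X" by (auto simp: X_def)
    qed
    show "inv (foldr (\<circ>) (tl xs) id) # tl xs = xs" if xX: "xs \<in> X" for xs
    proof -
      obtain x ys where xs: "xs = x # ys" using xX p1 by (cases xs) (auto simp: X_def)
      have "foldr (\<circ>) ys id \<in> G" using xX foldr_mem xs by (simp add: X_def)
      then have b: "bij (foldr (\<circ>) ys id)" by (rule bij_mem)
      have "x \<circ> foldr (\<circ>) ys id = id" using xX xs by (simp add: X_def)
      then have "x \<circ> (foldr (\<circ>) ys id \<circ> inv (foldr (\<circ>) ys id)) = inv (foldr (\<circ>) ys id)"
        by (simp add: comp_assoc[symmetric])
      moreover have "foldr (\<circ>) ys id \<circ> inv (foldr (\<circ>) ys id) = id"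
        using b by (simp add: surj_iff[symmetric] bij_is_surj)
      ultimately have "x = inv (foldr (\<circ>) ys id)" by simp
      then show ?thesis using xs by simp
    qed
  qed simp
  then have "card X = card ?L" by (rule bij_betw_same_card)
  also have "\<dots> = card G ^ (p - 1)" by (rule card_lists_length_eq[OF finite_group])
  also have "card G dvd card G ^ (p - 1)" using p1 by (intro dvd_power) simp
  then have "p dvd card G ^ (p - 1)" using dvd by (rule dvd_trans[rotated])
  finally have cX: "card X mod p = 0" by simp
  have finX: "finite X"
    by (rule finite_subset[OF _ finite_lists_length_eq[OF finite_group, of p]]) (auto simp: X_def)
  have rot: "rotate1 ` X \<subseteq> X"
  proof
    fix zs assume "zs \<in> rotate1 ` X"
    then obtain xs where xs: "xs \<in> X" "zs = rotate1 xs" by blast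
    then obtain x ys where "xs = x # ys" using p1 by (cases xs) (auto simp: X_def)
    then have z: "zs = ys @ [x]" "x # ys \<in> X" using xs by simp_all
    have xG: "x \<in> G" and yG: "foldr (\<circ>) ys id \<in> G" using z foldr_mem by (auto simp: X_def)
    have "x \<circ> foldr (\<circ>) ys id = id" using z by (simp add: X_def)
    then have "inv x \<circ> (x \<circ> foldr (\<circ>) ys id) \<circ> x = inv x \<circ> x" by simp
    then have "foldr (\<circ>) ys id \<circ> x = id" using xG by (simp add: comp_assoc[symmetric] bij_mem bij_is_inj)
    then show "zs \<in> X" using z by (simp add: X_def foldr_app del: foldr_append)
  qed
  have "(rotate1 ^^ p) xs = xs" if "xs \<in> X" for xs
    using that rotate_id[of p xs] by (simp add: X_def rotate_def)
  then have fp: "card X mod p = card {xs\<in>X. rotate1 xs = xs} mod p"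
    by (rule card_mod_prime_fixed_points[OF p finX rot])
  have foldr_rep: "foldr (\<circ>) (replicate k x) id = x ^^ k" for k and x :: "'a \<Rightarrow> 'a"
    by (induction k) (auto simp: id_def)
  have rep_id: "replicate p id \<in> {xs\<in>X. rotate1 xs = xs}"
  proof -
    have "id ^^ p = (id :: 'a \<Rightarrow> 'a)" by (induction p) auto
    moreover have "rotate1 (replicate p (id :: 'a \<Rightarrow> 'a)) = replicate p id"
      by (cases p) (auto simp: replicate_append_same)
    moreover have "foldr (\<circ>) (replicate p id) id = (id :: 'a \<Rightarrow> 'a)"
      unfolding foldr_rep by fact
    ultimately show ?thesis using id_mem by (auto simp: X_def)
  qed
  have "\<exists>xs\<in>{xs\<in>X. rotate1 xs = xs}. xs \<noteq> replicate p id"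
  proof (rule ccontr)
    assume "\<not> ?thesis"
    then have "{xs\<in>X. rotate1 xs = xs} = {replicate p id}" using rep_id by blast
    with fp cX p1 show False by simp
  qed
  then obtain xs where xs: "xs \<in> X" "rotate1 xs = xs" "xs \<noteq> replicate p id" by blast
  have len: "length xs = p" using xs by (simp add: X_def)
  have all: "xs ! i = xs ! 0" if "i < p" for i
    using that
  proof (induction i)
    case (Suc i)
    have "rotate1 xs ! i = xs ! (Suc i mod length xs)" by (rule nth_rotate1) (use Suc len in simp)
    then show ?case using Suc xs(2) len by simp
  qed simp
  define x0 where "x0 = xs ! 0"
  have all': "xs ! i = x0" if "i < p" for i using all[OF that] by (simp only: x0_def)
  have rep: "xs = replicate p x0"
    by (rule nth_equalityI) (use len all' in auto)
  have "x0 \<noteq> id" using rep xs(3) by auto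
  moreover have "x0 \<in> G" using xs(1) rep p1 by (simp add: X_def)
  moreover have "foldr (\<circ>) (replicate p x0) id = id" using xs(1) unfolding rep by (simp add: X_def)
  then have "x0 ^^ p = id" unfolding foldr_rep .
  ultimately show ?thesis by blast
qed

text \<open>A map that commutes with a transitive cycle is determined by its value at one point,
  where it agrees with a power of \<open>\<sigma>\<close>.\<close>

lemma commuting_with_cycle:
  fixes p :: nat
  assumes reach: "\<And>x y. x \<in> \<Gamma> \<Longrightarrow> y \<in> \<Gamma> \<Longrightarrow> \<exists>i. (\<sigma> ^^ i) x = y"
    and c: "c \<circ> \<sigma> = \<sigma> \<circ> c" "c ` \<Gamma> = \<Gamma>"
  shows "\<exists>i. \<forall>x\<in>\<Gamma>. c x = (\<sigma> ^^ i) x"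
proof (cases "\<Gamma> = {}")
  case False
  then obtain x0 where x0: "x0 \<in> \<Gamma>" by blast
  then have "c x0 \<in> \<Gamma>" using c(2) by blast
  then obtain i where i: "(\<sigma> ^^ i) x0 = c x0" using reach[OF x0] by blast
  have comm: "c ((\<sigma> ^^ k) x) = (\<sigma> ^^ k) (c x)" for k x
    using c(1) by (induction k) (auto simp: fun_eq_iff)
  have "c x = (\<sigma> ^^ i) x" if x: "x \<in> \<Gamma>" for x
  proof -
    obtain k where k: "x = (\<sigma> ^^ k) x0" using reach[OF x0 x] by blast
    then have "c x = (\<sigma> ^^ k) ((\<sigma> ^^ i) x0)" using comm i by simp
    also have "\<dots> = (\<sigma> ^^ (k + i)) x0" by (simp only: funpow_add o_apply)
    also have "\<dots> = (\<sigma> ^^ (i + k)) x0" by (simp only: add.commute)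
    also have "\<dots> = (\<sigma> ^^ i) x" using k by (simp only: funpow_add o_apply)
    finally show ?thesis .
  qed
  then show ?thesis by blast
qed simp

text \<open>A Sylow-type statement.  The cosets of \<open>\<langle>\<sigma>\<rangle>\<close> in \<open>supported \<Gamma>\<close> that are fixed by \<open>\<sigma>\<close> correspond
  to elements of the normaliser modulo \<open>\<langle>\<sigma>\<rangle>\<close>, so there are between \<open>1\<close> and \<open>p - 1\<close> of them. Hence
  the number of cosets is prime to \<open>p\<close> and every \<open>\<tau>\<close> of order \<open>p\<close> fixes a coset.\<close>

lemma conjugate_into_cycle_group:
  fixes p :: nat
  assumes p: "prime p" and \<sigma>: "\<sigma> \<in> supported \<Gamma>" "\<sigma> ^^ p = id" "\<sigma> \<noteq> id"
    and reach: "\<And>x y. x \<in> \<Gamma> \<Longrightarrow> y \<in> \<Gamma> \<Longrightarrow> \<exists>i. (\<sigma> ^^ i) x = y"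
    and \<tau>: "\<tau> \<in> supported \<Gamma>" "\<tau> ^^ p = id"
  shows "\<exists>l\<in>supported \<Gamma>. \<exists>u. \<tau> \<circ> l = l \<circ> \<sigma> ^^ u"
proof -
  let ?L = "supported \<Gamma>"
  have p0: "p > 0" using p by (rule prime_gt_0_nat)
  have finL: "finite ?L" using finite_group by (rule finite_subset[rotated]) (auto simp: supported_def)
  have LG: "?L \<subseteq> G" by (auto simp: supported_def)
  \<comment> \<open>\<open>cs l\<close> is the left coset of \<open>l\<close> modulo
    \<langle>\<sigma>\<rangle>; natural exponents suffice because \<open>\<sigma>\<close> has finite
    order.\<close>
  define cs where "cs l = range (\<lambda>i::nat. l \<circ> \<sigma> ^^ i)" for l :: "'a \<Rightarrow> 'a"
  define X where "X = cs ` ?L"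
  have finX: "finite X" using finL by (simp add: X_def)
  have pow_mod: "\<sigma> ^^ i = \<sigma> ^^ (i mod p)" for i
    by (rule ext, rule funpow_mod_eq[symmetric]) (simp add: \<sigma>(2))
  have cs_shift: "cs (l \<circ> \<sigma> ^^ u) = cs l" for l u
  proof
    show "cs (l \<circ> \<sigma> ^^ u) \<subseteq> cs l"
      by (auto simp: cs_def comp_assoc funpow_add[symmetric])
    show "cs l \<subseteq> cs (l \<circ> \<sigma> ^^ u)"
    proof
      fix f assume "f \<in> cs l"
      then obtain i where f: "f = l \<circ> \<sigma> ^^ i" by (auto simp: cs_def)
      \<comment> \<open>The extra exponent \<open>(p - 1) * u\<close> undoes
        \<open>\<sigma> ^^ u\<close>, the total \<open>p * u\<close> being trivial.\<close>
      have "u + (i + (p - 1) * u) = i + p * u" using p0 by (cases p) auto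
      then have "(u + (i + (p - 1) * u)) mod p = i mod p"
        by (simp only: mod_mult_self2)
      then have "\<sigma> ^^ (u + (i + (p - 1) * u)) = \<sigma> ^^ i" by (metis pow_mod)
      then have "f = (l \<circ> \<sigma> ^^ u) \<circ> \<sigma> ^^ (i + (p - 1) * u)"
        using f by (simp only: comp_assoc funpow_add)
      then show "f \<in> cs (l \<circ> \<sigma> ^^ u)" by (auto simp: cs_def)
    qed
  qed
  have cs_self: "l \<in> cs l" for l
    unfolding cs_def by (rule range_eqI[of _ _ 0]) (simp add: id_def[symmetric])
  define act where "act t C = (\<lambda>f. t \<circ> f) ` C" for t :: "'a \<Rightarrow> 'a" and C :: "('a \<Rightarrow> 'a) set"
  have act_cs: "act t (cs l) = cs (t \<circ> l)" for t l
    by (auto simp: act_def cs_def comp_assoc image_image)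
  have act_pow: "(act t ^^ k) (cs l) = cs ((t ^^ k) \<circ> l)" for t k l
    by (induction k) (simp_all add: act_cs o_def)
  have count: "card X mod p = card {C\<in>X. act t C = C} mod p" if t: "t \<in> ?L" "t ^^ p = id" for t
  proof (rule card_mod_prime_fixed_points[OF p finX])
    show "act t ` X \<subseteq> X" using t supported_comp by (auto simp: X_def act_cs)
    show "(act t ^^ p) C = C" if "C \<in> X" for C
      using that t by (auto simp: X_def act_pow)
  qed
  have fixed: "\<exists>u. t \<circ> l = l \<circ> \<sigma> ^^ u" if "act t (cs l) = cs l" for t l
  proof -
    have "t \<circ> l \<in> cs l" using cs_self[of "t \<circ> l"] that act_cs by simp
    then show ?thesis by (auto simp: cs_def)
  qed
  let ?F = "{C\<in>X. act \<sigma> C = C}"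
  have "\<forall>C\<in>?F. \<exists>l u. l \<in> ?L \<and> C = cs l \<and> u < p \<and> \<sigma> \<circ> l = l \<circ> \<sigma> ^^ u"
  proof
    fix C assume C: "C \<in> ?F"
    then obtain l where l: "l \<in> ?L" "C = cs l" by (auto simp: X_def)
    then obtain u where "\<sigma> \<circ> l = l \<circ> \<sigma> ^^ u" using C fixed by blast
    then have "\<sigma> \<circ> l = l \<circ> \<sigma> ^^ (u mod p)" using pow_mod by metis
    with l show "\<exists>l u. l \<in> ?L \<and> C = cs l \<and> u < p \<and> \<sigma> \<circ> l = l \<circ> \<sigma> ^^ u"
      using p0 by (intro exI[of _ l] exI[of _ "u mod p"]) auto
  qed
  from bchoice[OF this] obtain rep where
    "\<forall>C\<in>?F. \<exists>u. rep C \<in> ?L \<and> C = cs (rep C) \<and> u < p \<and> \<sigma> \<circ> rep C = rep C \<circ> \<sigma> ^^ u" ..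
  from bchoice[OF this] obtain ex where
    ex: "\<forall>C\<in>?F. rep C \<in> ?L \<and> C = cs (rep C) \<and> ex C < p \<and> \<sigma> \<circ> rep C = rep C \<circ> \<sigma> ^^ ex C" ..
  note re = bspec[OF ex]
  \<comment> \<open>A fixed coset is determined by its exponent: two representatives with the same
    exponent differ by an element that commutes with \<open>\<sigma>\<close>, hence by a power of
    \<open>\<sigma>\<close>.\<close>
  have inj_ex: "inj_on ex ?F"
  proof (rule inj_onI)
    fix C D assume CD: "C \<in> ?F" "D \<in> ?F" "ex C = ex D"
    let ?l = "rep C" and ?l' = "rep D"
    have l: "?l \<in> ?L" "?l' \<in> ?L" "\<sigma> \<circ> ?l = ?l \<circ> \<sigma> ^^ ex C" "\<sigma> \<circ> ?l' = ?l' \<circ> \<sigma> ^^ ex C"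
      using re[OF CD(1)] re[OF CD(2)] CD(3) by auto
    have lG: "?l \<in> G" using l LG by blast
    have lin: "inv ?l \<circ> ?l = id" "?l \<circ> inv ?l = id" using lG by (auto simp: fun_eq_iff)
    let ?m = "?l' \<circ> inv ?l"
    have e: "?m \<circ> ?l = ?l'" using lin by (simp add: comp_assoc)
    have "(?m \<circ> \<sigma>) \<circ> ?l = (\<sigma> \<circ> ?m) \<circ> ?l"
    proof -
      have "(?m \<circ> \<sigma>) \<circ> ?l = ?m \<circ> (\<sigma> \<circ> ?l)" by (simp only: comp_assoc)
      also have "\<dots> = (?m \<circ> ?l) \<circ> \<sigma> ^^ ex C" by (simp only: l comp_assoc)
      also have "\<dots> = \<sigma> \<circ> ?l'" by (simp only: e l)
      also have "\<dots> = (\<sigma> \<circ> ?m) \<circ> ?l" by (simp only: comp_assoc lin comp_id)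
      finally show ?thesis .
    qed
    then have "(?m \<circ> \<sigma>) \<circ> (?l \<circ> inv ?l) = (\<sigma> \<circ> ?m) \<circ> (?l \<circ> inv ?l)"
      by (simp only: comp_assoc[symmetric])
    then have comm: "?m \<circ> \<sigma> = \<sigma> \<circ> ?m" by (simp only: lin comp_id)
    have mL: "?m \<in> ?L" using l by (intro supported_comp supported_inv)
    obtain i where i: "\<forall>x\<in>\<Gamma>. ?m x = (\<sigma> ^^ i) x"
      using commuting_with_cycle[OF reach comm supported_image[OF mL]] by blast
    have \<sigma>i: "(\<sigma> ^^ i) x = x" if "x \<notin> \<Gamma>" for x
      using \<sigma>(1) that by (induction i) (auto simp: supported_def)
    have "?m = \<sigma> ^^ i"
    proof
      fix x show "?m x = (\<sigma> ^^ i) x"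
        using i \<sigma>i mL by (cases "x \<in> \<Gamma>") (auto simp: supported_def)
    qed
    then have l': "?l' = \<sigma> ^^ i \<circ> ?l" using e by simp
    have "\<sigma> ^^ k \<circ> ?l = ?l \<circ> (\<sigma> ^^ ex C) ^^ k" for k
    proof (induction k)
      case (Suc k)
      have "\<sigma> ^^ Suc k \<circ> ?l = \<sigma> \<circ> (\<sigma> ^^ k \<circ> ?l)" by (simp add: comp_assoc)
      also have "\<dots> = (\<sigma> \<circ> ?l) \<circ> (\<sigma> ^^ ex C) ^^ k" by (simp only: Suc comp_assoc)
      also have "\<dots> = ?l \<circ> (\<sigma> ^^ ex C) ^^ Suc k" by (simp only: l(3) comp_assoc funpow.simps)
      finally show ?case .
    qed (simp add: id_def[symmetric])
    then have "?l' = ?l \<circ> \<sigma> ^^ (ex C * i)" using l' by (simp add: funpow_mult)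
    then have "cs ?l' = cs ?l" by (simp only: cs_shift)
    then show "C = D" using re[OF CD(1)] re[OF CD(2)] by simp
  qed
  have "ex ` ?F \<subseteq> {1..<p}"
  proof
    fix u assume "u \<in> ex ` ?F"
    then obtain C where C: "C \<in> ?F" "u = ex C" by blast
    note r = re[OF C(1)]
    have "u \<noteq> 0"
    proof
      assume "u = 0"
      then have "\<sigma> \<circ> rep C = rep C" using r C by (simp add: id_def[symmetric])
      moreover have "rep C \<circ> inv (rep C) = id" using r LG by (auto simp: fun_eq_iff)
      ultimately have "\<sigma> = id" by (metis comp_assoc comp_id)
      with \<sigma>(3) show False by simp
    qed
    with r C show "u \<in> {1..<p}" by simp
  qed
  then have "card (ex ` ?F) \<le> card {1..<p}" by (rule card_mono[rotated]) simp
  then have "card ?F < p" using card_image[OF inj_ex] p0 by simp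
  moreover have "cs id \<in> ?F"
  proof -
    have "act \<sigma> (cs id) = cs (id \<circ> \<sigma> ^^ 1)" by (simp add: act_cs)
    also have "\<dots> = cs id" by (rule cs_shift)
    finally show ?thesis using supported_id by (simp add: X_def)
  qed
  then have "card ?F > 0" using finX by (auto simp: card_gt_0_iff)
  ultimately have "card X mod p \<noteq> 0" using count[OF \<sigma>(1,2)] by simp
  then have "card {C\<in>X. act \<tau> C = C} mod p \<noteq> 0" using count[OF \<tau>] by simp
  then have "{C\<in>X. act \<tau> C = C} \<noteq> {}" by (metis card.empty mod_0)
  then obtain l where "l \<in> ?L" "act \<tau> (cs l) = cs l" by (auto simp: X_def)
  then show ?thesis using fixed by blast
qed

section \<open>Three-cycles and the conclusion of Jordan's argument\<close>

definition three_cycle :: "'a \<Rightarrow> 'a \<Rightarrow> 'a \<Rightarrow> ('a \<Rightarrow> 'a) \<Rightarrow> bool" where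
  "three_cycle a b c t \<longleftrightarrow> t a = b \<and> t b = c \<and> t c = a \<and> (\<forall>x. x \<noteq> a \<and> x \<noteq> b \<and> x \<noteq> c \<longrightarrow> t x = x)"

text \<open>A 3-cycle through \<open>x\<close>, \<open>y\<close> and a third point replaces
  \<open>x\<close> by \<open>y\<close> in \<open>X\<close>. The third point is taken in
  \<open>X\<close>, or outside \<open>X\<close> and different from \<open>y\<close> if
  \<open>X\<close> is just \<open>{x}\<close>.\<close>

lemma homog_if_three_cycles:
  assumes n3: "card \<Omega> \<ge> 3"
    and tc: "\<And>a b c. a \<in> \<Omega> \<Longrightarrow> b \<in> \<Omega> \<Longrightarrow> c \<in> \<Omega> \<Longrightarrow> distinct [a, b, c] \<Longrightarrow> \<exists>t\<in>G. three_cycle a b c t"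
  shows "homog d"
proof -
  have swap: "\<exists>g\<in>G. g ` X = insert y (X - {x})" if X: "X \<subseteq> \<Omega>" "x \<in> X" "y \<in> \<Omega> - X" for X x y
  proof (cases "X = {x}")
    case True
    have "\<exists>z\<in>\<Omega>. z \<noteq> x \<and> z \<noteq> y"
    proof (rule ccontr)
      assume "\<not> ?thesis"
      then have "\<Omega> \<subseteq> {x, y}" by blast
      then have "card \<Omega> \<le> card {x, y}" by (rule card_mono[rotated]) simp
      also have "\<dots> \<le> 2" by (simp add: card_insert_if)
      finally show False using n3 by simp
    qed
    then obtain z t where "t \<in> G" "three_cycle x y z t" using tc[of x y] X by force
    then show ?thesis using True by (intro bexI[of _ t]) (auto simp: three_cycle_def)
  next
    case False
    then obtain z where z: "z \<in> X" "z \<noteq> x" using X by blast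
    obtain t where t: "t \<in> G" "three_cycle x z y t" using tc[of x z y] X z by force
    have "t ` X = insert y (X - {x})"
    proof -
      have "X = insert x (insert z (X - {x, z}))" using X z by blast
      moreover have "t ` (X - {x, z}) = X - {x, z}"
      proof -
        have "t w = w" if "w \<in> X - {x, z}" for w
          using t(2) X that unfolding three_cycle_def by blast
        then show ?thesis by force
      qed
      ultimately have "t ` X = insert z (insert y (X - {x, z}))"
        using t(2) unfolding three_cycle_def by (metis image_insert)
      moreover have "insert z (insert y (X - {x, z})) = insert y (X - {x})" using z by auto
      ultimately show ?thesis by simp
    qed
    with t show ?thesis by blast
  qed
  show ?thesis
    unfolding homog_def
  proof (intro allI impI, elim conjE)
    fix A B assume AB: "A \<subseteq> \<Omega>" "B \<subseteq> \<Omega>" "card A = d" "card B = d"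
    obtain e :: "'a set \<Rightarrow> int" where e_inv: "\<And>g S. g \<in> G \<Longrightarrow> e (g ` S) = e S" and eA: "e A = 1"
      and eB: "e B = 1 \<Longrightarrow> \<exists>g\<in>G. g ` A = B"
      using orbit_indicator[of A] by metis
    have "e A = e B"
      by (rule exchange_invariant[OF finite_points]) (use AB swap e_inv in \<open>metis, simp_all\<close>)
    then show "\<exists>g\<in>G. g ` A = B" using eA by (intro eB) simp
  qed
qed

lemma three_cycle_conj:
  assumes g: "g \<in> G" and t: "three_cycle a b c t"
  shows "three_cycle (g a) (g b) (g c) (g \<circ> t \<circ> inv g)"
proof -
  have "inv g x \<noteq> a \<and> inv g x \<noteq> b \<and> inv g x \<noteq> c" if "x \<noteq> g a \<and> x \<noteq> g b \<and> x \<noteq> g c" for x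
    using that inv_apply(2)[OF g] by metis
  then show ?thesis using t g unfolding three_cycle_def by simp
qed

lemma comp_inv: "g \<in> G \<Longrightarrow> inv g \<circ> g = id" "g \<in> G \<Longrightarrow> g \<circ> inv g = id"
  by (auto simp: fun_eq_iff)

text \<open>A Frattini argument: the conjugate of \<open>\<sigma>\<close> by \<open>h\<close> is
  again supported on the cycle, so some \<open>l\<close> supported there conjugates it back into
  \<langle>\<sigma>\<rangle>. Correcting \<open>h\<close> by \<open>l\<close> does not change it on
  the fixed points of \<open>\<sigma>\<close>.\<close>

lemma normalising_element:
  fixes p :: nat
  assumes p: "prime p" and \<sigma>: "\<sigma> \<in> G" "\<sigma> ^^ p = id" "\<sigma> \<noteq> id" and big: "card \<Omega> < 2 * p"
    and h: "h \<in> G" "h ` {x. \<sigma> x \<noteq> x} = {x. \<sigma> x \<noteq> x}"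
  shows "\<exists>m\<in>G. \<exists>u. m \<circ> \<sigma> = \<sigma> ^^ u \<circ> m \<and> (\<forall>x. \<sigma> x = x \<longrightarrow> m x = h x)"
proof -
  let ?\<Gamma> = "{x. \<sigma> x \<noteq> x}"
  have \<sigma>L: "\<sigma> \<in> supported ?\<Gamma>" using \<sigma>(1) by (simp add: supported_def)
  have reach: "\<exists>i. (\<sigma> ^^ i) x = y" if "x \<in> ?\<Gamma>" "y \<in> ?\<Gamma>" for x y
    using support_of_prime_order(2)[OF p permutes[OF \<sigma>(1)] \<sigma>(2,3) big] that by auto
  let ?\<tau> = "h \<circ> \<sigma> \<circ> inv h"
  have \<tau>L: "?\<tau> \<in> supported ?\<Gamma>" using supported_conj[OF h(1) \<sigma>L] h(2) by simp
  have hi: "inv h \<circ> h = id" "h \<circ> inv h = id" using h(1) by (auto simp: fun_eq_iff)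
  have "(?\<tau> ^^ k) = h \<circ> \<sigma> ^^ k \<circ> inv h" for k
  proof (induction k)
    case (Suc k)
    have "?\<tau> ^^ Suc k = ?\<tau> \<circ> (h \<circ> \<sigma> ^^ k \<circ> inv h)" by (simp only: funpow.simps Suc)
    also have "\<dots> = h \<circ> \<sigma> \<circ> (inv h \<circ> h) \<circ> \<sigma> ^^ k \<circ> inv h" by (simp only: comp_assoc)
    also have "\<dots> = h \<circ> \<sigma> ^^ Suc k \<circ> inv h" by (simp only: hi comp_id funpow.simps comp_assoc)
    finally show ?case .
  next
    case 0
    show ?case using hi(2) by simp
  qed
  then have "?\<tau> ^^ p = id" using \<sigma>(2) hi(2) by simp
  then obtain l u where l: "l \<in> supported ?\<Gamma>" "?\<tau> \<circ> l = l \<circ> \<sigma> ^^ u"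
    using conjugate_into_cycle_group[OF p \<sigma>L \<sigma>(2,3) reach \<tau>L] by blast
  have lG: "l \<in> G" using l by (simp add: supported_def)
  have li: "inv l \<circ> l = id" "l \<circ> inv l = id" using lG by (auto simp: fun_eq_iff)
  let ?m = "inv l \<circ> h"
  have "?m \<circ> \<sigma> = inv l \<circ> (?\<tau> \<circ> (l \<circ> inv l)) \<circ> h"
    by (simp only: li comp_id comp_assoc hi)
  also have "\<dots> = inv l \<circ> (l \<circ> \<sigma> ^^ u) \<circ> inv l \<circ> h"
    by (simp only: l(2)[symmetric] comp_assoc)
  also have "\<dots> = (inv l \<circ> l) \<circ> \<sigma> ^^ u \<circ> ?m" by (simp only: comp_assoc)
  also have "\<dots> = \<sigma> ^^ u \<circ> ?m" by (simp only: li id_comp)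
  finally have "?m \<circ> \<sigma> = \<sigma> ^^ u \<circ> ?m" .
  moreover have "?m \<in> G" using lG h(1) by (intro comp_mem inv_mem)
  moreover have "?m x = h x" if x: "\<sigma> x = x" for x
  proof -
    have "h x \<notin> ?\<Gamma>"
    proof
      assume "h x \<in> ?\<Gamma>"
      then have "h x \<in> h ` ?\<Gamma>" using h(2) by simp
      then have "x \<in> ?\<Gamma>" using bij_is_inj[OF bij_mem[OF h(1)]] by (simp only: inj_image_mem_iff)
      with x show False by simp
    qed
    then have "inv l (h x) = h x" using supported_inv[OF l(1)] by (simp only: supported_def mem_Collect_eq) simp
    then show ?thesis by simp
  qed
  ultimately show ?thesis by blast
qed

lemma comp_pow_commute:
  assumes "m \<circ> \<sigma> = \<sigma> ^^ u \<circ> m"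
  shows "m \<circ> \<sigma> ^^ k = \<sigma> ^^ (u * k) \<circ> m"
proof (induction k)
  case (Suc k)
  have "m \<circ> \<sigma> ^^ Suc k = (m \<circ> \<sigma>) \<circ> \<sigma> ^^ k" by (simp only: funpow.simps comp_assoc)
  also have "\<dots> = \<sigma> ^^ u \<circ> (m \<circ> \<sigma> ^^ k)" by (simp only: assms comp_assoc)
  also have "\<dots> = \<sigma> ^^ u \<circ> \<sigma> ^^ (u * k) \<circ> m" by (simp only: Suc comp_assoc)
  also have "\<dots> = \<sigma> ^^ (u * Suc k) \<circ> m" by (simp only: funpow_add[symmetric] mult_Suc_right)
  finally show ?case .
qed simp

text \<open>The normaliser of \<langle>\<sigma>\<rangle> induces every permutation of the fixed
  points. The commutator of two elements that induce overlapping transpositions induces a 3-cycle,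
  and it centralises \<open>\<sigma>\<close> because automorphisms of a cyclic group commute. On the
  cycle it is thus a power of \<open>\<sigma>\<close>; its \<open>p\<close>-th power is trivial
  there but still a 3-cycle on the fixed points.\<close>

lemma exists_three_cycle:
  fixes p :: nat
  assumes p: "prime p" and \<sigma>: "\<sigma> \<in> G" "\<sigma> ^^ p = id" "\<sigma> \<noteq> id" and big: "card \<Omega> < 2 * p"
    and p3: "p + 3 \<le> card \<Omega>"
    and mt: "multi_transitive_on (card \<Omega> - p + 1) \<Omega>"
  shows "\<exists>a b c t. a \<in> \<Omega> \<and> b \<in> \<Omega> \<and> c \<in> \<Omega> \<and> distinct [a, b, c] \<and> t \<in> G \<and> three_cycle a b c t"
proof -
  let ?\<Gamma> = "{x. \<sigma> x \<noteq> x}"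
  note supp = support_of_prime_order[OF p permutes[OF \<sigma>(1)] \<sigma>(2,3) big]
  have \<Gamma>\<Omega>: "?\<Gamma> \<subseteq> \<Omega>" using permutes[OF \<sigma>(1)] by (auto simp: permutes_def)
  have fin\<Gamma>: "finite ?\<Gamma>" using \<Gamma>\<Omega> finite_points by (rule finite_subset)
  define Y where "Y = \<Omega> - ?\<Gamma>"
  have finY: "finite Y" using finite_points by (simp add: Y_def)
  have cY: "card Y = card \<Omega> - p" using \<Gamma>\<Omega> fin\<Gamma> supp(1) by (simp add: Y_def card_Diff_subset)
  have p0: "p > 0" using p by (rule prime_gt_0_nat)
  obtain z where z: "z \<in> ?\<Gamma>" using supp(1) p0 by (metis card.empty all_not_in_conv less_irrefl)
  obtain ys where ys: "set ys = Y" "distinct ys" using finite_distinct_list[OF finY] by blast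
  have len: "length ys = card \<Omega> - p" using distinct_card[OF ys(2)] ys(1) cY by simp
  have realise: "\<exists>m\<in>G. \<exists>u. m \<circ> \<sigma> = \<sigma> ^^ u \<circ> m \<and> (\<forall>x\<in>Y. m x = \<pi> x)" if \<pi>: "\<pi> permutes Y" for \<pi>
  proof -
    \<comment> \<open>A point \<open>z\<close> of the cycle brings the tuples to length
      \<open>card \<Omega> - p + 1\<close>, the degree of transitivity at hand.\<close>
    have "distinct (z # ys)" "distinct (z # map \<pi> ys)"
      using ys z permutes_image[OF \<pi>] permutes_inj[OF \<pi>]
      by (auto simp: Y_def distinct_map inj_on_subset[OF _ subset_UNIV])
    moreover have "set (z # ys) \<subseteq> \<Omega>" "set (z # map \<pi> ys) \<subseteq> \<Omega>"
      using ys z permutes_image[OF \<pi>] \<Gamma>\<Omega> by (auto simp: Y_def)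
    moreover have "length (z # ys) = card \<Omega> - p + 1" "length (z # map \<pi> ys) = card \<Omega> - p + 1"
      using len by simp_all
    ultimately obtain h where h: "h \<in> supported \<Omega>" "map h (z # ys) = z # map \<pi> ys"
      using mt unfolding multi_transitive_on_def by meson
    have hG: "h \<in> G" using h(1) by (simp add: supported_points)
    have hY: "h y = \<pi> y" if "y \<in> Y" for y
      using h(2) that ys(1) by (auto simp: map_eq_conv)
    have "h ` Y = Y" using hY permutes_image[OF \<pi>] by (metis image_cong)
    moreover have "?\<Gamma> = \<Omega> - Y" using \<Gamma>\<Omega> by (auto simp: Y_def)
    moreover have "h ` (\<Omega> - Y) = h ` \<Omega> - h ` Y"
      using bij_is_inj[OF bij_mem[OF hG]] by (rule image_set_diff)
    moreover have "h ` \<Omega> = \<Omega>" using permutes_image[OF permutes[OF hG]] .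
    ultimately have h\<Gamma>: "h ` ?\<Gamma> = ?\<Gamma>" by simp
    obtain m u where m: "m \<in> G" "m \<circ> \<sigma> = \<sigma> ^^ u \<circ> m" "\<forall>x. \<sigma> x = x \<longrightarrow> m x = h x"
      using normalising_element[OF p \<sigma> big hG h\<Gamma>] by blast
    have "\<forall>x\<in>Y. m x = \<pi> x" using m(3) hY by (auto simp: Y_def)
    with m show ?thesis by blast
  qed
  have "3 \<le> card Y" using cY p3 by simp
  then obtain W where W: "W \<subseteq> Y" "card W = 3" by (meson obtain_subset_with_card_n)
  then obtain a b c where abc: "W = {a, b, c}" "distinct [a, b, c]" by (auto simp: card_3_iff)
  then have Yabc: "a \<in> Y" "b \<in> Y" "c \<in> Y" using W by auto
  have ne: "a \<noteq> b" "a \<noteq> c" "b \<noteq> c" "b \<noteq> a" "c \<noteq> a" "c \<noteq> b" using abc by auto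
  obtain m u where m: "m \<in> G" "m \<circ> \<sigma> = \<sigma> ^^ u \<circ> m" "\<forall>x\<in>Y. m x = transpose a b x"
    using realise[OF permutes_swap_id[OF Yabc(1,2)]] by blast
  obtain k v where k: "k \<in> G" "k \<circ> \<sigma> = \<sigma> ^^ v \<circ> k" "\<forall>x\<in>Y. k x = transpose b c x"
    using realise[OF permutes_swap_id[OF Yabc(2,3)]] by blast
  let ?q = "k \<circ> m"
  have qG: "?q \<in> G" using m k by (intro comp_mem)
  have qi: "inv ?q \<circ> ?q = id" "?q \<circ> inv ?q = id" using comp_inv[OF qG] by blast+
  let ?c = "inv ?q \<circ> (m \<circ> k)"
  have cG: "?c \<in> G" using m k qG by (intro comp_mem inv_mem)
  have mk: "(m \<circ> k) \<circ> \<sigma> = \<sigma> ^^ (u * v) \<circ> (m \<circ> k)"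
  proof -
    have "(m \<circ> k) \<circ> \<sigma> = (m \<circ> \<sigma> ^^ v) \<circ> k" by (simp only: k(2) comp_assoc)
    also have "\<dots> = \<sigma> ^^ (u * v) \<circ> (m \<circ> k)" by (simp only: comp_pow_commute[OF m(2)] comp_assoc)
    finally show ?thesis .
  qed
  have km: "?q \<circ> \<sigma> = \<sigma> ^^ (u * v) \<circ> ?q"
  proof -
    have "?q \<circ> \<sigma> = (k \<circ> \<sigma> ^^ u) \<circ> m" by (simp only: m(2) comp_assoc)
    also have "\<dots> = \<sigma> ^^ (v * u) \<circ> ?q" by (simp only: comp_pow_commute[OF k(2)] comp_assoc)
    finally show ?thesis by (simp only: mult.commute)
  qed
  have comm: "?c \<circ> \<sigma> = \<sigma> \<circ> ?c"
  proof -
    have "?c \<circ> \<sigma> = inv ?q \<circ> \<sigma> ^^ (u * v) \<circ> (?q \<circ> inv ?q) \<circ> (m \<circ> k)"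
      by (simp only: qi comp_id) (simp only: comp_assoc mk[unfolded comp_assoc])
    also have "\<dots> = inv ?q \<circ> (?q \<circ> \<sigma>) \<circ> inv ?q \<circ> (m \<circ> k)"
      by (simp only: km) (simp only: comp_assoc)
    also have "\<dots> = (inv ?q \<circ> ?q) \<circ> \<sigma> \<circ> ?c" by (simp only: comp_assoc)
    also have "\<dots> = \<sigma> \<circ> ?c" by (simp only: qi id_comp)
    finally show ?thesis .
  qed
  have fixY: "\<sigma> x = x \<longleftrightarrow> x \<in> Y" if "x \<in> \<Omega>" for x using that by (auto simp: Y_def)
  have c\<Gamma>: "?c ` ?\<Gamma> = ?\<Gamma>"
  proof -
    have "?c x \<in> ?\<Gamma> \<longleftrightarrow> x \<in> ?\<Gamma>" for x
    proof -
      have "\<sigma> (?c x) = ?c (\<sigma> x)" using comm by (metis comp_apply)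
      then show ?thesis using bij_is_inj[OF bij_mem[OF cG]] by (simp only: mem_Collect_eq inj_eq)
    qed
    then have v: "?c -` ?\<Gamma> = ?\<Gamma>" by blast
    have "?c ` (?c -` ?\<Gamma>) = ?\<Gamma>" using bij_is_surj[OF bij_mem[OF cG]] by (rule surj_image_vimage_eq)
    then show ?thesis unfolding v .
  qed
  have reach: "\<exists>i. (\<sigma> ^^ i) x = y" if "x \<in> ?\<Gamma>" "y \<in> ?\<Gamma>" for x y
    using supp(2) that by auto
  obtain i where i: "\<forall>x\<in>?\<Gamma>. ?c x = (\<sigma> ^^ i) x"
    using commuting_with_cycle[OF reach comm c\<Gamma>] by blast
  define f where "f = ?c"
  have fG: "f \<in> G" and f\<Gamma>: "f ` ?\<Gamma> = ?\<Gamma>" and fi: "\<forall>x\<in>?\<Gamma>. f x = (\<sigma> ^^ i) x"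
    using cG c\<Gamma> i by (simp_all only: f_def)
  define t where "t = f ^^ p"
  have tG: "t \<in> G" unfolding t_def using fG by (rule funpow_mem)
  have t\<Gamma>: "t x = x" if x: "x \<in> ?\<Gamma>" for x
  proof -
    have "(f ^^ j) x = (\<sigma> ^^ (i * j)) x \<and> (f ^^ j) x \<in> ?\<Gamma>" for j
    proof (induction j)
      case (Suc j)
      have "(f ^^ Suc j) x = f ((f ^^ j) x)" by simp
      also have "\<dots> = (\<sigma> ^^ i) ((f ^^ j) x)" using Suc fi by blast
      also have "\<dots> = (\<sigma> ^^ (i * Suc j)) x" using Suc by (simp add: funpow_add)
      finally have "(f ^^ Suc j) x = (\<sigma> ^^ (i * Suc j)) x" .
      moreover have "f ((f ^^ j) x) \<in> ?\<Gamma>" using Suc f\<Gamma> by blast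
      ultimately show ?case by simp
    qed (use x in simp)
    then have "t x = (\<sigma> ^^ (i * p)) x" by (simp add: t_def)
    also have "\<dots> = ((\<sigma> ^^ p) ^^ i) x" by (simp only: funpow_mult mult.commute)
    also have "\<dots> = x" using \<sigma>(2) by (simp add: id_def[symmetric])
    finally show ?thesis .
  qed
  have invq: "inv ?q y = x" if "?q x = y" for x y using that qG by (metis inv_apply(1))
  have cY': "f x = x" if "x \<in> Y" "x \<noteq> a" "x \<noteq> b" "x \<noteq> c" for x
  proof -
    have "m x = x" "k x = x" using that m(3) k(3) by (auto simp: transpose_def)
    then have "?q x = x" "(m \<circ> k) x = x" by simp_all
    then show ?thesis using invq[of x x] by (simp add: f_def)
  qed
  have q_vals: "?q a = c" "?q b = a" "?q c = b"
    using m(3) k(3) Yabc ne by (auto simp: transpose_def)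
  have mk_vals: "(m \<circ> k) a = b" "(m \<circ> k) b = c" "(m \<circ> k) c = a"
    using m(3) k(3) Yabc ne by (auto simp: transpose_def)
  have c_vals: "f a = c" "f b = a" "f c = b"
    using invq[OF q_vals(3)] invq[OF q_vals(1)] invq[OF q_vals(2)] mk_vals by (simp_all add: f_def)
  have c3: "(f ^^ 3) x = x" if "x \<in> {a, b, c}" for x
    using that c_vals by (auto simp: numeral_3_eq_3)
  have tabc: "t x = (f ^^ (p mod 3)) x" if "x \<in> {a, b, c}" for x
    unfolding t_def by (rule funpow_mod_eq[OF c3[OF that], symmetric])
  \<comment> \<open>\<open>p + 3 <= card \<Omega> < 2 * p\<close> gives \<open>p > 3\<close>; so the
    \<open>p\<close>-th power is the 3-cycle or its inverse.\<close>
  have "p \<noteq> 3" using big p3 by auto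
  then have "p mod 3 \<noteq> 0" using p primes_dvd_imp_eq[of 3 p] by (auto simp: mod_eq_0_iff_dvd)
  then consider "p mod 3 = 1" | "p mod 3 = 2" by linarith
  then have tv: "(t a = c \<and> t c = b \<and> t b = a) \<or> (t a = b \<and> t b = c \<and> t c = a)"
  proof cases
    case 1
    then show ?thesis using tabc[of a] tabc[of b] tabc[of c] c_vals by simp
  next
    case 2
    then show ?thesis using tabc[of a] tabc[of b] tabc[of c] c_vals by (simp add: numeral_2_eq_2)
  qed
  have tout: "t x = x" if "x \<notin> {a, b, c}" for x
  proof -
    consider "x \<notin> \<Omega>" | "x \<in> ?\<Gamma>" | "x \<in> Y" by (auto simp: Y_def)
    then show ?thesis
    proof cases
      case 1
      then show ?thesis using permutes[OF tG] by (simp add: permutes_def)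
    next
      case 2
      then show ?thesis by (rule t\<Gamma>)
    next
      case 3
      then have "f x = x" using cY' that by auto
      then have "(f ^^ j) x = x" for j by (induction j) auto
      then show ?thesis by (simp add: t_def)
    qed
  qed
  have "three_cycle a b c t \<or> three_cycle a c b t"
    using tv tout unfolding three_cycle_def by auto
  moreover have "a \<in> \<Omega>" "b \<in> \<Omega>" "c \<in> \<Omega>" using Yabc by (auto simp: Y_def)
  ultimately show ?thesis using tG ne by (metis distinct_length_2_or_more distinct_singleton)
qed

text \<open>Growing the support of a \<open>p\<close>-cycle yields transitivity of degree
  \<open>card \<Omega> - p + 1\<close>, enough for small \<open>d\<close>. If the cycle fixes at
  least three points, conjugation of one 3-cycle gives all of them and hence every
  \<open>d\<close>.\<close>

theorem jordan:
  fixes p :: nat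
  assumes tr: "homog 1" and p: "prime p" "card \<Omega> < 2 * p" "p dvd card G"
    and d: "d \<le> card \<Omega> - p + 1 \<or> p + 3 \<le> card \<Omega>"
  shows "homog d"
proof -
  obtain \<sigma> where \<sigma>: "\<sigma> \<in> G" "\<sigma> \<noteq> id" "\<sigma> ^^ p = id" using cauchy[OF p(1,3)] by blast
  let ?\<Gamma> = "{x. \<sigma> x \<noteq> x}"
  have c\<Gamma>: "card ?\<Gamma> = p" using support_of_prime_order(1)[OF p(1) permutes[OF \<sigma>(1)] \<sigma>(3,2) p(2)] .
  have \<Gamma>\<Omega>: "?\<Gamma> \<subseteq> \<Omega>" using permutes[OF \<sigma>(1)] by (auto simp: permutes_def)
  then have p\<Omega>: "p \<le> card \<Omega>" using c\<Gamma> finite_points by (metis card_mono)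
  note tp = prime_cycle_transitive_primitive[OF p(1) \<sigma>(1,3,2) p(2)]
  have "multi_transitive_on 1 ?\<Gamma>"
    unfolding multi_transitive_on_def
  proof (intro allI impI, elim conjE)
    fix xs ys assume *: "length xs = 1" "length ys = (1::nat)" "set xs \<subseteq> ?\<Gamma>" "set ys \<subseteq> ?\<Gamma>"
    then obtain x y where xy: "xs = [x]" "ys = [y]"
      by (metis One_nat_def length_0_conv length_Suc_conv)
    then obtain h where "h \<in> supported ?\<Gamma>" "h x = y" using transitive_onE[OF tp(1), of x y] * by auto
    then show "\<exists>g\<in>supported ?\<Gamma>. map g xs = ys" using xy by auto
  qed
  then have mt: "multi_transitive_on (card \<Omega> - p + 1) \<Omega>"
    using grow_multi_transitive[OF \<Gamma>\<Omega> _ tp(2,1) transitive_if_homog[OF tr], of 1] p(2)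
    unfolding c\<Gamma> by blast
  from d show ?thesis
  proof
    assume "d \<le> card \<Omega> - p + 1"
    then show ?thesis using homog_if_multi_transitive[OF mt] p\<Omega> prime_gt_0_nat[OF p(1)] by simp
  next
    assume p3: "p + 3 \<le> card \<Omega>"
    obtain a b c t where t: "a \<in> \<Omega>" "b \<in> \<Omega>" "c \<in> \<Omega>" "distinct [a, b, c]" "t \<in> G" "three_cycle a b c t"
      using exists_three_cycle[OF p(1) \<sigma>(1,3,2) p(2) p3 mt] by blast
    have c3: "3 \<le> card \<Omega>" using p3 by simp
    show ?thesis
    proof (rule homog_if_three_cycles[OF c3])
      fix a' b' c' assume *: "a' \<in> \<Omega>" "b' \<in> \<Omega>" "c' \<in> \<Omega>" "distinct [a', b', c']"
      have ext: "\<exists>zs. distinct ([x, y, z] @ zs) \<and> length ([x, y, z] @ zs) = card \<Omega> - p + 1 \<and> set ([x, y, z] @ zs) \<subseteq> \<Omega>"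
        if "x \<in> \<Omega>" "y \<in> \<Omega>" "z \<in> \<Omega>" "distinct [x, y, z]" for x y z
      proof -
        have "card (\<Omega> - {x, y, z}) = card \<Omega> - 3" using that finite_points by (subst card_Diff_subset) auto
        then have "card \<Omega> - p - 2 \<le> card (\<Omega> - {x, y, z})" using prime_ge_2_nat[OF p(1)] by simp
        then obtain Z where Z: "Z \<subseteq> \<Omega> - {x, y, z}" "card Z = card \<Omega> - p - 2" "finite Z"
          by (meson obtain_subset_with_card_n)
        obtain zs where zs: "set zs = Z" "distinct zs" using finite_distinct_list[OF Z(3)] by blast
        have "length zs = card \<Omega> - p - 2" using distinct_card[OF zs(2)] zs(1) Z(2) by simp
        then show ?thesis using that Z zs p3 by (intro exI[of _ zs]) auto
      qed
      obtain zs where zs: "distinct ([a, b, c] @ zs)" "length ([a, b, c] @ zs) = card \<Omega> - p + 1"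
        "set ([a, b, c] @ zs) \<subseteq> \<Omega>" using ext[OF t(1-4)] by blast
      obtain zs' where zs': "distinct ([a', b', c'] @ zs')" "length ([a', b', c'] @ zs') = card \<Omega> - p + 1"
        "set ([a', b', c'] @ zs') \<subseteq> \<Omega>" using ext[OF *] by blast
      obtain g where "g \<in> supported \<Omega>" "map g ([a, b, c] @ zs) = [a', b', c'] @ zs'"
        using mt zs zs' unfolding multi_transitive_on_def by meson
      then have g: "g \<in> G" "g a = a'" "g b = b'" "g c = c'" by (auto simp: supported_points)
      have "three_cycle a' b' c' (g \<circ> t \<circ> inv g)"
        using three_cycle_conj[OF g(1) t(6)] g by simp
      moreover have "g \<circ> t \<circ> inv g \<in> G" using g(1) t(5) by (intro comp_mem inv_mem)
      ultimately show "\<exists>t\<in>G. three_cycle a' b' c' t" by blast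
    qed
  qed
qed

end

section \<open>The Livingstone-Wagner theorem\<close>

lemma sum_subsets_insert:
  fixes f :: "'a set \<Rightarrow> int"
  assumes "finite X" "x \<notin> X"
  shows "(\<Sum>S | S \<subseteq> insert x X \<and> card S = Suc d. f S) =
    (\<Sum>S | S \<subseteq> X \<and> card S = Suc d. f S) + (\<Sum>S | S \<subseteq> X \<and> card S = d. f (insert x S))"
proof -
  let ?A = "{S. S \<subseteq> X \<and> card S = Suc d}" and ?B = "{S. S \<subseteq> X \<and> card S = d}"
  have fs: "finite S" if "S \<subseteq> X" for S using that assms(1) by (rule finite_subset)
  have fin: "finite ?A" "finite ?B"
    by (rule finite_subset[of _ "Pow X"]; use assms(1) in auto)+
  have "{S. S \<subseteq> insert x X \<and> card S = Suc d} = ?A \<union> insert x ` ?B"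
  proof (intro subset_antisym subsetI)
    fix S assume S: "S \<in> {S. S \<subseteq> insert x X \<and> card S = Suc d}"
    show "S \<in> ?A \<union> insert x ` ?B"
    proof (cases "x \<in> S")
      case True
      then have "S = insert x (S - {x})" "S - {x} \<subseteq> X" using S by auto
      moreover have "card (S - {x}) = d" using S True by simp
      ultimately show ?thesis by blast
    qed (use S in auto)
  next
    fix S assume "S \<in> ?A \<union> insert x ` ?B"
    then show "S \<in> {S. S \<subseteq> insert x X \<and> card S = Suc d}"
      using assms fs by (auto simp: card_insert_if)
  qed
  moreover have "inj_on (insert x) ?B"
    by (rule inj_onI) (use assms(2) in \<open>metis (no_types, lifting) insert_ident mem_Collect_eq subsetD\<close>)
  moreover have "?A \<inter> insert x ` ?B = {}" using assms(2) by auto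
  ultimately show ?thesis using fin by (simp add: sum.union_disjoint sum.reindex)
qed

text \<open>The induction passes to the differences \<open>f (insert x T) - f (insert y T)\<close>, whose sums over the
  \<open>(u - 1)\<close>-subsets of \<open>\<Omega> - {x, y}\<close> vanish again.\<close>

lemma zero_if_subset_sums_zero:
  fixes f :: "'a set \<Rightarrow> int"
  assumes "finite \<Omega>" "d \<le> u" "u + d \<le> card \<Omega>"
    and "\<And>X. X \<subseteq> \<Omega> \<Longrightarrow> card X = u \<Longrightarrow> (\<Sum>S | S \<subseteq> X \<and> card S = d. f S) = 0"
    and "S \<subseteq> \<Omega>" "card S = d"
  shows "f S = 0"
  using assms
proof (induction d arbitrary: \<Omega> u f S)
  case 0
  have "finite S" using 0 finite_subset by blast
  then have S: "S = {}" using 0 by simp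
  obtain X where X: "X \<subseteq> \<Omega>" "card X = u" "finite X"
    using 0 by (metis add_0_right obtain_subset_with_card_n)
  have "{S. S \<subseteq> X \<and> card S = 0} = {{}}"
    using X(3) by (auto simp: card_eq_0_iff dest: finite_subset)
  then show ?case using 0(4)[OF X(1,2)] S by simp
next
  case (Suc d)
  have swap: "f (insert x T) = f (insert y T)"
    if xy: "x \<in> \<Omega>" "y \<in> \<Omega>" "x \<noteq> y" and T: "T \<subseteq> \<Omega> - {x, y}" "card T = d" for x y T
  proof -
    have "f (insert x T) - f (insert y T) = 0"
    proof (rule Suc.IH[of "\<Omega> - {x, y}" "u - 1" "\<lambda>T. f (insert x T) - f (insert y T)"])
      have "card (\<Omega> - {x, y}) = card \<Omega> - 2" using xy Suc.prems(1) by (subst card_Diff_subset) auto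
      then show "u - 1 + d \<le> card (\<Omega> - {x, y})" using Suc.prems(2,3) by simp
      fix X assume X: "X \<subseteq> \<Omega> - {x, y}" "card X = u - 1"
      have finX: "finite X" using X(1) Suc.prems(1) by (meson finite_Diff finite_subset)
      have sub: "insert x X \<subseteq> \<Omega>" "insert y X \<subseteq> \<Omega>" using X xy by auto
      have nin: "x \<notin> X" "y \<notin> X" using X by auto
      have card: "card (insert x X) = u" "card (insert y X) = u"
        using X(2) nin finX Suc.prems(2) by auto
      from Suc.prems(4)[OF sub(1) card(1)] Suc.prems(4)[OF sub(2) card(2)]
      show "(\<Sum>S | S \<subseteq> X \<and> card S = d. f (insert x S) - f (insert y S)) = 0"
        unfolding sum_subsets_insert[OF finX nin(1)] sum_subsets_insert[OF finX nin(2)]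
        by (simp add: sum_subtractf)
    qed (use Suc.prems T in auto)
    then show ?thesis by simp
  qed
  have const: "f A = f S" if A: "A \<subseteq> \<Omega>" "card A = Suc d" for A
  proof -
    define F where "F X = (if card X = Suc d then f X else 0)" for X
    have "F A = F S"
    proof (rule exchange_invariant[OF Suc.prems(1)])
      fix X x y assume X: "X \<subseteq> \<Omega>" "x \<in> X" "y \<in> \<Omega> - X"
      have finX: "finite X" using X(1) Suc.prems(1) by (rule finite_subset)
      have ci: "card (insert y (X - {x})) = card X"
        using X finX by (metis card_Suc_Diff1 card_insert_disjoint Diff_iff finite_Diff)
      have "f (insert y (X - {x})) = f X" if "card X = Suc d"
      proof -
        have "f (insert x (X - {x})) = f (insert y (X - {x}))"
          by (rule swap) (use X that finX in auto)
        then show ?thesis using X by (simp add: insert_absorb)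
      qed
      with ci show "F (insert y (X - {x})) = F X" by (simp add: F_def)
    qed (use A Suc.prems in auto)
    then show ?thesis using A Suc.prems(6) by (simp add: F_def)
  qed
  obtain X where X: "X \<subseteq> \<Omega>" "card X = u" "finite X"
    using Suc.prems by (metis add_leD1 obtain_subset_with_card_n)
  \<comment> \<open>Now \<open>f\<close> is constant on the sets of size \<open>Suc d\<close>. A
    vanishing sum of \<open>u choose Suc d\<close> equal terms makes the constant 0, as
    \<open>Suc d <= u\<close>.\<close>
  have "(\<Sum>A | A \<subseteq> X \<and> card A = Suc d. f A) = (\<Sum>A | A \<subseteq> X \<and> card A = Suc d. f S)"
    by (rule sum.cong) (use const X in auto)
  also have "\<dots> = int (u choose Suc d) * f S" using n_subsets[OF X(3), of "Suc d"] X(2) by simp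
  finally have "int (u choose Suc d) * f S = 0" using Suc.prems(4)[OF X(1,2)] by simp
  then show ?case using Suc.prems(2) by simp
qed

context perm_group
begin

text \<open>By homogeneity, the sum of the orbit indicator \<open>e\<close> over the
  \<open>d\<close>-subsets of a \<open>u\<close>-set does not depend on the \<open>u\<close>-set.
  Scaling \<open>e\<close> by \<open>u choose d\<close> and subtracting this constant gives a
  function with vanishing subset sums, so it is zero and \<open>e\<close> is constant. The integral
  scaling avoids averages.\<close>

lemma livingstone_wagner:
  assumes u: "homog u" and d: "d \<le> u" "u + d \<le> card \<Omega>"
  shows "homog d"
  unfolding homog_def
proof (intro allI impI, elim conjE)
  fix A B assume AB: "A \<subseteq> \<Omega>" "B \<subseteq> \<Omega>" "card A = d" "card B = d"
  obtain e :: "'a set \<Rightarrow> int" where e_inv: "\<And>g S. g \<in> G \<Longrightarrow> e (g ` S) = e S" and eA: "e A = 1"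
    and eB: "e B = 1 \<Longrightarrow> \<exists>g\<in>G. g ` A = B"
    using orbit_indicator[of A] by metis
  define F where "F X = (\<Sum>S | S \<subseteq> X \<and> card S = d. e S)" for X
  have F_inv: "F (g ` X) = F X" if g: "g \<in> G" for g X
  proof -
    have inj: "inj g" using bij_mem[OF g] bij_is_inj by blast
    have "{S. S \<subseteq> g ` X \<and> card S = d} = (`) g ` {S. S \<subseteq> X \<and> card S = d}"
      using inj by (auto simp: subset_image_iff card_image inj_on_subset[OF _ subset_UNIV])
    moreover have "inj_on ((`) g) {S. S \<subseteq> X \<and> card S = d}"
      using inj by (simp add: inj_on_def inj_image_eq_iff)
    ultimately show ?thesis unfolding F_def by (simp add: sum.reindex e_inv[OF g])
  qed
  obtain X0 where X0: "X0 \<subseteq> \<Omega>" "card X0 = u"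
    using d by (meson add_leD1 obtain_subset_with_card_n)
  have FX: "F X = F X0" if "X \<subseteq> \<Omega>" "card X = u" for X
    using homogD[OF u that(1) X0(1) that(2) X0(2)] F_inv by metis
  let ?N = "int (u choose d)"
  have zero: "?N * e S - F X0 = 0" if S: "S \<subseteq> \<Omega>" "card S = d" for S
  proof (rule zero_if_subset_sums_zero[OF finite_points d _ S, of "\<lambda>S. ?N * e S - F X0"])
    fix X assume X: "X \<subseteq> \<Omega>" "card X = u"
    have "finite X" using X(1) finite_points by (rule finite_subset)
    then have "(\<Sum>S | S \<subseteq> X \<and> card S = d. ?N * e S - F X0) = ?N * F X - ?N * F X0"
      using n_subsets[of X d] X(2) by (simp add: sum_subtractf sum_distrib_left F_def)
    then show "(\<Sum>S | S \<subseteq> X \<and> card S = d. ?N * e S - F X0) = 0" using FX[OF X] by simp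
  qed
  have "?N * e B = ?N * 1" using zero[OF AB(1,3)] zero[OF AB(2,4)] eA by simp
  then have "e B = 1" using d(1) by simp
  then show "\<exists>g\<in>G. g ` A = B" by (rule eB)
qed

end

text \<open>The pairing of \<open>f\<close> with the polytabloid of shape \<open>(3,3)\<close> whose
  columns are the three pairs: the eight transversals, each with the sign given by the parity of the
  number of \<open>y\<close>s.\<close>

definition polytabloid_sum :: "('a set \<Rightarrow> int) \<Rightarrow> 'a \<Rightarrow> 'a \<Rightarrow> 'a \<Rightarrow> 'a \<Rightarrow> 'a \<Rightarrow> 'a \<Rightarrow> int" where
  "polytabloid_sum f x1 y1 x2 y2 x3 y3 =
     f {x1, x2, x3} - f {y1, x2, x3} - f {x1, y2, x3} - f {x1, x2, y3}
     + f {x1, y2, y3} + f {y1, x2, y3} + f {y1, y2, x3} - f {y1, y2, y3}"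

lemma polytabloid_sum_flip:
  "polytabloid_sum f b a c d x y = - polytabloid_sum f a b c d x y"
  "polytabloid_sum f a b d c x y = - polytabloid_sum f a b c d x y"
  "polytabloid_sum f a b c d y x = - polytabloid_sum f a b c d x y"
  by (simp_all add: polytabloid_sum_def)

lemma polytabloid_sum_pairs:
  assumes "{x1, y1} = {p1, q1}" "{x2, y2} = {p2, q2}" "{x3, y3} = {p3, q3}"
  shows "\<bar>polytabloid_sum f x1 y1 x2 y2 x3 y3\<bar> = \<bar>polytabloid_sum f p1 q1 p2 q2 p3 q3\<bar>"
  using assms unfolding doubleton_eq_iff
  by (elim disjE conjE)
    (simp_all only: abs_minus_cancel polytabloid_sum_flip(1)[where a = p1 and b = q1]
      polytabloid_sum_flip(2)[where c = p2 and d = q2] polytabloid_sum_flip(3)[where x = p3 and y = q3])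

text \<open>The three summands belong to the three ways of splitting \<open>{a, b, c, d}\<close>
  into two pairs; each triple occurs twice, with opposite signs.\<close>

lemma polytabloid_sum_pluecker:
  "polytabloid_sum f a b c d x y + polytabloid_sum f b c a d x y + polytabloid_sum f c a b d x y = 0"
  by (simp add: polytabloid_sum_def insert_commute)

context perm_group
begin

text \<open>The case that escapes the prime number argument: transitivity on the \<open>15\<close> perfect matchings of
  six points. The signed sum over the transversals of a matching has constant absolute value, so the
  three-term relation forces it to vanish.\<close>

lemma homog_3_if_matching_transitive:
  assumes c6: "card \<Omega> = 6" and h2: "homog 2"
    and P: "distinct [p1, q1, p2, q2, p3, q3]" "{p1, q1, p2, q2, p3, q3} = \<Omega>"
    and mt: "\<And>x1 y1 x2 y2 x3 y3. distinct [x1, y1, x2, y2, x3, y3] \<Longrightarrow> {x1, y1, x2, y2, x3, y3} = \<Omega> \<Longrightarrow>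
      \<exists>h\<in>G. {h x1, h y1} \<in> {{p1, q1}, {p2, q2}, {p3, q3}} \<and> {h x2, h y2} \<in> {{p1, q1}, {p2, q2}, {p3, q3}} \<and>
        {h x3, h y3} \<in> {{p1, q1}, {p2, q2}, {p3, q3}}"
  shows "homog 3"
  unfolding homog_def
proof (intro allI impI, elim conjE)
  fix A B assume AB: "A \<subseteq> \<Omega>" "B \<subseteq> \<Omega>" "card A = 3" "card B = 3"
  obtain e :: "'a set \<Rightarrow> int" where e_inv: "\<And>g S. g \<in> G \<Longrightarrow> e (g ` S) = e S" and eA: "e A = 1"
    and eB: "e B = 1 \<Longrightarrow> \<exists>g\<in>G. g ` A = B"
    using orbit_indicator[of A] by metis
  let ?c = "polytabloid_sum e"
  have c_inv: "?c (h a) (h b) (h c) (h d) (h x) (h y) = ?c a b c d x y" if h: "h \<in> G" for h a b c d x y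
    using e_inv[OF h, of "{u, v, w}" for u v w] by (simp add: polytabloid_sum_def)
  define K where "K = \<bar>?c p1 q1 p2 q2 p3 q3\<bar>"
  have cK: "\<bar>?c x1 y1 x2 y2 x3 y3\<bar> = K"
    if xy: "distinct [x1, y1, x2, y2, x3, y3]" "{x1, y1, x2, y2, x3, y3} = \<Omega>" for x1 y1 x2 y2 x3 y3
  proof -
    obtain h where h: "h \<in> G" "{h x1, h y1} \<in> {{p1, q1}, {p2, q2}, {p3, q3}}"
      "{h x2, h y2} \<in> {{p1, q1}, {p2, q2}, {p3, q3}}" "{h x3, h y3} \<in> {{p1, q1}, {p2, q2}, {p3, q3}}"
      using mt[OF xy] by (elim bexE conjE) (rule that)
    have inj: "h u = h v \<longleftrightarrow> u = v" for u v using bij_is_inj[OF bij_mem[OF h(1)]] by (simp add: inj_eq)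
    have ne: "{h x1, h y1} \<noteq> {h x2, h y2}" "{h x1, h y1} \<noteq> {h x3, h y3}" "{h x2, h y2} \<noteq> {h x3, h y3}"
      using xy(1) by (auto simp: doubleton_eq_iff inj)
    define s1 s2 s3 where "s1 = {h x1, h y1}" and "s2 = {h x2, h y2}" and "s3 = {h x3, h y3}"
    define t1 t2 t3 where "t1 = {p1, q1}" and "t2 = {p2, q2}" and "t3 = {p3, q3}"
    have "(s1 = t1 \<and> s2 = t2 \<and> s3 = t3) \<or> (s1 = t1 \<and> s2 = t3 \<and> s3 = t2) \<or> (s1 = t2 \<and> s2 = t1 \<and> s3 = t3)
      \<or> (s1 = t2 \<and> s2 = t3 \<and> s3 = t1) \<or> (s1 = t3 \<and> s2 = t1 \<and> s3 = t2) \<or> (s1 = t3 \<and> s2 = t2 \<and> s3 = t1)"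
    proof -
      have "s1 \<in> {t1, t2, t3}" "s2 \<in> {t1, t2, t3}" "s3 \<in> {t1, t2, t3}" "s1 \<noteq> s2" "s1 \<noteq> s3" "s2 \<noteq> s3"
        using h(2-4) ne by (simp_all only: s1_def s2_def s3_def t1_def t2_def t3_def not_False_eq_True)
      then show ?thesis by auto
    qed
    note disj = this
    have perms: "\<bar>?c p1 q1 p2 q2 p3 q3\<bar> = K" "\<bar>?c p1 q1 p3 q3 p2 q2\<bar> = K" "\<bar>?c p2 q2 p1 q1 p3 q3\<bar> = K"
      "\<bar>?c p2 q2 p3 q3 p1 q1\<bar> = K" "\<bar>?c p3 q3 p1 q1 p2 q2\<bar> = K" "\<bar>?c p3 q3 p2 q2 p1 q1\<bar> = K"
      by (simp_all add: K_def polytabloid_sum_def insert_commute)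
    have via: "\<bar>?c (h x1) (h y1) (h x2) (h y2) (h x3) (h y3)\<bar> = K"
      if "s1 = {a1, b1}" "s2 = {a2, b2}" "s3 = {a3, b3}" "\<bar>?c a1 b1 a2 b2 a3 b3\<bar> = K" for a1 b1 a2 b2 a3 b3
      using polytabloid_sum_pairs[of "h x1" "h y1" a1 b1 "h x2" "h y2" a2 b2 "h x3" "h y3" a3 b3 e] that
      unfolding s1_def s2_def s3_def by simp
    from disj have "\<bar>?c (h x1) (h y1) (h x2) (h y2) (h x3) (h y3)\<bar> = K"
      unfolding t1_def t2_def t3_def
      by (elim disjE conjE) (erule via, assumption, assumption, rule perms)+
    then show ?thesis using c_inv[OF h(1)] by simp
  qed
  have c0: "?c a b c d x y = 0" if *: "distinct [a, b, c, d, x, y]" "{a, b, c, d, x, y} = \<Omega>" for a b c d x y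
  proof -
    have "{b, c, a, d, x, y} = \<Omega>" "{c, a, b, d, x, y} = \<Omega>" using *(2) by auto
    then have "\<bar>?c a b c d x y\<bar> = K" "\<bar>?c b c a d x y\<bar> = K" "\<bar>?c c a b d x y\<bar> = K"
      using * by (auto intro!: cK)
    \<comment> \<open>Three terms \<open>K\<close> or \<open>- K\<close> sum to 0 only if
      \<open>K = 0\<close>.\<close>
    then show ?thesis using polytabloid_sum_pluecker[of e a b c d x y] by linarith
  qed
  \<comment> \<open>\<open>N T\<close> is the sum of \<open>e\<close> over the triples containing
    the pair \<open>T\<close>; it is the same for all pairs because of 2-homogeneity.\<close>
  define N where "N T = (\<Sum>z\<in>\<Omega> - T. e (insert z T))" for T
  have N_inv: "N (g ` T) = N T" if g: "g \<in> G" for g T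
  proof -
    have inj: "inj g" using bij_mem[OF g] bij_is_inj by blast
    have "\<Omega> - g ` T = g ` (\<Omega> - T)"
      using permutes_image[OF permutes[OF g]] inj by (simp add: image_set_diff)
    then have "N (g ` T) = (\<Sum>z\<in>\<Omega> - T. e (insert (g z) (g ` T)))"
      unfolding N_def using inj by (simp add: sum.reindex inj_on_subset[OF _ subset_UNIV])
    also have "\<dots> = N T" unfolding N_def using e_inv[OF g] by (simp flip: image_insert)
    finally show ?thesis .
  qed
  have N_const: "N T = N S" if "T \<subseteq> \<Omega>" "S \<subseteq> \<Omega>" "card T = 2" "card S = 2" for S T
    using homogD[OF h2 that] N_inv by metis
  have swap: "e {x, a, b} = e {y, a, b}"
    if *: "distinct [x, y, a, b, c, d]" "{x, y, a, b, c, d} = \<Omega>" for x y a b c d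
  proof -
    have N2: "N {u, v} = e {w1, u, v} + e {w2, u, v} + e {w3, u, v} + e {w4, u, v}"
      if "distinct [u, v, w1, w2, w3, w4]" "{u, v, w1, w2, w3, w4} = \<Omega>" for u v w1 w2 w3 w4
    proof -
      have "\<Omega> - {u, v} = {w1, w2, w3, w4}" using that by auto
      then show ?thesis using that(1) unfolding N_def by simp
    qed
    have perm: "{x, a, y, b, c, d} = \<Omega>" "{x, b, y, a, c, d} = \<Omega>" "{x, c, y, a, b, d} = \<Omega>" "{x, d, y, a, b, c} = \<Omega>"
      "{y, a, x, b, c, d} = \<Omega>" "{y, b, x, a, c, d} = \<Omega>" "{y, c, x, a, b, d} = \<Omega>" "{y, d, x, a, b, c} = \<Omega>"
      "{x, y, a, c, b, d} = \<Omega>" "{x, y, a, d, b, c} = \<Omega>"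
      using *(2) by auto
    have mem: "x \<in> \<Omega>" "y \<in> \<Omega>" "a \<in> \<Omega>" "b \<in> \<Omega>" "c \<in> \<Omega>" "d \<in> \<Omega>" using *(2) by auto
    have card2: "card {u, v} = 2" if "u \<noteq> v" for u v :: 'a using that by simp
    have eqs: "N {x, a} = N {y, a}" "N {x, b} = N {y, b}" "N {x, c} = N {y, c}" "N {x, d} = N {y, d}"
      using *(1) mem by (auto intro!: N_const)
    have dist: "distinct [x, a, y, b, c, d]" "distinct [x, b, y, a, c, d]" "distinct [x, c, y, a, b, d]"
      "distinct [x, d, y, a, b, c]" "distinct [y, a, x, b, c, d]" "distinct [y, b, x, a, c, d]"
      "distinct [y, c, x, a, b, d]" "distinct [y, d, x, a, b, c]" "distinct [x, y, a, c, b, d]"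
      "distinct [x, y, a, d, b, c]"
      using *(1) by auto
    note Ns = N2[OF dist(1) perm(1)] N2[OF dist(2) perm(2)] N2[OF dist(3) perm(3)] N2[OF dist(4) perm(4)]
      N2[OF dist(5) perm(5)] N2[OF dist(6) perm(6)] N2[OF dist(7) perm(7)] N2[OF dist(8) perm(8)]
    note zs = c0[OF *] c0[OF dist(9) perm(9)] c0[OF dist(10) perm(10)]
    \<comment> \<open>\<open>hh\<close> is a weight on the edges of the complete graph on
      \<open>a\<close>, \<open>b\<close>, \<open>c\<close>, \<open>d\<close>. Comparing
      \<open>N\<close> at \<open>{x, u}\<close> and \<open>{y, u}\<close> shows that the weights at
      each vertex sum to 0, so opposite edges have equal weight; the vanishing signed sums then make
      all weights equal, hence 0.\<close>
    define hh where "hh u v = e {x, u, v} - e {y, u, v}" for u v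
    have sym: "hh u v = hh v u" for u v by (simp add: hh_def insert_commute)
    have xy: "e {y, x, u} = e {x, y, u}" for u by (simp add: insert_commute)
    have r: "e {v, x, u} = e {x, u, v}" "e {v, y, u} = e {y, u, v}" for u v by (simp_all add: insert_commute)
    have H1: "hh a b + hh a c + hh a d = 0"
      using eqs(1)[unfolded Ns] xy[of a] r[of b a] r[of c a] r[of d a] by (simp add: hh_def)
    have H2: "hh b a + hh b c + hh b d = 0"
      using eqs(2)[unfolded Ns] xy[of b] r[of a b] r[of c b] r[of d b] by (simp add: hh_def)
    have H3: "hh c a + hh c b + hh c d = 0"
      using eqs(3)[unfolded Ns] xy[of c] r[of a c] r[of b c] r[of d c] by (simp add: hh_def)
    have H4: "hh d a + hh d b + hh d c = 0"
      using eqs(4)[unfolded Ns] xy[of d] r[of a d] r[of b d] r[of c d] by (simp add: hh_def)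
    note H = H1 H2 H3 H4
    have Z: "hh a c - hh b c - hh a d + hh b d = 0" "hh a b - hh c b - hh a d + hh c d = 0"
      "hh a b - hh d b - hh a c + hh d c = 0"
      using zs unfolding polytabloid_sum_def hh_def by simp_all
    have "hh a b = 0"
      using H Z unfolding sym[of b a] sym[of c a] sym[of c b] sym[of d a] sym[of d b] sym[of d c] by linarith
    then show ?thesis by (simp add: hh_def)
  qed
  define F where "F X = (if card X = 3 then e X else 0)" for X
  have "F A = F B"
  proof (rule exchange_invariant[OF finite_points])
    fix X x y assume X: "X \<subseteq> \<Omega>" "x \<in> X" "y \<in> \<Omega> - X"
    have finX: "finite X" using X(1) finite_points by (rule finite_subset)
    have ci: "card (insert y (X - {x})) = card X"
      using X finX by (metis card_Suc_Diff1 card_insert_disjoint Diff_iff finite_Diff)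
    have "e (insert y (X - {x})) = e X" if X3: "card X = 3"
    proof -
      have "card (X - {x}) = 2" using X(2) X3 by simp
      then obtain a b where ab: "X - {x} = {a, b}" "a \<noteq> b" by (auto simp: card_2_iff)
      have "card (\<Omega> - insert y X) = 2"
        using X X3 c6 finX finite_points by (subst card_Diff_subset) auto
      then obtain c d where cd: "\<Omega> - insert y X = {c, d}" "c \<noteq> d" by (auto simp: card_2_iff)
      have Xx: "X = {x, a, b}" "x \<noteq> a" "x \<noteq> b" using ab X(2) by auto
      have O: "{x, y, a, b, c, d} = \<Omega>" using Xx cd X by auto
      have "c \<notin> insert y X" "d \<notin> insert y X" using cd by auto
      then have D: "distinct [x, y, a, b, c, d]" using Xx ab(2) cd(2) X by auto
      show ?thesis using swap[OF D O] ab(1) Xx(1) by simp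
    qed
    with ci show "F (insert y (X - {x})) = F X" by (simp add: F_def)
  qed (use AB in auto)
  then have "e B = 1" using AB eA by (simp add: F_def)
  then show "\<exists>g\<in>G. g ` A = B" by (rule eB)
qed

end

section \<open>Extension of partial injections to permutations\<close>

lemma extend_to_permutation:
  assumes fin: "finite \<Omega>" and X: "X \<subseteq> \<Omega>" "\<phi> ` X \<subseteq> \<Omega>" "inj_on \<phi> X"
  obtains g where "g permutes \<Omega>" "\<And>x. x \<in> X \<Longrightarrow> g x = \<phi> x"
proof -
  have finX: "finite X" using X(1) fin by (rule finite_subset)
  have "card (\<Omega> - X) = card (\<Omega> - \<phi> ` X)"
    using X finX by (simp add: card_Diff_subset card_image)
  then obtain \<psi> where \<psi>: "bij_betw \<psi> (\<Omega> - X) (\<Omega> - \<phi> ` X)"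
    using fin by (metis finite_Diff finite_same_card_bij)
  define g where "g x = (if x \<in> X then \<phi> x else if x \<in> \<Omega> then \<psi> x else x)" for x
  have "bij_betw g X (\<phi> ` X)"
    using X(3) unfolding bij_betw_def by (auto simp: g_def inj_on_def)
  moreover have "bij_betw g (\<Omega> - X) (\<Omega> - \<phi> ` X)"
    using \<psi> by (rule bij_betw_cong[THEN iffD1, rotated]) (simp add: g_def)
  ultimately have "bij_betw g (X \<union> (\<Omega> - X)) (\<phi> ` X \<union> (\<Omega> - \<phi> ` X))"
    by (rule bij_betw_combine) auto
  then have "bij_betw g \<Omega> \<Omega>" using X by (simp add: Un_absorb1)
  then have "g permutes \<Omega>" by (rule bij_imp_permutes) (use X in \<open>auto simp: g_def\<close>)
  then show ?thesis by (rule that) (simp add: g_def)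
qed

lemma permutation_image:
  assumes "finite \<Omega>" "X \<subseteq> \<Omega>" "Y \<subseteq> \<Omega>" "card X = card Y"
  obtains g where "g permutes \<Omega>" "g ` X = Y"
proof -
  have "finite X" "finite Y" using assms finite_subset by blast+
  then obtain \<phi> where \<phi>: "bij_betw \<phi> X Y" using assms(4) finite_same_card_bij by blast
  then obtain g where "g permutes \<Omega>" "\<And>x. x \<in> X \<Longrightarrow> g x = \<phi> x"
    using extend_to_permutation[OF assms(1,2), of \<phi>] assms(3) by (auto simp: bij_betw_def)
  then show ?thesis using \<phi> that[of g] by (metis bij_betw_def image_cong)
qed

section \<open>Transitivity on kernels\<close>

lemma card_eq_sum_fibres:
  assumes "finite A"
  shows "card A = (\<Sum>y\<in>f ` A. card {x\<in>A. f x = y})"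
  using assms by (simp add: sum.image_gen[of A "\<lambda>_. 1 :: nat" f, simplified])

lemma card_eq_mult_if_fibres_eq:
  assumes "finite A" "\<And>y. y \<in> f ` A \<Longrightarrow> card {x\<in>A. f x = y} = k"
  shows "card A = card (f ` A) * k"
  using card_eq_sum_fibres[OF assms(1), of f] assms(2) by simp

context perm_group
begin

definition fibre :: "('a \<Rightarrow> 'b) \<Rightarrow> 'a \<Rightarrow> 'a set" where
  "fibre a x = {y\<in>\<Omega>. a y = a x}"

definition fibre_class :: "('a \<Rightarrow> 'b) \<Rightarrow> nat \<Rightarrow> 'a set" where
  "fibre_class a k = {x\<in>\<Omega>. card (fibre a x) = k}"

text \<open>This is \<open>\<lambda>\<close>-homogeneity of \<open>G\<close>, where \<open>\<lambda>\<close> is the type of the kernel of \<open>a\<close>.\<close>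

definition kernel_homog :: "('a \<Rightarrow> 'b) \<Rightarrow> bool" where
  "kernel_homog a \<longleftrightarrow> (\<forall>g. g permutes \<Omega> \<longrightarrow>
     (\<exists>h\<in>G. \<forall>x\<in>\<Omega>. \<forall>y\<in>\<Omega>. a (g x) = a (g y) \<longleftrightarrow> a (h x) = a (h y)))"

lemma kernel_homogE:
  assumes "kernel_homog a" "g permutes \<Omega>"
  obtains h where "h \<in> G" "\<And>x y. x \<in> \<Omega> \<Longrightarrow> y \<in> \<Omega> \<Longrightarrow> a (g x) = a (g y) \<longleftrightarrow> a (h x) = a (h y)"
  using assms unfolding kernel_homog_def by metis

lemma finite_fibre: "finite (fibre a x)"
  using finite_points by (simp add: fibre_def)

lemma card_fibre_permuted:
  assumes g: "g permutes \<Omega>"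
  shows "card (fibre a (g x)) = card {y\<in>\<Omega>. a (g y) = a (g x)}"
proof -
  have "fibre a (g x) = g ` {y\<in>\<Omega>. a (g y) = a (g x)}"
  proof
    show "fibre a (g x) \<subseteq> g ` {y\<in>\<Omega>. a (g y) = a (g x)}"
    proof
      fix z assume z: "z \<in> fibre a (g x)"
      then obtain y where "y \<in> \<Omega>" "z = g y" using permutes_image[OF g] by (auto simp: fibre_def)
      with z show "z \<in> g ` {y\<in>\<Omega>. a (g y) = a (g x)}" by (auto simp: fibre_def)
    qed
    show "g ` {y\<in>\<Omega>. a (g y) = a (g x)} \<subseteq> fibre a (g x)"
      using permutes_image[OF g] by (auto simp: fibre_def)
  qed
  then show ?thesis using permutes_inj[OF g] by (simp add: card_image inj_on_subset[OF _ subset_UNIV])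
qed

text \<open>A permutation that carries \<open>X\<close> to the class can be replaced by an element
  of \<open>G\<close> with the same pulled-back kernel, and the size of the part of a point is read
  off from this kernel. So one homogeneity degree results for each part size.\<close>

lemma homog_fibre_class:
  assumes kh: "kernel_homog a"
  shows "homog (card (fibre_class a k))"
proof -
  let ?C = "fibre_class a k"
  have C: "?C \<subseteq> \<Omega>" by (auto simp: fibre_class_def)
  have to_C: "\<exists>h\<in>G. h ` X = ?C" if X: "X \<subseteq> \<Omega>" "card X = card ?C" for X
  proof -
    obtain g where g: "g permutes \<Omega>" "g ` X = ?C"
      by (rule permutation_image[OF finite_points X(1) C X(2)])
    obtain h where h: "h \<in> G" "\<And>x y. x \<in> \<Omega> \<Longrightarrow> y \<in> \<Omega> \<Longrightarrow> a (g x) = a (g y) \<longleftrightarrow> a (h x) = a (h y)"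
      by (rule kernel_homogE[OF kh g(1)]) blast
    have hp: "h permutes \<Omega>" using h(1) by (rule permutes)
    have same: "card (fibre a (g x)) = card (fibre a (h x))" if x: "x \<in> \<Omega>" for x
    proof -
      have "{y\<in>\<Omega>. a (g y) = a (g x)} = {y\<in>\<Omega>. a (h y) = a (h x)}" using h(2) x by blast
      then show ?thesis by (simp only: card_fibre_permuted[OF g(1)] card_fibre_permuted[OF hp])
    qed
    have "h x \<in> ?C" if "x \<in> X" for x
    proof -
      have x: "x \<in> \<Omega>" using that X(1) by blast
      have "g x \<in> ?C" using that g(2) by blast
      then show ?thesis using same[OF x] apply_mem[OF h(1) x] by (simp add: fibre_class_def)
    qed
    then have "h ` X \<subseteq> ?C" by blast
    moreover have "card (h ` X) = card ?C" using card_image_mem[OF h(1)] X(2) by simp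
    moreover have "finite ?C" using C finite_points by (rule finite_subset)
    ultimately have "h ` X = ?C" by (intro card_subset_eq)
    with h(1) show ?thesis by blast
  qed
  show ?thesis
    unfolding homog_def
  proof (intro allI impI, elim conjE)
    fix X Y assume XY: "X \<subseteq> \<Omega>" "Y \<subseteq> \<Omega>" "card X = card ?C" "card Y = card ?C"
    obtain h where h: "h \<in> G" "h ` X = ?C" using to_C[OF XY(1,3)] by blast
    obtain k where k: "k \<in> G" "k ` Y = ?C" using to_C[OF XY(2,4)] by blast
    have "(inv k \<circ> h) ` X = inv k ` k ` Y" by (simp only: image_comp[symmetric] h(2) k(2))
    also have "\<dots> = Y" using k(1) by (rule image_inv(1))
    finally have "(inv k \<circ> h) ` X = Y" .
    moreover have "inv k \<circ> h \<in> G" using h k by (intro comp_mem inv_mem)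
    ultimately show "\<exists>g\<in>G. g ` X = Y" by blast
  qed
qed

section \<open>Counting kernels modulo a prime\<close>

definition kernel :: "('a \<Rightarrow> 'b) \<Rightarrow> ('a \<times> 'a) set" where
  "kernel f = {(x, y). x \<in> \<Omega> \<and> y \<in> \<Omega> \<and> f x = f y}"

lemma kernel_comp:
  assumes "g permutes \<Omega>"
  shows "(x, y) \<in> kernel (f \<circ> g) \<longleftrightarrow> (g x, g y) \<in> kernel f"
  using permutes_in_image[OF assms] by (simp add: kernel_def)

lemma kernel_comp_eq_iff:
  fixes f f' :: "'a \<Rightarrow> 'b"
  assumes g: "g permutes \<Omega>"
  shows "kernel (f \<circ> g) = kernel (f' \<circ> g) \<longleftrightarrow> kernel f = kernel f'"
proof
  assume eq: "kernel (f \<circ> g) = kernel (f' \<circ> g)"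
  have *: "(x, y) \<in> kernel e \<longleftrightarrow> (inv g x, inv g y) \<in> kernel (e \<circ> g)" for x y and e :: "'a \<Rightarrow> 'b"
    unfolding kernel_comp[OF g] by (simp add: permutes_inverses[OF g])
  show "kernel f = kernel f'"
    using *[of _ _ f] *[of _ _ f'] eq by auto
next
  assume eq: "kernel f = kernel f'"
  have "(x, y) \<in> kernel (f \<circ> g) \<longleftrightarrow> (x, y) \<in> kernel (f' \<circ> g)" for x y
    unfolding kernel_comp[OF g] eq ..
  then show "kernel (f \<circ> g) = kernel (f' \<circ> g)" by auto
qed

text \<open>Orbit and stabiliser: two elements of \<open>G\<close> yield the same kernel exactly if
  they lie in the same right coset of the stabiliser \<open>S\<close> of the kernel of
  \<open>a\<close>.\<close>

lemma card_kernels_dvd: "card ((\<lambda>h. kernel (a \<circ> h)) ` G) dvd card G"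
proof -
  let ?K = "\<lambda>h. kernel (a \<circ> h)"
  define S where "S = {k\<in>G. kernel (a \<circ> k) = kernel a}"
  have "card {h\<in>G. ?K h = K} = card S" if K: "K \<in> ?K ` G" for K
  proof -
    obtain h0 where h0: "h0 \<in> G" "K = ?K h0" using K by blast
    have h0p: "h0 permutes \<Omega>" using h0(1) by (rule permutes)
    have "{h\<in>G. ?K h = K} = (\<lambda>k. k \<circ> h0) ` S"
    proof
      show "{h\<in>G. ?K h = K} \<subseteq> (\<lambda>k. k \<circ> h0) ` S"
      proof
        fix h assume h: "h \<in> {h\<in>G. ?K h = K}"
        have e: "(h \<circ> inv h0) \<circ> h0 = h" using h0(1) by (auto simp: fun_eq_iff)
        have "kernel ((a \<circ> (h \<circ> inv h0)) \<circ> h0) = kernel (a \<circ> h0)"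
          using h h0(2) e by (simp only: comp_assoc) simp
        then have "kernel (a \<circ> (h \<circ> inv h0)) = kernel a" by (simp only: kernel_comp_eq_iff[OF h0p])
        then have "h \<circ> inv h0 \<in> S" using h h0(1) by (simp only: S_def mem_Collect_eq comp_mem inv_mem)
        then show "h \<in> (\<lambda>k. k \<circ> h0) ` S" using e by (metis imageI)
      qed
      show "(\<lambda>k. k \<circ> h0) ` S \<subseteq> {h\<in>G. ?K h = K}"
      proof
        fix h assume "h \<in> (\<lambda>k. k \<circ> h0) ` S"
        then obtain k where k: "k \<in> S" "h = k \<circ> h0" by blast
        have "kernel ((a \<circ> k) \<circ> h0) = kernel (a \<circ> h0)"
          using k(1) by (simp only: kernel_comp_eq_iff[OF h0p] S_def mem_Collect_eq)
        then show "h \<in> {h\<in>G. ?K h = K}" using k h0 comp_mem by (simp add: S_def comp_assoc)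
      qed
    qed
    moreover have "inj_on (\<lambda>k. k \<circ> h0) S"
    proof (rule inj_onI)
      fix k k' assume "k \<circ> h0 = k' \<circ> h0"
      then have "(k \<circ> h0) \<circ> inv h0 = (k' \<circ> h0) \<circ> inv h0" by simp
      moreover have "h0 \<circ> inv h0 = id" using h0(1) by (rule comp_inv)
      ultimately show "k = k'" by (simp only: comp_assoc comp_id)
    qed
    ultimately show ?thesis by (simp add: card_image)
  qed
  then have "card G = card (?K ` G) * card S" by (rule card_eq_mult_if_fibres_eq[OF finite_group])
  then show ?thesis by simp
qed

text \<open>Cauchy's theorem in the full symmetric group, whose order is a factorial, replaces the
  construction of an explicit cycle.\<close>

lemma exists_prime_cycle:
  fixes p :: nat
  assumes p: "prime p" "p \<le> card \<Omega>"
  obtains \<tau> where "\<tau> permutes \<Omega>" "\<tau> \<noteq> id" "\<tau> ^^ p = id"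
proof -
  interpret S: perm_group \<Omega> "{g. g permutes \<Omega>}"
    by unfold_locales (auto simp: finite_points permutes_id permutes_compose permutes_inv)
  have "p dvd card {g. g permutes \<Omega>}"
    using p by (simp add: card_permutations[OF refl finite_points] prime_dvd_fact_iff)
  from S.cauchy[OF p(1) this] that show ?thesis by blast
qed

text \<open>A \<open>p\<close>-cycle fixes a partition only if its support lies in one part or consists of singletons.\<close>

lemma prime_dvd_card_if_kernel_homog:
  fixes p :: nat
  assumes kh: "kernel_homog a" and p: "prime p" "p \<le> card \<Omega>" "card \<Omega> < 2 * p"
    and fib: "\<And>x. x \<in> \<Omega> \<Longrightarrow> card (fibre a x) < p" and one: "card (fibre_class a 1) < p"
  shows "p dvd card G"
proof -
  obtain \<tau> where \<tau>: "\<tau> permutes \<Omega>" "\<tau> \<noteq> id" "\<tau> ^^ p = id" by (rule exists_prime_cycle[OF p(1,2)])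
  let ?\<Gamma> = "{x. \<tau> x \<noteq> x}"
  have reach: "\<exists>i<p. (\<tau> ^^ i) x = y" if "\<tau> x \<noteq> x" "\<tau> y \<noteq> y" for x y
    using support_of_prime_order(2)[OF p(1) \<tau>(1,3,2) p(3)] that by blast
  have c\<Gamma>: "card ?\<Gamma> = p" by (rule support_of_prime_order(1)[OF p(1) \<tau>(1,3,2) p(3)])
  have \<Gamma>\<Omega>: "?\<Gamma> \<subseteq> \<Omega>" using \<tau>(1) by (auto simp: permutes_def)
  define X where "X = (\<lambda>h. kernel (a \<circ> h)) ` G"
  \<comment> \<open>By homogeneity the kernels reached by \<open>G\<close> are all those reached by
    arbitrary permutations, so \<open>\<tau>\<close> acts on \<open>X\<close> although it need not
    lie in \<open>G\<close>.\<close>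
  have X_perm: "X = (\<lambda>g. kernel (a \<circ> g)) ` {g. g permutes \<Omega>}"
  proof
    show "X \<subseteq> (\<lambda>g. kernel (a \<circ> g)) ` {g. g permutes \<Omega>}" using permutes by (auto simp: X_def)
    show "(\<lambda>g. kernel (a \<circ> g)) ` {g. g permutes \<Omega>} \<subseteq> X"
    proof
      fix K assume "K \<in> (\<lambda>g. kernel (a \<circ> g)) ` {g. g permutes \<Omega>}"
      then obtain g where g: "g permutes \<Omega>" "K = kernel (a \<circ> g)" by blast
      obtain h where h: "h \<in> G" "\<And>x y. x \<in> \<Omega> \<Longrightarrow> y \<in> \<Omega> \<Longrightarrow> a (g x) = a (g y) \<longleftrightarrow> a (h x) = a (h y)"
        by (rule kernel_homogE[OF kh g(1)]) blast
      have "kernel (a \<circ> g) = kernel (a \<circ> h)" using h(2) by (auto simp: kernel_def)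
      then show "K \<in> X" using g(2) h(1) by (auto simp: X_def)
    qed
  qed
  define \<pi> where "\<pi> K = {(x, y). (\<tau> x, \<tau> y) \<in> K}" for K :: "('a \<times> 'a) set"
  have \<pi>_kernel: "\<pi> (kernel f) = kernel (f \<circ> \<tau>)" for f :: "'a \<Rightarrow> 'b"
    using kernel_comp[OF \<tau>(1), of _ _ f] by (auto simp: \<pi>_def)
  have \<pi>_pow: "(\<pi> ^^ i) (kernel f) = kernel (f \<circ> \<tau> ^^ i)" for f :: "'a \<Rightarrow> 'b" and i
  proof (induction i)
    case (Suc i)
    have "(\<pi> ^^ Suc i) (kernel f) = \<pi> ((\<pi> ^^ i) (kernel f))" by simp
    also have "\<dots> = \<pi> (kernel (f \<circ> \<tau> ^^ i))" by (rule arg_cong[OF Suc])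
    also have "\<dots> = kernel ((f \<circ> \<tau> ^^ i) \<circ> \<tau>)" by (rule \<pi>_kernel)
    also have "(f \<circ> \<tau> ^^ i) \<circ> \<tau> = f \<circ> \<tau> ^^ Suc i" by (simp only: comp_assoc funpow_Suc_right)
    finally show ?case .
  qed simp
  have "card X mod p = card {K\<in>X. \<pi> K = K} mod p"
  proof (rule card_mod_prime_fixed_points[OF p(1)])
    show "finite X" using finite_group by (simp add: X_def)
    show "\<pi> ` X \<subseteq> X"
    proof
      fix L assume "L \<in> \<pi> ` X"
      then obtain g where g: "g permutes \<Omega>" "L = \<pi> (kernel (a \<circ> g))" unfolding X_perm by blast
      have "g \<circ> \<tau> permutes \<Omega>" using \<tau>(1) g(1) by (rule permutes_compose)
      moreover have "L = kernel (a \<circ> (g \<circ> \<tau>))" unfolding g(2) \<pi>_kernel by (simp only: comp_assoc)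
      ultimately show "L \<in> X" unfolding X_perm by blast
    qed
    show "(\<pi> ^^ p) K = K" if "K \<in> X" for K
      using that \<tau>(3) by (auto simp: X_def \<pi>_pow)
  qed
  moreover have "{K\<in>X. \<pi> K = K} = {}"
  proof (rule ccontr)
    assume "{K\<in>X. \<pi> K = K} \<noteq> {}"
    then obtain g where g: "g permutes \<Omega>" "\<pi> (kernel (a \<circ> g)) = kernel (a \<circ> g)"
      unfolding X_perm by blast
    have inv1: "a (g (\<tau> x)) = a (g (\<tau> y)) \<longleftrightarrow> a (g x) = a (g y)" if "x \<in> \<Omega>" "y \<in> \<Omega>" for x y
    proof -
      have "(x, y) \<in> \<pi> (kernel (a \<circ> g)) \<longleftrightarrow> (x, y) \<in> kernel (a \<circ> g)" using g(2) by simp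
      then show ?thesis using that permutes_in_image[OF \<tau>(1)] by (simp add: \<pi>_def kernel_def)
    qed
    have \<tau>\<Omega>: "(\<tau> ^^ i) x \<in> \<Omega>" if "x \<in> \<Omega>" for i x
      using that permutes_in_image[OF \<tau>(1)] by (induction i) auto
    have inv_pow: "a (g ((\<tau> ^^ i) x)) = a (g ((\<tau> ^^ i) y)) \<longleftrightarrow> a (g x) = a (g y)"
      if "x \<in> \<Omega>" "y \<in> \<Omega>" for i x y
      using that by (induction i) (simp_all add: inv1 \<tau>\<Omega>)
    show False
    \<comment> \<open>If a point \<open>x\<close> of the cycle shares its part with another point
      \<open>y\<close>, some \<open>\<tau> ^^ i\<close> with \<open>0 < i < p\<close> keeps
      \<open>x\<close> in its part: \<open>i = 1\<close> if \<open>\<tau>\<close> fixes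
      \<open>y\<close>, and otherwise the \<open>i\<close> leading from \<open>x\<close> to
      \<open>y\<close>. As \<open>i\<close> is prime to \<open>p\<close>, the whole cycle lies in
      that part. Without such an \<open>x\<close> the cycle consists of singletons.\<close>
    proof (cases "\<exists>x\<in>?\<Gamma>. \<exists>y\<in>\<Omega>. y \<noteq> x \<and> a (g y) = a (g x)")
      case True
      then obtain x y where xy: "\<tau> x \<noteq> x" "y \<in> \<Omega>" "y \<noteq> x" "a (g y) = a (g x)" by blast
      have x\<Omega>: "x \<in> \<Omega>" using xy(1) \<Gamma>\<Omega> by blast
      obtain i where i: "0 < i" "i < p" "a (g ((\<tau> ^^ i) x)) = a (g x)"
      proof (cases "\<tau> y = y")
        case True
        have "a (g (\<tau> y)) = a (g (\<tau> x))" using inv1[OF xy(2) x\<Omega>] xy(4) by simp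
        then have "a (g ((\<tau> ^^ 1) x)) = a (g x)" using True xy(4) by simp
        then show ?thesis using that[of 1] prime_gt_1_nat[OF p(1)] by simp
      next
        case False
        then obtain j where j: "j < p" "(\<tau> ^^ j) x = y" using reach[OF xy(1)] by blast
        then have "j > 0" using xy(3) by (cases j) auto
        then show ?thesis using that[of j] j xy(4) by simp
      qed
      have mult: "a (g ((\<tau> ^^ (i * k)) x)) = a (g x)" for k
      proof (induction k)
        case (Suc k)
        have "(\<tau> ^^ (i * Suc k)) x = (\<tau> ^^ i) ((\<tau> ^^ (i * k)) x)" by (simp add: funpow_add)
        then have "a (g ((\<tau> ^^ (i * Suc k)) x)) = a (g ((\<tau> ^^ i) x))"
          using inv_pow[OF \<tau>\<Omega>[OF x\<Omega>] x\<Omega>, of i] Suc by simp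
        with i(3) show ?case by simp
      qed simp
      have "coprime i p"
        using p(1) i(1,2) by (metis coprime_commute nat_dvd_not_less prime_imp_coprime)
      then obtain b c where bc: "i * b = p * c + 1"
        using coprime_bezout_strong[of i p] prime_gt_1_nat[OF p(1)] by auto
      have "?\<Gamma> \<subseteq> {z\<in>\<Omega>. a (g z) = a (g x)}"
      proof
        fix z assume z: "z \<in> ?\<Gamma>"
        then obtain j where j: "(\<tau> ^^ j) x = z" using reach[OF xy(1), of z] by blast
        have cl: "(\<tau> ^^ p) x = x" using \<tau>(3) by simp
        have "i * (b * j) = (p * c + 1) * j" by (simp only: bc[symmetric] mult.assoc)
        also have "\<dots> = j + p * (c * j)" by (simp add: add_mult_distrib)
        finally have "i * (b * j) = j + p * (c * j)" .
        then have "(i * (b * j)) mod p = j mod p" by simp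
        then have "(\<tau> ^^ (i * (b * j))) x = z"
          using funpow_mod_eq[OF cl] j by metis
        then show "z \<in> {z\<in>\<Omega>. a (g z) = a (g x)}" using mult[of "b * j"] z \<Gamma>\<Omega> by auto
      qed
      then have "card ?\<Gamma> \<le> card {z\<in>\<Omega>. a (g z) = a (g x)}" using finite_points by (intro card_mono) auto
      then have "p \<le> card (fibre a (g x))" unfolding c\<Gamma> card_fibre_permuted[OF g(1), of a x] .
      then show False using fib[of "g x"] x\<Omega> permutes_in_image[OF g(1)] by simp
    next
      case False
      have "g ` ?\<Gamma> \<subseteq> fibre_class a 1"
      proof
        fix z assume "z \<in> g ` ?\<Gamma>"
        then obtain x where x: "x \<in> ?\<Gamma>" "z = g x" by blast
        have "{y\<in>\<Omega>. a (g y) = a (g x)} = {x}" using False x(1) \<Gamma>\<Omega> by blast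
        then have "card (fibre a z) = 1" unfolding x(2) card_fibre_permuted[OF g(1), of a x] by simp
        then show "z \<in> fibre_class a 1" using x \<Gamma>\<Omega> permutes_in_image[OF g(1)] by (auto simp: fibre_class_def)
      qed
      then have "card (g ` ?\<Gamma>) \<le> card (fibre_class a 1)"
        using finite_points by (intro card_mono) (auto simp: fibre_class_def)
      moreover have "card (g ` ?\<Gamma>) = p"
        using c\<Gamma> permutes_inj[OF g(1)] by (simp add: card_image inj_on_subset[OF _ subset_UNIV])
      ultimately show False using one by simp
    qed
  qed
  ultimately have "p dvd card X" by (simp add: mod_eq_0_iff_dvd)
  then show ?thesis using card_kernels_dvd[of a] unfolding X_def by (rule dvd_trans)
qed

section \<open>Numbers of parts and possible kernel types\<close>

lemma image_fibre_class:
  "card (fibre_class a k) = k * card (a ` fibre_class a k)"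
proof -
  have "card {x\<in>fibre_class a k. a x = y} = k" if y: "y \<in> a ` fibre_class a k" for y
  proof -
    obtain z where z: "y = a z" "z \<in> \<Omega>" "card (fibre a z) = k" using y by (auto simp: fibre_class_def)
    have eq: "fibre a x = fibre a z" if "a x = a z" for x using that by (simp only: fibre_def)
    have "{x\<in>fibre_class a k. a x = y} = fibre a z"
    proof (intro subset_antisym subsetI)
      fix x assume "x \<in> {x\<in>fibre_class a k. a x = y}"
      then show "x \<in> fibre a z" using z(1) by (simp add: fibre_def fibre_class_def)
    next
      fix x assume x: "x \<in> fibre a z"
      then have "card (fibre a x) = k" using eq z(3) by (simp only: fibre_def) simp
      then show "x \<in> {x\<in>fibre_class a k. a x = y}" using x z(1) by (simp add: fibre_class_def) (simp add: fibre_def)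
    qed
    then show ?thesis using z(3) by simp
  qed
  then show ?thesis
    using card_eq_mult_if_fibres_eq[of "fibre_class a k" a k] finite_points
    by (simp add: fibre_class_def mult.commute)
qed

lemma fibre_class_subset: "fibre_class a k \<subseteq> \<Omega>"
  by (auto simp: fibre_class_def)

lemma finite_fibre_class: "finite (fibre_class a k)"
  using fibre_class_subset finite_points by (rule finite_subset)

lemma mem_fibre: "x \<in> \<Omega> \<Longrightarrow> x \<in> fibre a x"
  by (simp add: fibre_def)

lemma card_fibre_pos: "x \<in> \<Omega> \<Longrightarrow> 0 < card (fibre a x)"
  using mem_fibre finite_fibre card_gt_0_iff by blast

lemma singleton_class_iff: "x \<in> fibre_class a 1 \<longleftrightarrow> x \<in> \<Omega> \<and> (\<forall>y\<in>\<Omega>. a y = a x \<longrightarrow> y = x)"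
proof -
  have "card (fibre a x) = 1 \<longleftrightarrow> (\<forall>y\<in>\<Omega>. a y = a x \<longrightarrow> y = x)" if x: "x \<in> \<Omega>"
  proof
    assume "card (fibre a x) = 1"
    then obtain z where "fibre a x = {z}" by (meson card_1_singletonE)
    then show "\<forall>y\<in>\<Omega>. a y = a x \<longrightarrow> y = x" using mem_fibre[OF x, of a] by (auto simp: fibre_def)
  next
    assume "\<forall>y\<in>\<Omega>. a y = a x \<longrightarrow> y = x"
    then have "fibre a x = {x}" using x by (auto simp: fibre_def)
    then show "card (fibre a x) = 1" by simp
  qed
  then show ?thesis by (auto simp: fibre_class_def)
qed

lemmas singleton_class_iff' = singleton_class_iff[unfolded One_nat_def]

text \<open>\<open>G\<close> is homogeneous of degree the size of the class; a size between
  \<open>d\<close> and \<open>card \<Omega> - d\<close> would therefore give degree \<open>d\<close>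
  by Livingstone-Wagner.\<close>

lemma fibre_class_homog_bound:
  assumes "kernel_homog a" "\<not> homog d" "d \<le> card \<Omega>"
  shows "card (fibre_class a k) < d \<or> card \<Omega> - d < card (fibre_class a k)"
  using livingstone_wagner[OF homog_fibre_class[OF assms(1), of k], of d] assms(2,3) by fastforce

lemma card_image_eq_singletons:
  "card (a ` \<Omega>) = card (fibre_class a 1) + card (a ` (\<Omega> - fibre_class a 1))"
proof -
  let ?C = "fibre_class a 1"
  have "inj_on a ?C" by (rule inj_onI) (auto simp: singleton_class_iff')
  then have "card (a ` ?C) = card ?C" by (rule card_image)
  moreover have "a ` ?C \<inter> a ` (\<Omega> - ?C) = {}"
  proof (rule ccontr)
    assume "\<not> ?thesis"
    then obtain x y where xy: "x \<in> ?C" "y \<in> \<Omega> - ?C" "a y = a x" by force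
    then have "y = x" by (simp add: singleton_class_iff')
    with xy show False by simp
  qed
  moreover have "a ` \<Omega> = a ` ?C \<union> a ` (\<Omega> - ?C)" using fibre_class_subset[of a 1] by blast
  ultimately show ?thesis
    by (simp add: card_Un_disjoint finite_points finite_fibre_class)
qed

text \<open>The second conjunct says that the kernel type of \<open>a\<close> is \<open>(n - d + 1, 1, \<dots>, 1)\<close>.\<close>

lemma kernel_type_if_large_prime:
  fixes p :: nat
  assumes kh: "kernel_homog a" and nh: "\<not> homog d" and d: "2 * d \<le> card \<Omega>" "2 \<le> d"
    and h1: "homog 1" and p: "prime p" "p \<le> card \<Omega>" "card \<Omega> < 2 * p"
    and dp: "d \<le> card \<Omega> - p + 1 \<or> p + 3 \<le> card \<Omega>" and rank: "d \<le> card (a ` \<Omega>)"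
  shows "d - 1 \<le> card (fibre_class a 1) \<and>
    (card (a ` \<Omega>) \<le> card \<Omega> - d \<longrightarrow> card (fibre_class a 1) = d - 1 \<and> card (a ` \<Omega>) = d)"
proof -
  let ?u = "card (fibre_class a 1)"
  have d\<Omega>: "d \<le> card \<Omega>" using d by simp
  note bound = fibre_class_homog_bound[OF kh nh d\<Omega>]
  have "\<not> p dvd card G" using jordan[OF h1 p(1,3) _ dp] nh by blast
  then have "(\<exists>x\<in>\<Omega>. p \<le> card (fibre a x)) \<or> p \<le> ?u"
    using prime_dvd_card_if_kernel_homog[OF kh p] by (meson not_le)
  then show ?thesis
  proof
    assume u: "p \<le> ?u"
    \<comment> \<open>With this many singletons the rank exceeds \<open>card \<Omega> - d\<close>,
      and the second conjunct holds vacuously.\<close>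
    then have "card \<Omega> - d < ?u" using bound[of 1] d p(3) by linarith
    moreover have "?u \<le> card (a ` \<Omega>)" using card_image_eq_singletons[of a] by simp
    ultimately show ?thesis using d by linarith
  next
    assume "\<exists>x\<in>\<Omega>. p \<le> card (fibre a x)"
    then obtain x where x: "x \<in> \<Omega>" "p \<le> card (fibre a x)" by blast
    let ?F = "fibre a x"
    let ?K = "card ?F"
    have F\<Omega>: "?F \<subseteq> \<Omega>" by (auto simp: fibre_def)
    \<comment> \<open>Two parts of size at least \<open>p\<close> would exceed
      \<open>card \<Omega>\<close>, so the part is the only one of its size and the bound on class
      sizes applies to the part itself.\<close>
    have "fibre_class a ?K = ?F"
    proof
      show "?F \<subseteq> fibre_class a ?K" by (auto simp: fibre_class_def fibre_def)
      show "fibre_class a ?K \<subseteq> ?F"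
      proof (rule ccontr)
        assume "\<not> fibre_class a ?K \<subseteq> ?F"
        then obtain y where y: "y \<in> \<Omega>" "card (fibre a y) = ?K" "y \<notin> ?F" by (auto simp: fibre_class_def)
        have "fibre a y \<inter> ?F = {}" using y(1,3) by (auto simp: fibre_def)
        then have "card (fibre a y \<union> ?F) = ?K + ?K"
          using y(2) by (simp add: card_Un_disjoint finite_fibre)
        moreover have "card (fibre a y \<union> ?F) \<le> card \<Omega>"
          using finite_points by (intro card_mono) (auto simp: fibre_def)
        ultimately show False using x(2) p(3) by simp
      qed
    qed
    then have K: "card \<Omega> - d < ?K" using bound[of ?K] d p(3) x(2) by simp
    have cD: "card (\<Omega> - ?F) = card \<Omega> - ?K" using F\<Omega> by (simp add: card_Diff_subset finite_fibre)
    have KO: "?K \<le> card \<Omega>" using F\<Omega> finite_points by (rule card_mono[rotated])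
    have "a ` ?F = {a x}" using mem_fibre[OF x(1)] by (auto simp: fibre_def)
    moreover have "a ` \<Omega> = a ` ?F \<union> a ` (\<Omega> - ?F)" using F\<Omega> by blast
    moreover have "a x \<notin> a ` (\<Omega> - ?F)" by (auto simp: fibre_def)
    ultimately have r: "card (a ` \<Omega>) = Suc (card (a ` (\<Omega> - ?F)))"
      using finite_points by simp
    have le: "card (a ` (\<Omega> - ?F)) \<le> card (\<Omega> - ?F)" using finite_points by (intro card_image_le) simp
    \<comment> \<open>At most \<open>d - 1\<close> points lie outside the large part, but rank at
      least \<open>d\<close> requires \<open>d - 1\<close> values there; so \<open>a\<close> is
      injective on exactly \<open>d - 1\<close> remaining points.\<close>
    then have eq: "card (a ` (\<Omega> - ?F)) = card (\<Omega> - ?F)" "card (\<Omega> - ?F) = d - 1"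
      using r rank cD K KO by linarith+
    then have inj: "inj_on a (\<Omega> - ?F)" using finite_points by (intro eq_card_imp_inj_on) simp_all
    have "fibre_class a 1 = \<Omega> - ?F"
    proof
      show "\<Omega> - ?F \<subseteq> fibre_class a 1"
      proof
        fix y assume y: "y \<in> \<Omega> - ?F"
        have "z = y" if "z \<in> \<Omega>" "a z = a y" for z
        proof -
          have "z \<notin> ?F" using y that by (auto simp: fibre_def)
          then show ?thesis using inj_onD[OF inj that(2)] that(1) y by blast
        qed
        then show "y \<in> fibre_class a 1" using y unfolding singleton_class_iff by blast
      qed
      show "fibre_class a 1 \<subseteq> \<Omega> - ?F"
      proof
        fix y assume y: "y \<in> fibre_class a 1"
        have "y \<notin> ?F"
        proof
          assume "y \<in> ?F"
          then have "fibre a y = ?F" by (simp add: fibre_def)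
          then have "?K = 1" using y by (simp add: fibre_class_def)
          then show False using x(2) p(3) d by simp
        qed
        then show "y \<in> \<Omega> - ?F" using y fibre_class_subset by blast
      qed
    qed
    then show ?thesis using eq r d by simp
  qed
qed

text \<open>The numbers of parts of each size as solutions of two linear equations, so that the
  partitions of 6 can be enumerated by linear arithmetic.\<close>

lemma rank_by_fibre_classes:
  assumes "card \<Omega> = 6"
  shows "card (a ` \<Omega>) = (\<Sum>k=1..6. card (a ` fibre_class a k))"
    and "(\<Sum>k=1..6. k * card (a ` fibre_class a k)) = 6"
proof -
  have le: "card (fibre a x) \<in> {1..6}" if "x \<in> \<Omega>" for x
  proof -
    have "card (fibre a x) \<le> card \<Omega>" using finite_points by (intro card_mono) (auto simp: fibre_def)
    then show ?thesis using assms card_fibre_pos[OF that, of a] by simp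
  qed
  have un: "\<Omega> = (\<Union>k\<in>{1..6}. fibre_class a k)"
    using le by (auto simp: fibre_class_def)
  have "card (a ` \<Omega>) = card (\<Union>k\<in>{1..6}. a ` fibre_class a k)"
    by (subst un) (simp only: image_UN)
  also have "\<dots> = (\<Sum>k=1..6. card (a ` fibre_class a k))"
  proof (rule card_UN_disjoint)
    show "\<forall>i\<in>{1..6}. \<forall>j\<in>{1..6}. i \<noteq> j \<longrightarrow> a ` fibre_class a i \<inter> a ` fibre_class a j = {}"
    proof (intro ballI impI)
      fix i j :: nat assume "i \<noteq> j"
      show "a ` fibre_class a i \<inter> a ` fibre_class a j = {}"
      proof (rule ccontr)
        assume "a ` fibre_class a i \<inter> a ` fibre_class a j \<noteq> {}"
        then obtain x y where "x \<in> fibre_class a i" "y \<in> fibre_class a j" "a x = a y" by blast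
        then have "i = j" by (auto simp: fibre_class_def fibre_def)
        with \<open>i \<noteq> j\<close> show False ..
      qed
    qed
  qed (simp_all add: finite_fibre_class)
  finally show "card (a ` \<Omega>) = (\<Sum>k=1..6. card (a ` fibre_class a k))" .
  have "6 = card (\<Union>k\<in>{1..6}. fibre_class a k)" using un assms by simp
  also have "\<dots> = (\<Sum>k=1..6. card (fibre_class a k))"
    by (rule card_UN_disjoint) (auto simp: finite_fibre_class, auto simp: fibre_class_def)
  finally show "(\<Sum>k=1..6. k * card (a ` fibre_class a k)) = 6" by (simp only: image_fibre_class)
qed

text \<open>Among the partitions of 6 into at least three parts, \<open>(3,2,1)\<close> and
  \<open>(3,1,1,1)\<close> have a class of size 3, \<open>(1,1,1,1,1,1)\<close> is injective and
  \<open>(2,2,2)\<close> is refuted by perfect matchings. This leaves \<open>(4,1,1)\<close>,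
  \<open>(2,2,1,1)\<close> and \<open>(2,1,1,1,1)\<close>.\<close>

lemma kernel_type_6_3:
  assumes kh: "kernel_homog a" and nh: "\<not> homog 3" and c6: "card \<Omega> = 6" and h2: "homog 2"
    and rank: "3 \<le> card (a ` \<Omega>)" and sing: "\<not> inj_on a \<Omega>"
  shows "3 - 1 \<le> card (fibre_class a 1) \<and>
    (card (a ` \<Omega>) \<le> card \<Omega> - 3 \<longrightarrow> card (fibre_class a 1) = 3 - 1 \<and> card (a ` \<Omega>) = 3)"
proof -
  define \<nu> where "\<nu> k = card (a ` fibre_class a k)" for k
  have sums: "\<nu> 1 + \<nu> 2 + \<nu> 3 + \<nu> 4 + \<nu> 5 + \<nu> 6 = card (a ` \<Omega>)"
    "\<nu> 1 + 2 * \<nu> 2 + 3 * \<nu> 3 + 4 * \<nu> 4 + 5 * \<nu> 5 + 6 * \<nu> 6 = 6"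
  proof -
    have six: "{1..6::nat} = {1, 2, 3, 4, 5, 6}" by auto
    show "\<nu> 1 + \<nu> 2 + \<nu> 3 + \<nu> 4 + \<nu> 5 + \<nu> 6 = card (a ` \<Omega>)"
      using rank_by_fibre_classes(1)[OF c6, of a] unfolding six by (simp add: \<nu>_def)
    show "\<nu> 1 + 2 * \<nu> 2 + 3 * \<nu> 3 + 4 * \<nu> 4 + 5 * \<nu> 5 + 6 * \<nu> 6 = 6"
      using rank_by_fibre_classes(2)[OF c6, of a] unfolding six by (simp add: \<nu>_def)
  qed
  have u: "card (fibre_class a 1) = \<nu> 1" using image_fibre_class[of a 1] by (simp add: \<nu>_def)
  have n3: "card (fibre_class a k) \<noteq> 3" for k
    using fibre_class_homog_bound[OF kh nh, of k] c6 by auto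
  have "\<nu> 3 \<noteq> 1" using n3[of 3] image_fibre_class[of a 3] by (auto simp: \<nu>_def)
  moreover have "\<nu> 1 \<noteq> 6"
  proof
    assume "\<nu> 1 = 6"
    then have "fibre_class a 1 = \<Omega>" using u c6 finite_points fibre_class_subset by (intro card_subset_eq) auto
    have "inj_on a \<Omega>"
    proof (rule inj_onI)
      fix x y assume xy: "x \<in> \<Omega>" "y \<in> \<Omega>" "a x = a y"
      then have "y \<in> fibre_class a 1" using \<open>fibre_class a 1 = \<Omega>\<close> by simp
      with xy show "x = y" by (simp add: singleton_class_iff')
    qed
    with sing show False by simp
  qed
  moreover have "\<nu> 2 \<noteq> 3"
  proof
    assume "\<nu> 2 = 3"
    then have "card (fibre_class a 2) = 6" using image_fibre_class[of a 2] by (simp add: \<nu>_def)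
    then have all2: "fibre_class a 2 = \<Omega>" using c6 finite_points fibre_class_subset by (intro card_subset_eq) auto
    have f2: "card (fibre a x) = 2" if "x \<in> \<Omega>" for x using all2 that by (auto simp: fibre_class_def)
    have "card (a ` \<Omega>) = 3" using \<open>\<nu> 2 = 3\<close> all2 by (simp add: \<nu>_def)
    then obtain v1 v2 v3 where v: "a ` \<Omega> = {v1, v2, v3}" "v1 \<noteq> v2" "v1 \<noteq> v3" "v2 \<noteq> v3"
      by (auto simp: card_3_iff)
    have pair: "\<exists>p q. p \<noteq> q \<and> {x\<in>\<Omega>. a x = v} = {p, q}" if v: "v \<in> a ` \<Omega>" for v
    proof -
      obtain x where x: "x \<in> \<Omega>" "v = a x" using v by blast
      then have "{y\<in>\<Omega>. a y = v} = fibre a x" by (simp add: fibre_def)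
      then show ?thesis using f2[OF x(1)] by (auto simp: card_2_iff)
    qed
    obtain p1 q1 where 1: "p1 \<noteq> q1" "{x\<in>\<Omega>. a x = v1} = {p1, q1}" using pair[of v1] v by auto
    obtain p2 q2 where 2: "p2 \<noteq> q2" "{x\<in>\<Omega>. a x = v2} = {p2, q2}" using pair[of v2] v by auto
    obtain p3 q3 where 3: "p3 \<noteq> q3" "{x\<in>\<Omega>. a x = v3} = {p3, q3}" using pair[of v3] v by auto
    have vals: "a p1 = v1" "a q1 = v1" "a p2 = v2" "a q2 = v2" "a p3 = v3" "a q3 = v3"
      and mem: "p1 \<in> \<Omega>" "q1 \<in> \<Omega>" "p2 \<in> \<Omega>" "q2 \<in> \<Omega>" "p3 \<in> \<Omega>" "q3 \<in> \<Omega>"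
      using 1 2 3 by auto
    have dist: "distinct [p1, q1, p2, q2, p3, q3]" using vals v 1 2 3 by auto
    have cover: "{p1, q1, p2, q2, p3, q3} = \<Omega>"
    proof
      show "\<Omega> \<subseteq> {p1, q1, p2, q2, p3, q3}"
      proof
        fix x assume x: "x \<in> \<Omega>"
        then have "a x \<in> {v1, v2, v3}" using v(1) by blast
        then show "x \<in> {p1, q1, p2, q2, p3, q3}" using x 1(2) 2(2) 3(2) by auto
      qed
    qed (use mem in auto)
    have "homog 3"
    proof (rule homog_3_if_matching_transitive[OF c6 h2 dist cover])
      fix x1 y1 x2 y2 x3 y3
      assume d: "distinct [x1, y1, x2, y2, x3, y3]" and c: "{x1, y1, x2, y2, x3, y3} = \<Omega>"
      define \<phi> where "\<phi> = id(x1 := p1, y1 := q1, x2 := p2, y2 := q2, x3 := p3, y3 := q3)"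
      have \<phi>: "\<phi> x1 = p1" "\<phi> y1 = q1" "\<phi> x2 = p2" "\<phi> y2 = q2" "\<phi> x3 = p3" "\<phi> y3 = q3"
        using d by (auto simp: \<phi>_def)
      have im: "\<phi> ` \<Omega> = \<Omega>" unfolding c[symmetric] image_insert \<phi> using cover c by simp
      then have "inj_on \<phi> \<Omega>" using finite_points by (simp add: finite_surj_inj eq_card_imp_inj_on)
      then obtain g where g: "g permutes \<Omega>" "\<And>x. x \<in> \<Omega> \<Longrightarrow> g x = \<phi> x"
        using extend_to_permutation[OF finite_points subset_refl] im by blast
      obtain h where h: "h \<in> G" "\<And>x y. x \<in> \<Omega> \<Longrightarrow> y \<in> \<Omega> \<Longrightarrow> a (g x) = a (g y) \<longleftrightarrow> a (h x) = a (h y)"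
        by (rule kernel_homogE[OF kh g(1)]) blast
      have "{h x, h y} \<in> {{p1, q1}, {p2, q2}, {p3, q3}}"
        if xy: "x \<in> \<Omega>" "y \<in> \<Omega>" "x \<noteq> y" "a (\<phi> x) = a (\<phi> y)" for x y
      proof -
        have e: "a (h x) = a (h y)" using h(2)[OF xy(1,2)] g(2) xy by simp
        have m: "h x \<in> \<Omega>" "h y \<in> \<Omega>" using apply_mem[OF h(1)] xy by auto
        have ne: "h x \<noteq> h y" using xy(3) bij_is_inj[OF bij_mem[OF h(1)]] by (simp add: inj_eq)
        have "a (h x) \<in> {v1, v2, v3}" using m(1) v(1) by blast
        then obtain v p q where pq: "a (h x) = v" "{x\<in>\<Omega>. a x = v} = {p, q}" "{p, q} \<in> {{p1, q1}, {p2, q2}, {p3, q3}}"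
          using 1(2) 2(2) 3(2) by blast
        have "h x \<in> {p, q}" "h y \<in> {p, q}" using m e pq by auto
        then have "{h x, h y} = {p, q}" using ne by auto
        then show ?thesis using pq(3) by simp
      qed
      note key = this
      have "{h x1, h y1} \<in> {{p1, q1}, {p2, q2}, {p3, q3}}" "{h x2, h y2} \<in> {{p1, q1}, {p2, q2}, {p3, q3}}"
        "{h x3, h y3} \<in> {{p1, q1}, {p2, q2}, {p3, q3}}"
        by (rule key; use d c \<phi> vals in auto)+
      with h(1) show "\<exists>h\<in>G. {h x1, h y1} \<in> {{p1, q1}, {p2, q2}, {p3, q3}} \<and>
          {h x2, h y2} \<in> {{p1, q1}, {p2, q2}, {p3, q3}} \<and> {h x3, h y3} \<in> {{p1, q1}, {p2, q2}, {p3, q3}}" by (intro bexI[of _ h] conjI)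
    qed
    with nh show False ..
  qed
  ultimately have ne: "\<nu> 3 \<noteq> 1" "\<nu> 1 \<noteq> 6" "\<nu> 2 \<noteq> 3" by blast+
  have z: "\<nu> 5 = 0" "\<nu> 6 = 0" "\<nu> 3 \<le> 1" "\<nu> 4 \<le> 1" using sums rank by linarith+
  then have "\<nu> 3 = 0" using ne(1) by linarith
  note sums' = sums[unfolded z this]
  have "\<nu> 4 = 0 \<or> \<nu> 4 = 1" using z(4) by linarith
  then have "2 \<le> \<nu> 1 \<and> (card (a ` \<Omega>) \<le> 3 \<longrightarrow> \<nu> 1 = 2 \<and> card (a ` \<Omega>) = 3)"
  proof
    assume "\<nu> 4 = 1"
    then have "\<nu> 2 = 0" "\<nu> 1 = 2" using sums' rank by linarith+
    then show ?thesis using sums' \<open>\<nu> 4 = 1\<close> by simp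
  next
    assume 4: "\<nu> 4 = 0"
    have "\<nu> 2 \<noteq> 0" using 4 ne(2) sums' by linarith
    moreover have "\<nu> 2 \<le> 3" using sums' by linarith
    ultimately have "\<nu> 2 = 1 \<or> \<nu> 2 = 2" using ne(3) by linarith
    then show ?thesis using sums' 4 by auto
  qed
  then show ?thesis using u c6 by simp
qed

lemma kernel_type:
  assumes kh: "kernel_homog a" and nh: "\<not> homog d" and d: "2 * d \<le> card \<Omega>" "2 \<le> d"
    and least: "\<And>j. j < d \<Longrightarrow> homog j" and rank: "d \<le> card (a ` \<Omega>)" and sing: "\<not> inj_on a \<Omega>"
  shows "d - 1 \<le> card (fibre_class a 1) \<and>
    (card (a ` \<Omega>) \<le> card \<Omega> - d \<longrightarrow> card (fibre_class a 1) = d - 1 \<and> card (a ` \<Omega>) = d)"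
proof (cases "card \<Omega> = 6 \<and> d = 3")
  case True
  then show ?thesis using kernel_type_6_3[OF kh] nh least[of 2] rank sing by simp
next
  case False
  have h1: "homog 1" using least d by simp
  let ?n = "card \<Omega>"
  have "\<exists>p. prime p \<and> p \<le> ?n \<and> ?n < 2 * p \<and> (d \<le> ?n - p + 1 \<or> p + 3 \<le> ?n)"
  proof (cases "8 \<le> ?n")
    case True
    then obtain p where "prime p" "?n < 2 * p" "p + 3 \<le> ?n" using exists_prime_between by blast
    then show ?thesis by (intro exI[of _ p]) auto
  next
    case False
    \<comment> \<open>Below 8 points no prime satisfies \<open>p + 3 <= n < 2 * p\<close>, but
      \<open>d <= n - p + 1\<close> can be met. For \<open>n = 6\<close> the only candidate is 5,
      which covers \<open>d = 2\<close> but not \<open>d = 3\<close>.\<close>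
    then consider "?n = 4" "d = 2" | "?n = 5" "d = 2" | "?n = 6" "d = 2" | "?n = 7" "d \<le> 3"
      using d \<open>\<not> (card \<Omega> = 6 \<and> d = 3)\<close> by linarith
    then show ?thesis
    proof cases
      case 1
      then show ?thesis by (intro exI[of _ 3]) simp
    next
      case 2
      then show ?thesis by (intro exI[of _ 3]) simp
    next
      case 3
      then show ?thesis by (intro exI[of _ 5]) simp
    next
      case 4
      then show ?thesis by (intro exI[of _ 5]) simp
    qed
  qed
  then obtain p where "prime p" "p \<le> ?n" "?n < 2 * p" "d \<le> ?n - p + 1 \<or> p + 3 \<le> ?n" by blast
  then show ?thesis using kernel_type_if_large_prime[OF kh nh d h1] rank by blast
qed

end

section \<open>Generation by singular maps\<close>

lemma Sn_iff: "f \<in> Sn n \<longleftrightarrow> f permutes {1..n}"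
proof
  assume "f \<in> Sn n"
  then show "f permutes {1..n}" by (intro bij_imp_permutes) (auto simp: Sn_def Tn_def)
next
  assume f: "f permutes {1..n}"
  then have "bij_betw f {1..n} {1..n}" by (rule permutes_imp_bij)
  moreover have "f ` {1..n} = {1..n}" using f by (rule permutes_image)
  moreover have "\<forall>x. x \<notin> {1..n} \<longrightarrow> f x = x" using f by (auto simp: permutes_def)
  ultimately show "f \<in> Sn n" by (simp add: Sn_def Tn_def)
qed

lemma Sn_subset_Tn: "Sn n \<subseteq> Tn n"
  by (auto simp: Sn_def)

lemma Tn_maps: "f \<in> Tn n \<Longrightarrow> x \<in> {1..n} \<Longrightarrow> f x \<in> {1..n}"
  unfolding Tn_def by blast

lemma Tn_outside: "f \<in> Tn n \<Longrightarrow> x \<notin> {1..n} \<Longrightarrow> f x = x"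
  by (auto simp: Tn_def)

lemma Tn_eqI: "f \<in> Tn n \<Longrightarrow> g \<in> Tn n \<Longrightarrow> (\<And>x. x \<in> {1..n} \<Longrightarrow> f x = g x) \<Longrightarrow> f = g"
  by (rule ext) (metis Tn_outside)

lemma Tn_comp: "f \<in> Tn n \<Longrightarrow> g \<in> Tn n \<Longrightarrow> f \<circ> g \<in> Tn n"
  unfolding Tn_def by (auto simp: image_subset_iff)

lemma id_Sn: "id \<in> Sn n"
  by (simp add: Sn_iff permutes_id)

lemma Sn_comp: "f \<in> Sn n \<Longrightarrow> g \<in> Sn n \<Longrightarrow> f \<circ> g \<in> Sn n"
  by (simp add: Sn_iff permutes_compose)

lemma Sn_inv: "f \<in> Sn n \<Longrightarrow> inv f \<in> Sn n"
  by (simp add: Sn_iff permutes_inv)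

lemma singular_iff: "f \<in> Tn n - Sn n \<longleftrightarrow> f \<in> Tn n \<and> \<not> inj_on f {1..n}"
proof -
  have "f \<in> Sn n \<longleftrightarrow> inj_on f {1..n}" if "f \<in> Tn n"
  proof
    assume "inj_on f {1..n}"
    moreover have "f ` {1..n} \<subseteq> {1..n}" using that by (simp add: Tn_def)
    ultimately have "bij_betw f {1..n} {1..n}"
      unfolding bij_betw_def by (metis endo_inj_surj finite_atLeastAtMost)
    then show "f \<in> Sn n" using that by (simp add: Sn_def)
  qed (simp add: Sn_def bij_betw_def)
  then show ?thesis by blast
qed

lemma singular_comp:
  assumes "f \<in> Tn n - Sn n" "g \<in> Tn n"
  shows "f \<circ> g \<in> Tn n - Sn n" "g \<circ> f \<in> Tn n - Sn n"
proof -
  have f: "f \<in> Tn n" "\<not> inj_on f {1..n}" using assms(1) unfolding singular_iff by auto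
  have "\<not> inj_on (g \<circ> f) {1..n}" using f(2) inj_on_imageI2 by blast
  then show "g \<circ> f \<in> Tn n - Sn n" unfolding singular_iff using f(1) assms(2) Tn_comp by blast
  have "\<not> inj_on (f \<circ> g) {1..n}"
  proof
    assume i: "inj_on (f \<circ> g) {1..n}"
    then have "inj_on g {1..n}" by (rule inj_on_imageI2)
    then have "g ` {1..n} = {1..n}" using assms(2) by (intro endo_inj_surj) (auto simp: Tn_def)
    then have "inj_on f {1..n}" using i by (metis inj_on_imageI)
    with f(2) show False ..
  qed
  then show "f \<circ> g \<in> Tn n - Sn n" unfolding singular_iff using f(1) assms(2) Tn_comp by blast
qed

lemma singular_comp2:
  assumes "a \<in> Tn n - Sn n" "g \<in> Tn n" "h \<in> Tn n"
  shows "g \<circ> a \<circ> h \<in> Tn n - Sn n"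
  by (rule singular_comp(1)[OF singular_comp(2)[OF assms(1,2)] assms(3)])

lemma gen_subset_gen:
  assumes "X \<subseteq> gen Y"
  shows "gen X \<subseteq> gen Y"
proof
  fix f assume "f \<in> gen X"
  then show "f \<in> gen Y"
  proof induction
    case (base f)
    then show ?case using assms by blast
  next
    case (comp f g)
    show ?case by (rule gen.comp[OF comp.IH])
  qed
qed

lemma gen_mono: "X \<subseteq> Y \<Longrightarrow> gen X \<subseteq> gen Y"
  by (rule gen_subset_gen) (auto intro: gen.base)

lemma gen_subset_Tn:
  assumes "X \<subseteq> Tn n"
  shows "gen X \<subseteq> Tn n"
proof
  fix f assume "f \<in> gen X"
  then show "f \<in> Tn n"
  proof induction
    case (base f)
    then show ?case using assms by blast
  next
    case (comp f g)
    show ?case by (rule Tn_comp[OF comp.IH])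
  qed
qed

lemma gen_insert_translate:
  assumes "g \<in> Sn n"
  shows "gen (insert (b \<circ> g) (Sn n)) \<subseteq> gen (insert b (Sn n))"
proof (rule gen_subset_gen)
  have "b \<circ> g \<in> gen (insert b (Sn n))" by (intro gen.comp gen.base) (use assms in simp_all)
  then show "insert (b \<circ> g) (Sn n) \<subseteq> gen (insert b (Sn n))" by (auto intro: gen.base)
qed

lemma extend_to_Sn:
  assumes "X \<subseteq> {1..n}" "\<phi> ` X \<subseteq> {1..n}" "inj_on \<phi> X"
  obtains g where "g \<in> Sn n" "\<And>x. x \<in> X \<Longrightarrow> g x = \<phi> x"
  using extend_to_permutation[OF finite_atLeastAtMost assms] by (auto simp: Sn_iff)

text \<open>Equal kernels give a bijection between the two images, which extends to a
  permutation.\<close>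

lemma same_kernel_imp_translate:
  assumes f: "f \<in> Tn n" and c: "c \<in> Tn n"
    and ker: "\<And>x y. x \<in> {1..n} \<Longrightarrow> y \<in> {1..n} \<Longrightarrow> c x = c y \<longleftrightarrow> f x = f y"
  obtains g where "g \<in> Sn n" "f = g \<circ> c"
proof -
  let ?\<Omega> = "{1..n}"
  define \<phi> where "\<phi> v = f (inv_into ?\<Omega> c v)" for v
  have \<phi>: "\<phi> (c x) = f x" if "x \<in> ?\<Omega>" for x
  proof -
    have "inv_into ?\<Omega> c (c x) \<in> ?\<Omega>" "c (inv_into ?\<Omega> c (c x)) = c x"
      using imageI[OF that, of c] by (rule inv_into_into, rule f_inv_into_f)
    then show ?thesis using ker that by (simp add: \<phi>_def)
  qed
  have "inj_on \<phi> (c ` ?\<Omega>)"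
    by (rule inj_onI) (use \<phi> ker in auto)
  moreover have "\<phi> ` (c ` ?\<Omega>) \<subseteq> ?\<Omega>" using \<phi> Tn_maps[OF f] by auto
  moreover have "c ` ?\<Omega> \<subseteq> ?\<Omega>" using c by (simp add: Tn_def)
  ultimately obtain g where g: "g \<in> Sn n" "\<And>v. v \<in> c ` ?\<Omega> \<Longrightarrow> g v = \<phi> v"
    using extend_to_Sn[of "c ` ?\<Omega>" n \<phi>] by blast
  have "f = g \<circ> c"
  proof (rule Tn_eqI[OF f])
    show "g \<circ> c \<in> Tn n" using g(1) c Sn_subset_Tn Tn_comp by blast
    show "f x = (g \<circ> c) x" if "x \<in> ?\<Omega>" for x using that g(2) \<phi> by simp
  qed
  with g(1) show ?thesis by (rule that)
qed

text \<open>\<open>S\<close> contains one preimage of every value except \<open>c w1\<close>. Thus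
  \<open>c\<close> is injective on \<open>insert w1 S\<close> and glues \<open>w2\<close> to
  \<open>w1\<close>, which allows it to merge exactly one pair of chosen points.\<close>

lemma singular_section:
  assumes "c \<in> Tn n - Sn n"
  obtains w1 w2 S where "w1 \<in> {1..n}" "w2 \<in> {1..n}" "w1 \<noteq> w2" "c w1 = c w2"
    "S \<subseteq> {1..n}" "inj_on c S" "c ` S = c ` {1..n} - {c w1}" "card S = card (c ` {1..n}) - 1"
proof -
  let ?\<Omega> = "{1..n}"
  obtain w1 w2 where w: "w1 \<in> ?\<Omega>" "w2 \<in> ?\<Omega>" "w1 \<noteq> w2" "c w1 = c w2"
    using assms unfolding singular_iff inj_on_def by blast
  let ?V = "c ` ?\<Omega> - {c w1}"
  let ?S = "inv_into ?\<Omega> c ` ?V"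
  have cS: "c (inv_into ?\<Omega> c v) = v" if "v \<in> ?V" for v using that by (auto intro: f_inv_into_f)
  have "c ` ?S = (\<lambda>v. v) ` ?V" unfolding image_image by (rule image_cong[OF refl cS])
  then have "c ` ?S = ?V" by simp
  moreover have "inj_on c ?S"
  proof (rule inj_onI)
    fix s t assume "s \<in> ?S" "t \<in> ?S" and e: "c s = c t"
    then obtain v v' where "v \<in> ?V" "s = inv_into ?\<Omega> c v" "v' \<in> ?V" "t = inv_into ?\<Omega> c v'" by blast
    then show "s = t" using cS[of v] cS[of v'] e by simp
  qed
  moreover have "?S \<subseteq> ?\<Omega>" by (auto intro: inv_into_into)
  moreover have "card ?S = card (c ` ?\<Omega>) - 1"
    using card_image[OF \<open>inj_on c ?S\<close>] \<open>c ` ?S = ?V\<close> w(1) by simp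
  ultimately show ?thesis using w by (intro that[of w1 w2 ?S])
qed

text \<open>Induction on the difference of the ranks. If the kernels agree, a permutation suffices;
  otherwise \<open>f\<close> arises from a map with one more value by letting \<open>c\<close> merge
  two of its values.\<close>

lemma mem_gen_if_coarser:
  assumes c: "c \<in> Tn n - Sn n" and f: "f \<in> Tn n"
    and coarser: "\<And>x y. x \<in> {1..n} \<Longrightarrow> y \<in> {1..n} \<Longrightarrow> c x = c y \<Longrightarrow> f x = f y"
  shows "f \<in> gen (insert c (Sn n))"
  using f coarser
proof (induction "card (c ` {1..n}) - card (f ` {1..n})" arbitrary: f rule: less_induct)
  case less
  let ?\<Omega> = "{1..n}"
  let ?M = "gen (insert c (Sn n))"
  have cT: "c \<in> Tn n" using c by simp
  have gM: "g \<in> ?M" if "g \<in> insert c (Sn n)" for g using that by (rule gen.base)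
  show ?case
  proof (cases "\<forall>x\<in>?\<Omega>. \<forall>y\<in>?\<Omega>. f x = f y \<longrightarrow> c x = c y")
    case True
    then have "c x = c y \<longleftrightarrow> f x = f y" if "x \<in> ?\<Omega>" "y \<in> ?\<Omega>" for x y using less.prems(2) that by blast
    then obtain g where g: "g \<in> Sn n" "f = g \<circ> c" using same_kernel_imp_translate[OF less.prems(1) cT] by blast
    have "g \<circ> c \<in> ?M" by (intro gen.comp gM) (use g(1) in simp_all)
    then show ?thesis by (simp only: g(2))
  next
    case False
    then obtain x y where xy: "x \<in> ?\<Omega>" "y \<in> ?\<Omega>" "f x = f y" "c x \<noteq> c y" by blast
    define \<psi> where "\<psi> v = f (inv_into ?\<Omega> c v)" for v
    have \<psi>: "\<psi> (c z) = f z" if "z \<in> ?\<Omega>" for z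
    proof -
      have "inv_into ?\<Omega> c (c z) \<in> ?\<Omega>" "c (inv_into ?\<Omega> c (c z)) = c z"
        using imageI[OF that, of c] by (rule inv_into_into, rule f_inv_into_f)
      then show ?thesis using less.prems(2)[of "inv_into ?\<Omega> c (c z)" z] that by (simp only: \<psi>_def)
    qed
    have im: "\<psi> ` (c ` ?\<Omega>) = f ` ?\<Omega>" unfolding image_image by (rule image_cong[OF refl \<psi>])
    have lt: "card (f ` ?\<Omega>) < card (c ` ?\<Omega>)"
    proof (rule ccontr)
      assume "\<not> ?thesis"
      then have "card (\<psi> ` (c ` ?\<Omega>)) = card (c ` ?\<Omega>)"
        using card_image_le[of "c ` ?\<Omega>" \<psi>] im by simp
      then have "inj_on \<psi> (c ` ?\<Omega>)" by (intro eq_card_imp_inj_on) auto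
      moreover have "\<psi> (c x) = \<psi> (c y)" using \<psi> xy by simp
      ultimately show False using xy by (auto dest: inj_onD)
    qed
    have f\<Omega>: "f ` ?\<Omega> \<subseteq> ?\<Omega>" and c\<Omega>: "c ` ?\<Omega> \<subseteq> ?\<Omega>" using less.prems(1) cT by (simp_all add: Tn_def)
    have "card (c ` ?\<Omega>) \<le> card ?\<Omega>" by (rule card_image_le) simp
    then have "f ` ?\<Omega> \<noteq> ?\<Omega>" using lt by auto
    then obtain new where new: "new \<in> ?\<Omega>" "new \<notin> f ` ?\<Omega>" using f\<Omega> by blast
    define f' where "f' z = (if z \<in> ?\<Omega> \<and> c z = c x then new else f z)" for z
    have f'T: "f' \<in> Tn n" using new(1) less.prems(1) by (auto simp: f'_def Tn_def)
    have f'c: "f' z = f' z'" if "z \<in> ?\<Omega>" "z' \<in> ?\<Omega>" "c z = c z'" for z z'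
      using that less.prems(2)[OF that] by (simp add: f'_def)
    have f_f': "f z = (if f' z = new then f x else f' z)" if "z \<in> ?\<Omega>" for z
      using that new(2) less.prems(2)[of z x] xy(1) by (auto simp: f'_def)
    have R: "f' ` ?\<Omega> = insert new (f ` ?\<Omega>)"
    proof
      show "f' ` ?\<Omega> \<subseteq> insert new (f ` ?\<Omega>)" by (auto simp: f'_def)
      have "f z \<in> f' ` ?\<Omega>" if z: "z \<in> ?\<Omega>" for z
      proof (cases "c z = c x")
        case True
        then have "f z = f y" using less.prems(2)[OF z xy(1) True] xy(3) by simp
        also have "\<dots> = f' y" using xy by (simp add: f'_def)
        finally show ?thesis using xy(2) by blast
      next
        case False
        then have "f z = f' z" by (simp add: f'_def)
        then show ?thesis using z by blast
      qed
      moreover have "new = f' x" using xy by (simp add: f'_def)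
      ultimately show "insert new (f ` ?\<Omega>) \<subseteq> f' ` ?\<Omega>" using xy(1) by blast
    qed
    then have cf': "card (f' ` ?\<Omega>) = Suc (card (f ` ?\<Omega>))" using new(2) by simp
    have f'M: "f' \<in> ?M"
      by (rule less.hyps[OF _ f'T f'c]) (use lt cf' in simp_all)
    obtain w1 w2 S where w: "w1 \<in> ?\<Omega>" "w2 \<in> ?\<Omega>" "w1 \<noteq> w2" "c w1 = c w2"
      and S: "S \<subseteq> ?\<Omega>" "inj_on c S" "c ` S = c ` ?\<Omega> - {c w1}" "card S = card (c ` ?\<Omega>) - 1"
      by (rule singular_section[OF c])
    let ?R' = "f ` ?\<Omega> - {f x}"
    have "card ?R' \<le> card S" using S(4) lt xy(1) by simp
    moreover have "finite S" using S(1) finite_subset by blast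
    ultimately obtain \<iota> where \<iota>: "\<iota> ` ?R' \<subseteq> S" "inj_on \<iota> ?R'"
      using card_le_inj[of ?R' S] by blast
    \<comment> \<open>The two values to be merged are placed on \<open>w1\<close> and
      \<open>w2\<close>, the others on \<open>S\<close>; then \<open>c \<circ> g \<circ> f'\<close>
      has the kernel of \<open>f\<close>.\<close>
    define \<phi> where "\<phi> t = (if t = f x then w1 else if t = new then w2 else \<iota> t)" for t
    have ne: "f x \<noteq> new" using new(2) xy(1) by blast
    have \<iota>c: "c (\<iota> t) \<noteq> c w1" if "t \<in> ?R'" for t
      using that \<iota>(1) S(3) by blast
    have "inj_on \<phi> (f' ` ?\<Omega>)"
    proof (rule inj_onI)
      fix s t assume st: "s \<in> f' ` ?\<Omega>" "t \<in> f' ` ?\<Omega>" "\<phi> s = \<phi> t"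
      have cases: "s = f x \<or> s = new \<or> s \<in> ?R'" "t = f x \<or> t = new \<or> t \<in> ?R'"
        using st(1,2) R by auto
      have new_R: "new \<notin> ?R'" using new(2) by blast
      have val: "\<phi> v = \<iota> v" if "v \<in> ?R'" for v using that new_R by (auto simp: \<phi>_def)
      have vals: "\<phi> (f x) = w1" "\<phi> new = w2" using ne by (auto simp: \<phi>_def)
      show "s = t"
        using cases st(3) val vals \<iota>c w(3,4) inj_onD[OF \<iota>(2)] by metis
    qed
    moreover have "\<phi> ` (f' ` ?\<Omega>) \<subseteq> ?\<Omega>"
      using w \<iota>(1) S(1) R by (auto simp: \<phi>_def)
    moreover have "f' ` ?\<Omega> \<subseteq> ?\<Omega>" using f'T by (simp add: Tn_def)
    ultimately obtain g where g: "g \<in> Sn n" "\<And>t. t \<in> f' ` ?\<Omega> \<Longrightarrow> g t = \<phi> t"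
      using extend_to_Sn[of "f' ` ?\<Omega>" n \<phi>] by blast
    let ?k = "c \<circ> g \<circ> f'"
    have kM: "?k \<in> ?M" using gM g(1) f'M by (intro gen.comp) auto
    have kT: "?k \<in> Tn n" using cT g(1) f'T Sn_subset_Tn by (intro Tn_comp) auto
    have k: "?k z = (if f z = f x then c w1 else c (\<iota> (f z)))" if z: "z \<in> ?\<Omega>" for z
    proof -
      have "?k z = c (\<phi> (f' z))" using g(2) z by simp
      then show ?thesis using f_f'[OF z] ne w(4) by (auto simp: \<phi>_def split: if_splits)
    qed
    have "?k z = ?k z' \<longleftrightarrow> f z = f z'" if z: "z \<in> ?\<Omega>" "z' \<in> ?\<Omega>" for z z'
    proof -
      have i: "c (\<iota> s) = c (\<iota> t) \<longleftrightarrow> s = t" if "s \<in> ?R'" "t \<in> ?R'" for s t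
        by (metis that \<iota>(1) inj_on_eq_iff[OF S(2)] inj_on_eq_iff[OF \<iota>(2)] image_subset_iff)
      have "f z \<in> ?R' \<or> f z = f x" "f z' \<in> ?R' \<or> f z' = f x" using z by auto
      then show ?thesis
        unfolding k[OF z(1)] k[OF z(2)] using i[of "f z" "f z'"] \<iota>c[of "f z"] \<iota>c[of "f z'"] by auto
    qed
    then obtain h where h: "h \<in> Sn n" "f = h \<circ> ?k"
      using same_kernel_imp_translate[OF less.prems(1) kT] by blast
    have "h \<circ> ?k \<in> ?M" by (rule gen.comp[OF gM kM]) (use h(1) in simp)
    then show ?thesis by (simp only: h(2)[symmetric])
  qed
qed

section \<open>Factorisations of products and two-sided translates\<close>

lemma perm_group_if_sym_subgroup:
  assumes "sym_subgroup n G"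
  shows "perm_group {1..n} G"
proof
  show "g permutes {1..n}" if "g \<in> G" for g using assms that by (auto simp: sym_subgroup_def Sn_iff)
  show "inv g \<in> G" if g: "g \<in> G" for g
  proof -
    obtain h where "h \<in> G" "g \<circ> h = id" "h \<circ> g = id" using assms g by (auto simp: sym_subgroup_def)
    then show ?thesis using inv_unique_comp by metis
  qed
qed (use assms in \<open>auto simp: sym_subgroup_def\<close>)

lemma perm_group_Sn: "perm_group {1..n} (Sn n)"
  by unfold_locales (auto simp: Sn_iff permutes_id permutes_compose permutes_inv)

text \<open>The first alternative for a non-member of \<open>G\<close> isolates the factor from
  \<open>A\<close> that acts first, which determines the kernel up to coarsening; the second
  isolates the one that acts last, whose image contains that of \<open>f\<close> up to
  translation.\<close>

lemma gen_decompose: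
  assumes A: "A \<subseteq> Tn n" and G: "sym_subgroup n G" and f: "f \<in> gen (A \<union> G)"
  shows "f \<in> G \<or> ((\<exists>c\<in>A. \<exists>h\<in>G. \<exists>w\<in>Tn n. f = w \<circ> c \<circ> h) \<and> (\<exists>c\<in>A. \<exists>h\<in>G. \<exists>w\<in>Tn n. f = h \<circ> c \<circ> w))"
proof -
  have GT: "G \<subseteq> Tn n" using G Sn_subset_Tn by (auto simp: sym_subgroup_def)
  have GG: "g \<circ> h \<in> G" if "g \<in> G" "h \<in> G" for g h using G that by (simp add: sym_subgroup_def)
  have idG: "id \<in> G" using G by (simp add: sym_subgroup_def)
  have T: "gen (A \<union> G) \<subseteq> Tn n" using A GT by (intro gen_subset_Tn) simp
  let ?R = "\<lambda>f. \<exists>c\<in>A. \<exists>h\<in>G. \<exists>w\<in>Tn n. f = w \<circ> c \<circ> h"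
  let ?L = "\<lambda>f. \<exists>c\<in>A. \<exists>h\<in>G. \<exists>w\<in>Tn n. f = h \<circ> c \<circ> w"
  have RI: "?R (w \<circ> c \<circ> h)" if "c \<in> A" "h \<in> G" "w \<in> Tn n" for w c h using that by blast
  have LI: "?L (h \<circ> c \<circ> w)" if "c \<in> A" "h \<in> G" "w \<in> Tn n" for w c h using that by blast
  have idT: "id \<in> Tn n" using idG GT by blast
  from f show ?thesis
  proof induction
    case (base f)
    then show ?case
    proof
      assume "f \<in> A"
      then show ?thesis
        using RI[OF _ idG idT, of f] LI[OF _ idG idT, of f] by (simp only: comp_id id_comp simp_thms)
    qed blast
  next
    case (comp f g)
    have fT: "f \<in> Tn n" and gT: "g \<in> Tn n" using comp.hyps T by auto
    have R_right: "?R (f \<circ> g)" if "?R g"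
    proof -
      obtain c h w where 1: "c \<in> A" "h \<in> G" "w \<in> Tn n" "g = w \<circ> c \<circ> h" using \<open>?R g\<close> by blast
      then show ?thesis using RI[OF 1(1,2) Tn_comp[OF fT 1(3)]] by (simp only: comp_assoc)
    qed
    have R_left: "?R (f \<circ> g)" if "?R f" "g \<in> G"
    proof -
      obtain c h w where 1: "c \<in> A" "h \<in> G" "w \<in> Tn n" "f = w \<circ> c \<circ> h" using \<open>?R f\<close> by blast
      then show ?thesis using RI[OF 1(1) GG[OF 1(2) \<open>g \<in> G\<close>] 1(3)] by (simp only: comp_assoc)
    qed
    have L_left: "?L (f \<circ> g)" if "?L f"
    proof -
      obtain c h w where 1: "c \<in> A" "h \<in> G" "w \<in> Tn n" "f = h \<circ> c \<circ> w" using \<open>?L f\<close> by blast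
      then show ?thesis using LI[OF 1(1,2) Tn_comp[OF 1(3) gT]] by (simp only: comp_assoc)
    qed
    have L_right: "?L (f \<circ> g)" if "?L g" "f \<in> G"
    proof -
      obtain c h w where 1: "c \<in> A" "h \<in> G" "w \<in> Tn n" "g = h \<circ> c \<circ> w" using \<open>?L g\<close> by blast
      then show ?thesis using LI[OF 1(1) GG[OF \<open>f \<in> G\<close> 1(2)] 1(3)] by (simp only: comp_assoc)
    qed
    have fRL: "?R f \<and> ?L f" if "f \<notin> G" using comp.IH(1) that by (simp only: simp_thms)
    have gRL: "?R g \<and> ?L g" if "g \<notin> G" using comp.IH(2) that by (simp only: simp_thms)
    show ?case
    proof (cases "g \<in> G")
      case True
      show ?thesis
      proof (cases "f \<in> G")
        case False
        note RL = fRL[OF this]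
        have "?R (f \<circ> g) \<and> ?L (f \<circ> g)"
          by (rule conjI[OF R_left[OF conjunct1[OF RL] True] L_left[OF conjunct2[OF RL]]])
        then show ?thesis by (rule disjI2)
      qed (use GG True in blast)
    next
      case False
      have "?L (f \<circ> g)"
      proof (cases "f \<in> G")
        case True
        then show ?thesis by (rule L_right[OF conjunct2[OF gRL[OF False]]])
      next
        case f: False
        show ?thesis by (rule L_left[OF conjunct2[OF fRL[OF f]]])
      qed
      moreover have "?R (f \<circ> g)" by (rule R_right[OF conjunct1[OF gRL[OF False]]])
      ultimately show ?thesis by (intro disjI2 conjI)
    qed
  qed
qed

text \<open>A product that is not a permutation contains factors from \<open>A\<close>, and every
  permutation in it can be absorbed into a translate of a neighbouring factor. Products with a
  singular factor stay singular, so removing \<open>G\<close> or \<open>Sn n\<close> removes exactly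
  the permutations.\<close>

lemma gen_eq_iff_translates:
  assumes A: "A \<subseteq> Tn n - Sn n" and G: "sym_subgroup n G"
  shows "gen (A \<union> G) - G = gen (A \<union> Sn n) - Sn n \<longleftrightarrow>
    (\<forall>a\<in>A. \<forall>g\<in>Sn n. \<forall>h\<in>Sn n. g \<circ> a \<circ> h \<in> gen (A \<union> G))"
proof
  assume eq: "gen (A \<union> G) - G = gen (A \<union> Sn n) - Sn n"
  show "\<forall>a\<in>A. \<forall>g\<in>Sn n. \<forall>h\<in>Sn n. g \<circ> a \<circ> h \<in> gen (A \<union> G)"
  proof (intro ballI)
    fix a g h assume *: "a \<in> A" "g \<in> Sn n" "h \<in> Sn n"
    have "g \<circ> a \<circ> h \<in> gen (A \<union> Sn n)" using * by (intro gen.comp gen.base) auto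
    moreover have "g \<circ> a \<circ> h \<in> Tn n - Sn n"
      by (rule singular_comp2) (use * A Sn_subset_Tn in blast)+
    ultimately show "g \<circ> a \<circ> h \<in> gen (A \<union> G)" using eq by blast
  qed
next
  assume tr: "\<forall>a\<in>A. \<forall>g\<in>Sn n. \<forall>h\<in>Sn n. g \<circ> a \<circ> h \<in> gen (A \<union> G)"
  have GS: "G \<subseteq> Sn n" using G by (simp add: sym_subgroup_def)
  have AT: "A \<subseteq> Tn n" using A by blast
  show "gen (A \<union> G) - G = gen (A \<union> Sn n) - Sn n"
  proof
    have "f \<notin> Sn n" if f: "f \<in> gen (A \<union> G)" "f \<notin> G" for f
    proof -
      have "\<exists>c\<in>A. \<exists>h\<in>G. \<exists>w\<in>Tn n. f = w \<circ> c \<circ> h"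
        using gen_decompose[OF AT G f(1)] f(2) by (simp only: simp_thms)
      then obtain c h w where ch: "c \<in> A" "h \<in> G" "w \<in> Tn n" "f = w \<circ> c \<circ> h" by (elim bexE)
      have "f \<in> Tn n - Sn n"
        unfolding ch(4) by (rule singular_comp2) (use ch(1-3) A GS Sn_subset_Tn in blast)+
      then show ?thesis by simp
    qed
    moreover have "gen (A \<union> G) \<subseteq> gen (A \<union> Sn n)" using GS by (intro gen_mono) blast
    ultimately show "gen (A \<union> G) - G \<subseteq> gen (A \<union> Sn n) - Sn n" by blast
    show "gen (A \<union> Sn n) - Sn n \<subseteq> gen (A \<union> G) - G"
    proof
      fix f assume f: "f \<in> gen (A \<union> Sn n) - Sn n"
      \<comment> \<open>The induction carries all two-sided translates of \<open>f\<close>, so that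
        a permutation next to \<open>f\<close> can be absorbed.\<close>
      have "f \<in> Sn n \<or> (\<forall>g\<in>Sn n. \<forall>h\<in>Sn n. g \<circ> f \<circ> h \<in> gen (A \<union> G))" if "f \<in> gen (A \<union> Sn n)" for f
        using that
      proof induction
        case (base f)
        then show ?case using tr by blast
      next
        case (comp f1 f2)
        show ?case
        proof (cases "f1 \<in> Sn n \<and> f2 \<in> Sn n")
          case True
          then show ?thesis using Sn_comp by blast
        next
          case False
          have "g \<circ> (f1 \<circ> f2) \<circ> h \<in> gen (A \<union> G)" if gh: "g \<in> Sn n" "h \<in> Sn n" for g h
          proof -
            consider "f1 \<in> Sn n" "f2 \<notin> Sn n" | "f1 \<notin> Sn n" "f2 \<in> Sn n" | "f1 \<notin> Sn n" "f2 \<notin> Sn n"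
              using False by blast
            then show ?thesis
            proof cases
              case 1
              have tr2: "\<forall>g\<in>Sn n. \<forall>h\<in>Sn n. g \<circ> f2 \<circ> h \<in> gen (A \<union> G)"
                using comp.IH(2) 1(2) by (simp only: simp_thms)
              have "(g \<circ> f1) \<circ> f2 \<circ> h \<in> gen (A \<union> G)"
                by (rule bspec[OF bspec[OF tr2 Sn_comp[OF gh(1) 1(1)]] gh(2)])
              then show ?thesis by (simp only: comp_assoc)
            next
              case 2
              have tr1: "\<forall>g\<in>Sn n. \<forall>h\<in>Sn n. g \<circ> f1 \<circ> h \<in> gen (A \<union> G)"
                using comp.IH(1) 2(1) by (simp only: simp_thms)
              have "g \<circ> f1 \<circ> (f2 \<circ> h) \<in> gen (A \<union> G)"
                by (rule bspec[OF bspec[OF tr1 gh(1)] Sn_comp[OF 2(2) gh(2)]])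
              then show ?thesis by (simp only: comp_assoc)
            next
              case 3
              have tr1: "\<forall>g\<in>Sn n. \<forall>h\<in>Sn n. g \<circ> f1 \<circ> h \<in> gen (A \<union> G)"
                using comp.IH(1) 3(1) by (simp only: simp_thms)
              have tr2: "\<forall>g\<in>Sn n. \<forall>h\<in>Sn n. g \<circ> f2 \<circ> h \<in> gen (A \<union> G)"
                using comp.IH(2) 3(2) by (simp only: simp_thms)
              have "(g \<circ> f1 \<circ> id) \<circ> (id \<circ> f2 \<circ> h) \<in> gen (A \<union> G)"
                by (rule gen.comp[OF bspec[OF bspec[OF tr1 gh(1)] id_Sn] bspec[OF bspec[OF tr2 id_Sn] gh(2)]])
              then show ?thesis by (simp only: comp_assoc id_comp)
            qed
          qed
          then show ?thesis by blast
        qed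
      qed
      note all = this
      have f1: "f \<in> gen (A \<union> Sn n)" and nf: "f \<notin> Sn n" using f by simp_all
      from all[OF f1] have "\<forall>g\<in>Sn n. \<forall>h\<in>Sn n. g \<circ> f \<circ> h \<in> gen (A \<union> G)" using nf by (simp only: simp_thms)
      from bspec[OF bspec[OF this id_Sn] id_Sn] have "f \<in> gen (A \<union> G)" by (simp only: comp_id id_comp)
      then show "f \<in> gen (A \<union> G) - G" using f GS by auto
    qed
  qed
qed

lemma Sn_pair_iff_translates:
  assumes "a \<in> Tn n - Sn n" "sym_subgroup n G"
  shows "Sn_pair n a G \<longleftrightarrow> (\<forall>g\<in>Sn n. \<forall>h\<in>Sn n. g \<circ> a \<circ> h \<in> gen (insert a G))"
  using gen_eq_iff_translates[of "{a}" n G] assms by (simp add: Sn_pair_def)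

section \<open>Complements, uniform kernels and token sliding\<close>

context perm_group
begin

lemma finite_order:
  assumes g: "g \<in> G"
  obtains N where "N > 0" "g ^^ N = id"
proof -
  have "\<not> inj (\<lambda>i::nat. g ^^ i)"
  proof
    assume "inj (\<lambda>i::nat. g ^^ i)"
    moreover have "finite (range (\<lambda>i::nat. g ^^ i))"
      by (rule finite_subset[OF _ finite_group]) (use funpow_mem[OF g] in blast)
    ultimately show False using finite_imageD infinite_UNIV_nat by blast
  qed
  then obtain i j where ij: "g ^^ i = g ^^ j" "i \<noteq> j" by (auto simp: inj_def)
  have *: "\<exists>N>0. g ^^ N = id" if e: "g ^^ i = g ^^ j" "i < j" for i j
  proof -
    have "(g ^^ (j - i)) x = x" for x
    proof -
      have "(g ^^ i) ((g ^^ (j - i)) x) = (g ^^ j) x"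
        using e(2) by (metis funpow_add le_add_diff_inverse less_imp_le_nat o_apply)
      then have "(g ^^ i) ((g ^^ (j - i)) x) = (g ^^ i) x" using e(1) by simp
      then show ?thesis using inj_fn[OF bij_is_inj[OF bij_mem[OF g]], of i] by (simp add: inj_eq)
    qed
    then show ?thesis using e(2) by (intro exI[of _ "j - i"]) (auto simp: fun_eq_iff)
  qed
  from ij *[of i j] *[of j i] that show ?thesis by (metis nat_neq_iff)
qed

lemma homog_complement:
  assumes "homog k" "k \<le> card \<Omega>"
  shows "homog (card \<Omega> - k)"
  unfolding homog_def
proof (intro allI impI, elim conjE)
  fix X Y assume XY: "X \<subseteq> \<Omega>" "Y \<subseteq> \<Omega>" "card X = card \<Omega> - k" "card Y = card \<Omega> - k"
  have c: "card (\<Omega> - Z) = k" if "Z \<subseteq> \<Omega>" "card Z = card \<Omega> - k" for Z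
    using that assms(2) finite_subset[OF that(1) finite_points] by (simp add: card_Diff_subset)
  obtain g where g: "g \<in> G" "g ` (\<Omega> - X) = \<Omega> - Y"
    using homogD[OF assms(1), of "\<Omega> - X" "\<Omega> - Y"] c XY by auto
  have "g ` X = g ` (\<Omega> - (\<Omega> - X))" using XY(1) by (simp add: double_diff)
  also have "\<dots> = \<Omega> - (\<Omega> - Y)"
    using image_set_diff[OF bij_is_inj[OF bij_mem[OF g(1)]]] permutes_image[OF permutes[OF g(1)]] g(2) by simp
  also have "\<dots> = Y" using XY(2) by (simp add: double_diff)
  finally show "\<exists>g\<in>G. g ` X = Y" using g(1) by blast
qed

lemma homog_0: "homog 0"
proof -
  have "X = {}" if "X \<subseteq> \<Omega>" "card X = 0" for X
    using that finite_points finite_subset by (metis card_0_eq)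
  then show ?thesis using id_mem unfolding homog_def by (metis image_empty)
qed

text \<open>Equally many parts of uniform size have equal size, so a bijection between the parts can
  be refined by bijections inside them.\<close>

lemma uniform_kernels_match:
  assumes a: "\<And>x. x \<in> \<Omega> \<Longrightarrow> card (fibre a x) = k" and b: "\<And>x. x \<in> \<Omega> \<Longrightarrow> card (fibre b x) = l"
    and rank: "card (a ` \<Omega>) = card (b ` \<Omega>)"
  obtains g where "g permutes \<Omega>" "\<And>x y. x \<in> \<Omega> \<Longrightarrow> y \<in> \<Omega> \<Longrightarrow> b (g x) = b (g y) \<Longrightarrow> a x = a y"
proof (cases "\<Omega> = {}")
  case True
  then show ?thesis using that[of id] by (simp add: permutes_id)
next
  case False
  define F where "F v = {x\<in>\<Omega>. a x = v}" for v
  define F' where "F' v = {x\<in>\<Omega>. b x = v}" for v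
  have cF: "card (F v) = k" if "v \<in> a ` \<Omega>" for v using that a by (auto simp: F_def fibre_def)
  have cF': "card (F' v) = l" if "v \<in> b ` \<Omega>" for v using that b by (auto simp: F'_def fibre_def)
  have "card \<Omega> = card (a ` \<Omega>) * k" "card \<Omega> = card (b ` \<Omega>) * l"
    using card_eq_mult_if_fibres_eq[OF finite_points, of a k] card_eq_mult_if_fibres_eq[OF finite_points, of b l]
      cF cF' by (simp_all only: F_def F'_def)
  moreover have "card \<Omega> \<noteq> 0" using False finite_points by simp
  ultimately have kl: "k = l" using rank by auto
  obtain \<theta> where \<theta>: "bij_betw \<theta> (a ` \<Omega>) (b ` \<Omega>)"
    using finite_same_card_bij[OF finite_imageI[OF finite_points] finite_imageI[OF finite_points] rank] by blast
  have \<theta>m: "\<theta> v \<in> b ` \<Omega>" if "v \<in> a ` \<Omega>" for v using \<theta> that by (rule bij_betwE[THEN bspec])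
  have "\<forall>v\<in>a ` \<Omega>. \<exists>\<beta>. bij_betw \<beta> (F v) (F' (\<theta> v))"
  proof
    fix v assume v: "v \<in> a ` \<Omega>"
    have "finite (F v)" "finite (F' (\<theta> v))" using finite_points by (simp_all add: F_def F'_def)
    then show "\<exists>\<beta>. bij_betw \<beta> (F v) (F' (\<theta> v))"
      using cF[OF v] cF'[OF \<theta>m[OF v]] kl by (intro finite_same_card_bij) simp_all
  qed
  from bchoice[OF this] obtain \<beta> where \<beta>: "\<forall>v\<in>a ` \<Omega>. bij_betw (\<beta> v) (F v) (F' (\<theta> v))" ..
  define \<phi> where "\<phi> x = \<beta> (a x) x" for x
  have \<phi>: "\<phi> x \<in> F' (\<theta> (a x))" if "x \<in> \<Omega>" for x
  proof -
    have "x \<in> F (a x)" using that by (simp add: F_def)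
    then show ?thesis using \<beta> that by (auto simp: \<phi>_def bij_betw_def)
  qed
  then have b\<phi>: "b (\<phi> x) = \<theta> (a x)" "\<phi> x \<in> \<Omega>" if "x \<in> \<Omega>" for x
    using that by (auto simp: F'_def)
  have sep: "a x = a y" if "x \<in> \<Omega>" "y \<in> \<Omega>" "b (\<phi> x) = b (\<phi> y)" for x y
  proof -
    have "\<theta> (a x) = \<theta> (a y)" using that b\<phi> by simp
    then show ?thesis using bij_betw_imp_inj_on[OF \<theta>] that by (auto dest: inj_onD)
  qed
  have "inj_on \<phi> \<Omega>"
  proof (rule inj_onI)
    fix x y assume xy: "x \<in> \<Omega>" "y \<in> \<Omega>" "\<phi> x = \<phi> y"
    have e: "a x = a y" using sep[OF xy(1,2)] xy(3) by simp
    have "inj_on (\<beta> (a x)) (F (a x))" using \<beta> xy(1) by (auto simp: bij_betw_def)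
    moreover have "x \<in> F (a x)" "y \<in> F (a x)" using xy e by (auto simp: F_def)
    moreover have "\<beta> (a x) x = \<beta> (a x) y" using xy(3) e by (simp add: \<phi>_def)
    ultimately show "x = y" by (auto dest: inj_onD)
  qed
  moreover have "\<phi> ` \<Omega> \<subseteq> \<Omega>" using b\<phi> by blast
  ultimately obtain g where g: "g permutes \<Omega>" "\<And>x. x \<in> \<Omega> \<Longrightarrow> g x = \<phi> x"
    using extend_to_permutation[OF finite_points subset_refl] by blast
  show ?thesis
  proof (rule that[OF g(1)])
    fix x y assume xy: "x \<in> \<Omega>" "y \<in> \<Omega>" "b (g x) = b (g y)"
    then have "b (\<phi> x) = b (\<phi> y)" using g(2) by simp
    with xy(1,2) show "a x = a y" by (rule sep)
  qed
qed

end

text \<open>Token sliding: a configuration of \<open>r < n\<close> tokens can move one token to a free point by elements of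
  \<open>\<langle>a, G\<rangle>\<close>. The slide is undone up to a permutation of the image of \<open>a\<close> by mapping both
  configurations to this image, and such permutations have finite order.\<close>

lemma slide:
  assumes a: "a \<in> Tn n - Sn n" and G: "sym_subgroup n G"
    and kh: "perm_group.kernel_homog {1..n} G a" and hg: "perm_group.homog {1..n} G (card (a ` {1..n}))"
    and X: "X \<subseteq> {1..n}" "card X = card (a ` {1..n})" and x: "x \<in> X" and x': "x' \<in> {1..n} - X"
  shows "\<exists>v\<in>gen (insert a G). v x = x' \<and> (\<forall>y\<in>X - {x}. v y = y)"
proof -
  let ?\<Omega> = "{1..n}"
  let ?I = "a ` ?\<Omega>"
  let ?W = "gen (insert a G)"
  interpret perm_group ?\<Omega> G using G by (rule perm_group_if_sym_subgroup)
  have aT: "a \<in> Tn n" using a by simp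
  have I\<Omega>: "?I \<subseteq> ?\<Omega>" using aT by (simp add: Tn_def)
  have finX: "finite X" using X(1) finite_points by (rule finite_subset)
  have W_base: "g \<in> ?W" if "g \<in> insert a G" for g using that by (rule gen.base)
  let ?X' = "insert x' (X - {x})"
  have X': "?X' \<subseteq> ?\<Omega>" "card ?X' = card ?I"
    using X x x' finX by (auto simp: card_Suc_Diff1 simp del: card_Diff_insert)
  obtain w1 w2 S where w: "w1 \<in> ?\<Omega>" "w2 \<in> ?\<Omega>" "w1 \<noteq> w2" "a w1 = a w2"
    and S: "S \<subseteq> ?\<Omega>" "inj_on a S" "a ` S = ?I - {a w1}" "card S = card ?I - 1"
    by (rule singular_section[OF a])
  have "card (X - {x}) = card S" using S(4) X(2) x finX by simp
  then obtain \<iota> where \<iota>: "bij_betw \<iota> (X - {x}) S"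
    using finite_same_card_bij[of "X - {x}" S] finX finite_subset[OF S(1) finite_points] by auto
  have \<iota>S: "\<iota> y \<in> S" if "y \<in> X - {x}" for y using \<iota> that by (rule bij_betwE[THEN bspec])
  have \<iota>a: "a (\<iota> y) \<noteq> a w1" if "y \<in> X - {x}" for y using \<iota>S[OF that] S(3) by blast
  have a\<iota>: "y = z" if "y \<in> X - {x}" "z \<in> X - {x}" "a (\<iota> y) = a (\<iota> z)" for y z
    using that \<iota>S inj_onD[OF S(2)] inj_onD[OF bij_betw_imp_inj_on[OF \<iota>]] by blast
  \<comment> \<open>For a permutation \<open>g\<close> extending \<open>\<phi>\<close>, the map
    \<open>a \<circ> g\<close> merges \<open>x\<close> with \<open>x'\<close> and is injective on
    the new configuration.\<close>
  define \<phi> where "\<phi> y = (if y = x then w1 else if y = x' then w2 else \<iota> y)" for y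
  have xx': "x \<noteq> x'" "x' \<notin> X" using x x' by auto
  have \<phi>v: "\<phi> x = w1" "\<phi> x' = w2" "\<And>y. y \<in> X - {x} \<Longrightarrow> \<phi> y = \<iota> y"
    using xx' by (auto simp: \<phi>_def)
  have "inj_on \<phi> (insert x' X)"
  proof (rule inj_onI)
    fix y z assume yz: "y \<in> insert x' X" "z \<in> insert x' X" "\<phi> y = \<phi> z"
    then have "y = x \<or> y = x' \<or> y \<in> X - {x}" "z = x \<or> z = x' \<or> z \<in> X - {x}" by auto
    then show "y = z" using yz(3) \<phi>v w(3,4) \<iota>a a\<iota> by metis
  qed
  moreover have "\<phi> ` insert x' X \<subseteq> ?\<Omega>"
  proof
    fix u assume "u \<in> \<phi> ` insert x' X"
    then obtain y where y: "y = x \<or> y = x' \<or> y \<in> X - {x}" "u = \<phi> y" by auto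
    have "\<phi> y \<in> ?\<Omega>" if "y \<in> X - {x}"
      unfolding \<phi>v(3)[OF that] by (rule subsetD[OF S(1) \<iota>S[OF that]])
    then show "u \<in> ?\<Omega>" using y w(1,2) \<phi>v(1,2) by metis
  qed
  moreover have "insert x' X \<subseteq> ?\<Omega>" using X x' by blast
  ultimately obtain g where g: "g \<in> Sn n" "\<And>y. y \<in> insert x' X \<Longrightarrow> g y = \<phi> y"
    using extend_to_Sn[of "insert x' X" n \<phi>] by blast
  have gp: "g permutes ?\<Omega>" using g(1) by (simp add: Sn_iff)
  \<comment> \<open>\<open>g\<close> need not lie in \<open>G\<close>, but kernel homogeneity
    supplies an element of \<open>G\<close> that induces the same kernel.\<close>
  obtain h where h: "h \<in> G" "\<And>y z. y \<in> ?\<Omega> \<Longrightarrow> z \<in> ?\<Omega> \<Longrightarrow> a (g y) = a (g z) \<longleftrightarrow> a (h y) = a (h z)"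
    by (rule kernel_homogE[OF kh gp]) blast
  obtain k where k: "k \<in> G" "k ` ?I = ?X'" using homogD[OF hg I\<Omega> X'(1) refl X'(2)] by blast
  define \<alpha> where "\<alpha> = a \<circ> h"
  have \<alpha>W: "\<alpha> \<in> ?W" unfolding \<alpha>_def by (intro gen.comp W_base) (use h(1) in simp_all)
  have kW: "k \<in> ?W" using k(1) by (intro W_base) simp
  have \<alpha>I: "\<alpha> y \<in> ?I" if "y \<in> ?\<Omega>" for y
    using apply_mem[OF h(1) that] by (simp add: \<alpha>_def)
  have \<alpha>x: "\<alpha> x = \<alpha> x'"
    using h(2)[of x x'] g(2)[of x] g(2)[of x'] \<phi>v w(4) X(1) x x' by (auto simp: \<alpha>_def)
  have \<alpha>inj: "inj_on \<alpha> ?X'"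
  proof (rule inj_onI)
    fix y z assume yz: "y \<in> ?X'" "z \<in> ?X'" "\<alpha> y = \<alpha> z"
    have "y \<in> ?\<Omega>" "z \<in> ?\<Omega>" using yz X'(1) by blast+
    then have e: "a (g y) = a (g z)" using h(2)[of y z] yz(3) by (simp add: \<alpha>_def)
    have "g y = \<phi> y" "g z = \<phi> z" using yz g(2) by auto
    then have e': "a (\<phi> y) = a (\<phi> z)" using e by simp
    have "y = x' \<or> y \<in> X - {x}" "z = x' \<or> z \<in> X - {x}" using yz by auto
    then show "y = z" using e' \<phi>v w(4) \<iota>a a\<iota> by metis
  qed
  define \<sigma> where "\<sigma> = \<alpha> \<circ> k"
  have \<sigma>W: "\<sigma> ^^ i \<in> ?W" for i
  proof (induction i)
    case 0
    show ?case using W_base[of id] id_mem by (simp add: id_def)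
  next
    case (Suc i)
    have "\<sigma> \<in> ?W" unfolding \<sigma>_def by (rule gen.comp[OF \<alpha>W kW])
    then show ?case unfolding funpow.simps by (rule gen.comp[OF _ Suc])
  qed
  have \<sigma>I: "\<sigma> ` ?I \<subseteq> ?I"
  proof
    fix u assume "u \<in> \<sigma> ` ?I"
    then obtain i where i: "i \<in> ?I" "u = \<alpha> (k i)" by (auto simp: \<sigma>_def)
    have "k i \<in> ?\<Omega>" using apply_mem[OF k(1)] i(1) I\<Omega> by blast
    then show "u \<in> ?I" using \<alpha>I i(2) by simp
  qed
  have "inj_on \<sigma> ?I"
  proof (rule inj_onI)
    fix i j assume ij: "i \<in> ?I" "j \<in> ?I" "\<sigma> i = \<sigma> j"
    then have "k i = k j" using inj_onD[OF \<alpha>inj, of "k i" "k j"] k(2) by (auto simp: \<sigma>_def)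
    then show "i = j" using bij_is_inj[OF bij_mem[OF k(1)]] by (simp add: inj_eq)
  qed
  moreover have "\<sigma> ` ?I \<subseteq> ?\<Omega>" using \<sigma>I I\<Omega> by blast
  \<comment> \<open>\<open>\<sigma>\<close> permutes the image of \<open>a\<close> but is singular
    on all points; extending its restriction to a permutation provides a finite order.\<close>
  ultimately obtain s where s: "s \<in> Sn n" "\<And>i. i \<in> ?I \<Longrightarrow> s i = \<sigma> i"
    using extend_to_Sn[OF I\<Omega>, of \<sigma>] by blast
  obtain N where N: "N > 0" "s ^^ N = id" by (rule perm_group.finite_order[OF perm_group_Sn s(1)])
  have \<sigma>pow: "(\<sigma> ^^ j) i = (s ^^ j) i \<and> (\<sigma> ^^ j) i \<in> ?I" if "i \<in> ?I" for i j
  proof (induction j)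
    case (Suc j)
    then have m: "(\<sigma> ^^ j) i \<in> ?I" and e: "(\<sigma> ^^ j) i = (s ^^ j) i" by blast+
    have "(\<sigma> ^^ Suc j) i = (s ^^ Suc j) i" using s(2)[OF m, unfolded e] e by simp
    moreover have "\<sigma> ((\<sigma> ^^ j) i) \<in> ?I" using Suc \<sigma>I by blast
    ultimately show ?case by simp
  qed (use that in simp)
  \<comment> \<open>The power \<open>N - 1\<close> inverts
    \<open>\<sigma> = \<alpha> \<circ> k\<close> on the image. Hence \<open>?v\<close> is the
    identity on the new configuration, and it treats \<open>x\<close> like \<open>x'\<close> because
    \<open>\<alpha> x = \<alpha> x'\<close>.\<close>
  let ?v = "k \<circ> (\<sigma> ^^ (N - 1) \<circ> \<alpha>)"
  have vW: "?v \<in> ?W" by (intro gen.comp kW \<sigma>W \<alpha>W)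
  have v: "?v y = z" if z: "z \<in> ?X'" "\<alpha> y = \<alpha> z" for y z
  proof -
    obtain i where i: "i \<in> ?I" "z = k i" using z(1) k(2) by blast
    have "?v y = k ((\<sigma> ^^ (N - 1)) (\<sigma> i))" using z(2) i(2) by (simp add: \<sigma>_def)
    also have "(\<sigma> ^^ (N - 1)) (\<sigma> i) = (\<sigma> ^^ Suc (N - 1)) i" by (simp only: funpow_Suc_right o_apply)
    also have "\<dots> = (\<sigma> ^^ N) i" using N(1) by simp
    also have "\<dots> = i" using \<sigma>pow[OF i(1), of N] N(2) by simp
    finally show ?thesis using i(2) by simp
  qed
  have "?v x = x'" by (rule v[OF _ \<alpha>x]) simp
  moreover have "?v y = y" if "y \<in> X - {x}" for y by (rule v) (use that in simp_all)
  ultimately show ?thesis using vW by blast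
qed

text \<open>The points of the image are tokens that start at their own positions and are brought to
  their targets by slides; the number of misplaced tokens decreases.\<close>

lemma realise_injection:
  assumes a: "a \<in> Tn n - Sn n" and G: "sym_subgroup n G"
    and kh: "perm_group.kernel_homog {1..n} G a" and hg: "perm_group.homog {1..n} G (card (a ` {1..n}))"
    and \<psi>: "inj_on \<psi> (a ` {1..n})" "\<psi> ` (a ` {1..n}) \<subseteq> {1..n}"
  shows "\<exists>w\<in>gen (insert a G). \<forall>y\<in>a ` {1..n}. w y = \<psi> y"
proof -
  let ?\<Omega> = "{1..n}"
  let ?I = "a ` ?\<Omega>"
  let ?W = "gen (insert a G)"
  interpret perm_group ?\<Omega> G using G by (rule perm_group_if_sym_subgroup)
  have aT: "a \<in> Tn n" using a by simp
  have I\<Omega>: "?I \<subseteq> ?\<Omega>" using aT by (simp add: Tn_def)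
  have finI: "finite ?I" by simp
  have WT: "?W \<subseteq> Tn n"
    using aT G Sn_subset_Tn by (intro gen_subset_Tn) (auto simp: sym_subgroup_def)
  have rn: "card ?I < card ?\<Omega>"
  proof -
    have "card ?I \<le> card ?\<Omega>" by (rule card_image_le) simp
    moreover have "card ?I \<noteq> card ?\<Omega>"
      using a eq_card_imp_inj_on[OF finite_points, of a] unfolding singular_iff by blast
    ultimately show ?thesis by simp
  qed
  define bad where "bad w = {y\<in>?I. w y \<noteq> \<psi> y}" for w
  have fin_bad: "finite (bad w)" for w by (simp add: bad_def)
  have move: "\<exists>w'\<in>?W. inj_on w' ?I \<and> w' y = x' \<and> (\<forall>z\<in>?I - {y}. w' z = w z)"
    if w: "w \<in> ?W" "inj_on w ?I" and y: "y \<in> ?I" and x': "x' \<in> ?\<Omega> - w ` ?I" for w y x'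
  proof -
    have w\<Omega>: "w ` ?I \<subseteq> ?\<Omega>" using w(1) WT I\<Omega> Tn_maps by blast
    obtain v where v: "v \<in> ?W" "v (w y) = x'" "\<forall>u\<in>w ` ?I - {w y}. v u = u"
      using slide[OF a G kh hg w\<Omega> card_image[OF w(2)] imageI[OF y] x'] by (elim bexE conjE) (rule that)
    have keep: "(v \<circ> w) z = w z" if "z \<in> ?I - {y}" for z
    proof -
      have "w z \<noteq> w y" using inj_onD[OF w(2), of z y] that y by blast
      then show ?thesis using v(3) that by simp
    qed
    have "inj_on (v \<circ> w) ?I"
    proof (rule inj_onI)
      fix z z' assume zz: "z \<in> ?I" "z' \<in> ?I" "(v \<circ> w) z = (v \<circ> w) z'"
      have "(v \<circ> w) y = x'" using v(2) by simp
      moreover have "w u \<noteq> x'" if "u \<in> ?I" for u using x' that by blast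
      ultimately show "z = z'"
        using zz keep[of z] keep[of z'] inj_onD[OF w(2), of z z'] by (cases "z = y"; cases "z' = y") auto
    qed
    moreover have "v \<circ> w \<in> ?W" by (rule gen.comp[OF v(1) w(1)])
    ultimately show ?thesis using keep v(2) by (intro bexI[of _ "v \<circ> w"]) auto
  qed
  have fix_one: "\<exists>w'\<in>?W. inj_on w' ?I \<and> bad w' \<subseteq> bad w - {y}"
    if w: "w \<in> ?W" "inj_on w ?I" and y: "y \<in> bad w" and free: "\<psi> y \<notin> w ` ?I" for w y
  proof -
    have yI: "y \<in> ?I" using y by (simp add: bad_def)
    have free': "\<psi> y \<in> ?\<Omega> - w ` ?I" using free \<psi>(2) yI by blast
    obtain w' where w': "w' \<in> ?W" "inj_on w' ?I" "w' y = \<psi> y" "\<forall>z\<in>?I - {y}. w' z = w z"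
      using move[OF w yI free'] by (elim bexE conjE) (rule that)
    have "bad w' \<subseteq> bad w - {y}"
    proof
      fix z assume "z \<in> bad w'"
      then have z: "z \<in> ?I" "w' z \<noteq> \<psi> z" unfolding bad_def by blast+
      then have "z \<noteq> y" using w'(3) by blast
      moreover have "w' z = w z" using z(1) \<open>z \<noteq> y\<close> by (intro bspec[OF w'(4)]) simp
      ultimately show "z \<in> bad w - {y}" using z unfolding bad_def by simp
    qed
    with w'(2) have "inj_on w' ?I \<and> bad w' \<subseteq> bad w - {y}" by (rule conjI)
    then show ?thesis using w'(1) by (rule bexI)
  qed
  have main: "\<exists>w'\<in>?W. \<forall>y\<in>?I. w' y = \<psi> y" if "w \<in> ?W" "inj_on w ?I" for w
    using that
  proof (induction "card (bad w)" arbitrary: w rule: less_induct)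
    case less
    show ?case
    proof (cases "bad w = {}")
      case True
      then show ?thesis using less.prems(1) by (auto simp: bad_def)
    next
      case False
      have finish: ?thesis if w': "w' \<in> ?W" "inj_on w' ?I" and sub: "bad w' \<subseteq> bad w - {y}" and y: "y \<in> bad w" for w' y
      proof -
        have "bad w' \<subset> bad w" using sub y by blast
        then have "card (bad w') < card (bad w)" using fin_bad by (intro psubset_card_mono)
        then show ?thesis using less.hyps w' by blast
      qed
      from False obtain y where y: "y \<in> bad w" by blast
      then have yI: "y \<in> ?I" by (simp add: bad_def)
      show ?thesis
      proof (cases "\<psi> y \<in> w ` ?I")
        case False
        obtain w' where "w' \<in> ?W" "inj_on w' ?I" "bad w' \<subseteq> bad w - {y}"
          using fix_one[OF less.prems y False] by (elim bexE conjE) (rule that)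
        then show ?thesis by (rule finish[OF _ _ _ y])
      next
        case True
        then obtain y2 where y2: "y2 \<in> ?I" "\<psi> y = w y2" by blast
        have ne: "y2 \<noteq> y" using y y2 by (auto simp: bad_def)
        \<comment> \<open>The token occupying the target of \<open>y\<close> is itself misplaced
          because \<open>\<psi>\<close> is injective, so parking it on a free point, which exists as
          the rank is less than \<open>n\<close>, spoils nothing.\<close>
        have y2b: "y2 \<in> bad w"
          using y2 ne inj_onD[OF \<psi>(1) _ y2(1) yI] by (auto simp: bad_def)
        have "w ` ?I \<subseteq> ?\<Omega>" using less.prems(1) WT I\<Omega> Tn_maps by blast
        moreover have "card (w ` ?I) < card ?\<Omega>" using card_image[OF less.prems(2)] rn by simp
        ultimately have "w ` ?I \<noteq> ?\<Omega>" by auto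
        then obtain z where z: "z \<in> ?\<Omega> - w ` ?I" using \<open>w ` ?I \<subseteq> ?\<Omega>\<close> by blast
        obtain w1 where w1: "w1 \<in> ?W" "inj_on w1 ?I" "w1 y2 = z" "\<forall>u\<in>?I - {y2}. w1 u = w u"
          using move[OF less.prems y2(1) z] by (elim bexE conjE) (rule that)
        have keep: "w1 u = w u" if "u \<in> ?I" "u \<noteq> y2" for u using that by (intro bspec[OF w1(4)]) simp
        have b1: "bad w1 \<subseteq> bad w"
        proof
          fix u assume u: "u \<in> bad w1"
          show "u \<in> bad w"
          proof (cases "u = y2")
            case False
            then show ?thesis using u keep[of u] unfolding bad_def by simp
          qed (use y2b in simp)
        qed
        have y1: "y \<in> bad w1" using y keep[of y] ne unfolding bad_def by simp
        have "\<psi> y \<notin> w1 ` ?I"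
        proof
          assume "\<psi> y \<in> w1 ` ?I"
          then obtain u where u: "u \<in> ?I" "w y2 = w1 u" using y2(2) by auto
          show False
          proof (cases "u = y2")
            case True
            then show False using u w1(3) z y2(1) by auto
          next
            case False
            then have "w y2 = w u" using u w1(4) by simp
            then have "y2 = u" using inj_onD[OF less.prems(2) _ y2(1) u(1)] by simp
            with False show False by simp
          qed
        qed
        note free = this
        obtain w' where w': "w' \<in> ?W" "inj_on w' ?I" "bad w' \<subseteq> bad w1 - {y}"
          using fix_one[OF w1(1,2) y1 free] by (elim bexE conjE) (rule that)
        have "bad w' \<subseteq> bad w - {y}" using w'(3) b1 by blast
        with w'(1,2) show ?thesis by (rule finish[OF _ _ _ y])
      qed
    qed
  qed
  have "id \<in> ?W" using id_mem by (intro gen.base) simp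
  then show ?thesis by (rule main) simp
qed

text \<open>Kernel homogeneity rewrites \<open>a \<circ> g'\<close> as
  \<open>\<theta> \<circ> a \<circ> h\<close> with \<open>h\<close> in \<open>G\<close>. What
  remains on the left is a permutation that matters only on the image of \<open>a\<close>, where
  sliding realises it.\<close>

lemma Sn_pair_if_homog:
  assumes a: "a \<in> Tn n - Sn n" and G: "sym_subgroup n G"
    and kh: "perm_group.kernel_homog {1..n} G a" and hg: "perm_group.homog {1..n} G (card (a ` {1..n}))"
  shows "Sn_pair n a G"
  unfolding Sn_pair_iff_translates[OF a G]
proof (intro ballI)
  fix g g' assume gg: "g \<in> Sn n" "g' \<in> Sn n"
  let ?\<Omega> = "{1..n}"
  let ?W = "gen (insert a G)"
  interpret perm_group ?\<Omega> G using G by (rule perm_group_if_sym_subgroup)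
  have aT: "a \<in> Tn n" using a by simp
  have I\<Omega>: "a ` ?\<Omega> \<subseteq> ?\<Omega>" using aT by (simp add: Tn_def)
  have GT: "G \<subseteq> Tn n" using G Sn_subset_Tn by (auto simp: sym_subgroup_def)
  have "g' permutes ?\<Omega>" using gg(2) by (simp add: Sn_iff)
  then obtain h where h: "h \<in> G" "\<And>x y. x \<in> ?\<Omega> \<Longrightarrow> y \<in> ?\<Omega> \<Longrightarrow> a (g' x) = a (g' y) \<longleftrightarrow> a (h x) = a (h y)"
    using kernel_homogE[OF kh] by blast
  have T: "a \<circ> g' \<in> Tn n" "a \<circ> h \<in> Tn n" using aT gg Sn_subset_Tn h(1) GT Tn_comp by blast+
  have "(a \<circ> h) x = (a \<circ> h) y \<longleftrightarrow> (a \<circ> g') x = (a \<circ> g') y" if "x \<in> ?\<Omega>" "y \<in> ?\<Omega>" for x y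
    using h(2)[OF that] by simp
  then obtain \<theta> where \<theta>: "\<theta> \<in> Sn n" "a \<circ> g' = \<theta> \<circ> (a \<circ> h)"
    using same_kernel_imp_translate[OF T] by blast
  have g\<theta>: "g \<circ> \<theta> \<in> Sn n" using gg(1) \<theta>(1) by (rule Sn_comp)
  then have p: "(g \<circ> \<theta>) permutes ?\<Omega>" by (simp add: Sn_iff)
  have "inj_on (g \<circ> \<theta>) (a ` ?\<Omega>)" using permutes_inj[OF p] by (rule inj_on_subset) simp
  moreover have "(g \<circ> \<theta>) ` (a ` ?\<Omega>) \<subseteq> ?\<Omega>" using permutes_image[OF p] I\<Omega> by blast
  ultimately obtain w where w: "w \<in> ?W" "\<forall>y\<in>a ` ?\<Omega>. w y = (g \<circ> \<theta>) y"
    using realise_injection[OF a G kh hg] by blast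
  have WT: "?W \<subseteq> Tn n" using aT GT by (intro gen_subset_Tn) auto
  have "(g \<circ> \<theta>) \<circ> a = w \<circ> a"
  proof (rule Tn_eqI)
    show "(g \<circ> \<theta>) \<circ> a \<in> Tn n" by (rule Tn_comp) (use g\<theta> aT Sn_subset_Tn in blast)+
    show "w \<circ> a \<in> Tn n" by (rule Tn_comp) (use w(1) aT WT in blast)+
    show "((g \<circ> \<theta>) \<circ> a) x = (w \<circ> a) x" if "x \<in> ?\<Omega>" for x using w(2) that by simp
  qed
  then have "g \<circ> a \<circ> g' = w \<circ> a \<circ> h" using \<theta>(2) by (simp only: comp_assoc) (simp only: comp_assoc[symmetric])
  moreover have "w \<circ> a \<circ> h \<in> ?W"
    by (intro gen.comp w(1) gen.base) (use h(1) in simp_all)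
  ultimately show "g \<circ> a \<circ> g' \<in> ?W" by simp
qed

section \<open>Consequences of condition (1) for an independent set\<close>

lemma independentD:
  assumes "independent n A" "a \<in> A" "b \<in> A" "a \<in> gen (insert b (Sn n))"
  shows "a = b"
  using assms unfolding independent_def by auto

lemma kernel_homog_if_translates:
  assumes A: "independent n A" and G: "sym_subgroup n G"
    and tr: "\<forall>a\<in>A. \<forall>g\<in>Sn n. \<forall>h\<in>Sn n. g \<circ> a \<circ> h \<in> gen (A \<union> G)" and a: "a \<in> A"
  shows "perm_group.kernel_homog {1..n} G a"
proof -
  let ?\<Omega> = "{1..n}"
  interpret perm_group ?\<Omega> G using G by (rule perm_group_if_sym_subgroup)
  have AS: "A \<subseteq> Tn n - Sn n" using A by (simp add: independent_def)
  have AT: "A \<subseteq> Tn n" using AS by blast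
  have GS: "G \<subseteq> Sn n" using G by (simp add: sym_subgroup_def)
  show ?thesis
    unfolding kernel_homog_def
  proof (intro allI impI)
    fix g assume gp: "g permutes ?\<Omega>"
    then have g: "g \<in> Sn n" by (simp add: Sn_iff)
    have "id \<circ> a \<circ> g \<in> gen (A \<union> G)" by (rule bspec[OF bspec[OF bspec[OF tr a] id_Sn] g])
    then have mem: "a \<circ> g \<in> gen (A \<union> G)" by (simp only: id_comp)
    have "a \<circ> g \<in> Tn n - Sn n" by (rule singular_comp(1)) (use a AS g Sn_subset_Tn in blast)+
    then have "a \<circ> g \<notin> G" using GS by blast
    with gen_decompose[OF AT G mem] have "\<exists>c\<in>A. \<exists>h\<in>G. \<exists>w\<in>Tn n. a \<circ> g = w \<circ> c \<circ> h"
      by (simp only: simp_thms)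
    then obtain c h w where c: "c \<in> A" "h \<in> G" "w \<in> Tn n" and e: "a \<circ> g = w \<circ> c \<circ> h" by (elim bexE)
    have gi: "g \<circ> inv g = id" using permutes_inv_o(1)[OF gp] .
    have hS: "h \<in> Sn n" using c(2) GS by blast
    have ca: "c = a"
    proof (rule ccontr)
      assume "c \<noteq> a"
      let ?k = "h \<circ> inv g"
      have kS: "?k \<in> Sn n" using hS Sn_inv[OF g] by (rule Sn_comp)
      have "a = (a \<circ> g) \<circ> inv g" by (simp only: comp_assoc gi comp_id)
      also have "\<dots> = w \<circ> (c \<circ> ?k)" unfolding e by (simp only: comp_assoc)
      finally have a_eq: "a = w \<circ> (c \<circ> ?k)" .
      have "c \<circ> ?k \<in> Tn n - Sn n" by (rule singular_comp(1)) (use c(1) AS kS Sn_subset_Tn in blast)+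
      then have "a \<in> gen (insert (c \<circ> ?k) (Sn n))"
      proof (rule mem_gen_if_coarser)
        show "a \<in> Tn n" using a AT by blast
        show "a x = a y" if "(c \<circ> ?k) x = (c \<circ> ?k) y" for x y
          using that by (subst (1 2) a_eq) simp
      qed
      then have "a \<in> gen (insert c (Sn n))" using gen_insert_translate[OF kS] by blast
      then have "a = c" by (rule independentD[OF A a c(1)])
      with \<open>c \<noteq> a\<close> show False by simp
    qed
    have e': "a (g x) = w (a (h x))" for x using fun_cong[OF e, of x] ca by simp
    have hp: "h permutes ?\<Omega>" using hS by (simp add: Sn_iff)
    \<comment> \<open>Both sides of the factorisation have the image of \<open>a\<close>, so
      \<open>w\<close> permutes this image and cannot merge further points; hence
      \<open>a \<circ> g\<close> and \<open>a \<circ> h\<close> have the same kernel.\<close>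
    have "w ` (a ` ?\<Omega>) = a ` ?\<Omega>"
    proof -
      have "w ` (a ` ?\<Omega>) = w ` a ` (h ` ?\<Omega>)" by (simp only: permutes_image[OF hp])
      also have "\<dots> = a ` (g ` ?\<Omega>)" using e' by (simp add: image_image)
      finally show ?thesis by (simp only: permutes_image[OF gp])
    qed
    then have winj: "inj_on w (a ` ?\<Omega>)" by (intro eq_card_imp_inj_on) simp_all
    have "a (g x) = a (g y) \<longleftrightarrow> a (h x) = a (h y)" if "x \<in> ?\<Omega>" "y \<in> ?\<Omega>" for x y
    proof
      assume "a (g x) = a (g y)"
      then have "w (a (h x)) = w (a (h y))" by (simp only: e')
      moreover have "a (h x) \<in> a ` ?\<Omega>" "a (h y) \<in> a ` ?\<Omega>" using that permutes_in_image[OF hp] by blast+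
      ultimately show "a (h x) = a (h y)" by (rule inj_onD[OF winj])
    next
      assume "a (h x) = a (h y)"
      then show "a (g x) = a (g y)" by (simp only: e')
    qed
    then show "\<exists>h\<in>G. \<forall>x\<in>?\<Omega>. \<forall>y\<in>?\<Omega>. a (g x) = a (g y) \<longleftrightarrow> a (h x) = a (h y)" using c(2) by blast
  qed
qed

text \<open>\<open>b\<close> is the factor from \<open>A\<close> that acts last in a product equal
  to \<open>g \<circ> a\<close>. Only an inclusion results, since the rank of \<open>b\<close> may
  be larger than that of \<open>a\<close>.\<close>

lemma image_cover:
  assumes A: "A \<subseteq> Tn n - Sn n" and G: "sym_subgroup n G"
    and tr: "\<forall>a\<in>A. \<forall>g\<in>Sn n. \<forall>h\<in>Sn n. g \<circ> a \<circ> h \<in> gen (A \<union> G)"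
    and a: "a \<in> A" and Y: "Y \<subseteq> {1..n}" "card Y = card (a ` {1..n})"
  shows "\<exists>b\<in>A. \<exists>h\<in>G. Y \<subseteq> h ` b ` {1..n}"
proof -
  let ?\<Omega> = "{1..n}"
  have AT: "A \<subseteq> Tn n" using A by blast
  have GS: "G \<subseteq> Sn n" using G by (simp add: sym_subgroup_def)
  have aT: "a \<in> Tn n" using a AT by blast
  then have a\<Omega>: "a ` ?\<Omega> \<subseteq> ?\<Omega>" by (simp add: Tn_def)
  obtain g where gp: "g permutes ?\<Omega>" and gY: "g ` (a ` ?\<Omega>) = Y"
    by (rule permutation_image[OF finite_atLeastAtMost a\<Omega> Y(1) Y(2)[symmetric]])
  have g: "g \<in> Sn n" using gp by (simp add: Sn_iff)
  have "g \<circ> a \<circ> id \<in> gen (A \<union> G)" by (rule bspec[OF bspec[OF bspec[OF tr a] g] id_Sn])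
  then have mem: "g \<circ> a \<in> gen (A \<union> G)" by (simp only: comp_id)
  have "g \<circ> a \<in> Tn n - Sn n" by (rule singular_comp(2)) (use a A g Sn_subset_Tn in blast)+
  then have "g \<circ> a \<notin> G" using GS by blast
  with gen_decompose[OF AT G mem] have "\<exists>c\<in>A. \<exists>h\<in>G. \<exists>w\<in>Tn n. g \<circ> a = h \<circ> c \<circ> w"
    by (simp only: simp_thms)
  then obtain b h w where b: "b \<in> A" "h \<in> G" "w \<in> Tn n" and e: "g \<circ> a = h \<circ> b \<circ> w" by (elim bexE)
  have "Y = (g \<circ> a) ` ?\<Omega>" using gY by (simp only: image_comp)
  also have "\<dots> = h ` b ` (w ` ?\<Omega>)" unfolding e by (simp only: image_comp comp_assoc)
  also have "\<dots> \<subseteq> h ` b ` ?\<Omega>" using b(3) by (intro image_mono) (simp add: Tn_def)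
  finally show ?thesis using b by blast
qed

lemma mem_gen_translate:
  assumes a: "a \<in> Tn n" and b: "b \<in> Tn n - Sn n" and g: "g permutes {1..n}"
    and ker: "\<And>x y. x \<in> {1..n} \<Longrightarrow> y \<in> {1..n} \<Longrightarrow> b (g x) = b (g y) \<Longrightarrow> a x = a y"
  shows "a \<in> gen (insert b (Sn n))"
proof -
  have gS: "g \<in> Sn n" using g by (simp add: Sn_iff)
  have "b \<circ> g \<in> Tn n - Sn n" by (rule singular_comp(1)[OF b]) (use gS Sn_subset_Tn in blast)
  then have "a \<in> gen (insert (b \<circ> g) (Sn n))"
  proof (rule mem_gen_if_coarser[OF _ a])
    fix x y assume "x \<in> {1..n}" "y \<in> {1..n}" "(b \<circ> g) x = (b \<circ> g) y"
    then show "a x = a y" unfolding o_apply by (rule ker)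
  qed
  then show ?thesis using gen_insert_translate[OF gS] by blast
qed

lemma homog_rank:
  assumes A: "independent n A" and G: "sym_subgroup n G"
    and tr: "\<forall>a\<in>A. \<forall>g\<in>Sn n. \<forall>h\<in>Sn n. g \<circ> a \<circ> h \<in> gen (A \<union> G)" and a: "a \<in> A"
  shows "perm_group.homog {1..n} G (card (a ` {1..n}))"
proof (rule ccontr)
  let ?\<Omega> = "{1..n}"
  let ?rk = "\<lambda>b. card (b ` ?\<Omega>)"
  interpret perm_group ?\<Omega> G using G by (rule perm_group_if_sym_subgroup)
  have AS: "A \<subseteq> Tn n - Sn n" using A by (simp add: independent_def)
  have indep: "b = c" if "b \<in> A" "c \<in> A" "b \<in> gen (insert c (Sn n))" for b c
    by (rule independentD[OF A that])
  have kh: "kernel_homog b" if "b \<in> A" for b by (rule kernel_homog_if_translates[OF A G tr that])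
  have sing: "b \<in> Tn n" "\<not> inj_on b ?\<Omega>" if "b \<in> A" for b
    using AS that singular_iff by blast+
  have rk_lt: "?rk b < n" if "b \<in> A" for b
  proof -
    have "?rk b \<le> card ?\<Omega>" by (rule card_image_le) simp
    moreover have "?rk b \<noteq> card ?\<Omega>"
      using sing(2)[OF that] eq_card_imp_inj_on[OF finite_points, of b] by blast
    ultimately show ?thesis by simp
  qed
  have rk_pos: "0 < ?rk b" if "b \<in> A" for b
    using rk_lt[OF that] by (simp add: card_gt_0_iff)
  have card_hb: "card (h ` b ` ?\<Omega>) = ?rk b" if "h \<in> G" for h b by (rule card_image_mem[OF that])
  \<comment> \<open>If no other element of \<open>A\<close> has rank at least that of
    \<open>b\<close>, the covering translates are translates of the image of \<open>b\<close>
    itself, and by cardinality the inclusions are equalities.\<close>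
  have homog_if_only: "homog (?rk b)"
    if b: "b \<in> A" and only: "\<And>c. c \<in> A \<Longrightarrow> ?rk b \<le> ?rk c \<Longrightarrow> c = b" for b
  proof -
    have to: "\<exists>h\<in>G. h ` b ` ?\<Omega> = Y" if Y: "Y \<subseteq> ?\<Omega>" "card Y = ?rk b" for Y
    proof -
      obtain c h where c: "c \<in> A" "h \<in> G" "Y \<subseteq> h ` c ` ?\<Omega>" using image_cover[OF AS G tr b Y] by blast
      have "card Y \<le> card (h ` c ` ?\<Omega>)" using c(3) by (intro card_mono) simp_all
      then have "c = b" using only[OF c(1)] Y(2) card_hb[OF c(2)] by simp
      then have "Y = h ` b ` ?\<Omega>" using c(3) Y(2) card_hb[OF c(2), of b] by (intro card_subset_eq) simp_all
      with c(2) show ?thesis by blast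
    qed
    show ?thesis
      unfolding homog_def
    proof (intro allI impI, elim conjE)
      fix X Y assume XY: "X \<subseteq> ?\<Omega>" "Y \<subseteq> ?\<Omega>" "card X = ?rk b" "card Y = ?rk b"
      obtain h where h: "h \<in> G" "h ` b ` ?\<Omega> = X" using to[OF XY(1,3)] by blast
      obtain k where k: "k \<in> G" "k ` b ` ?\<Omega> = Y" using to[OF XY(2,4)] by blast
      have "(k \<circ> inv h) ` X = k ` inv h ` h ` b ` ?\<Omega>" by (simp only: image_comp[symmetric] h(2))
      also have "\<dots> = Y" by (simp only: image_inv(1)[OF h(1)] k(2))
      finally show "\<exists>g\<in>G. g ` X = Y" using comp_mem[OF k(1) inv_mem[OF h(1)]] by blast
    qed
  qed
  assume nr: "\<not> homog (?rk a)"
  define d where "d = (LEAST j. \<not> homog j)"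
  have nd: "\<not> homog d" unfolding d_def by (rule LeastI[of "\<lambda>j. \<not> homog j" "?rk a", OF nr])
  have least: "homog j" if "j < d" for j using that not_less_Least unfolding d_def by blast
  have d1: "1 \<le> d" using nd homog_0 by (cases d) auto
  have dr: "d \<le> ?rk a" unfolding d_def by (rule Least_le[of "\<lambda>j. \<not> homog j", OF nr])
  have "\<not> homog (n - ?rk a)"
  proof
    assume "homog (n - ?rk a)"
    then have "homog (card ?\<Omega> - (n - ?rk a))" by (rule homog_complement) simp
    then show False using nr rk_lt[OF a] by simp
  qed
  then have dnr: "d \<le> n - ?rk a" unfolding d_def by (rule Least_le)
  show False
  proof (cases "d = 1")
    case True
    then have n1: "\<not> homog 1" using nd by simp
    \<comment> \<open>With \<open>d = 1\<close> the size bound leaves only 0 and \<open>n\<close> as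
      sizes of a class, so the class of the part of the point 1 is everything.\<close>
    have uniform: "\<exists>k. \<forall>x\<in>?\<Omega>. card (fibre b x) = k" if b: "b \<in> A" for b
    proof -
      have ne: "1 \<in> ?\<Omega>" using rk_lt[OF b] by simp
      let ?C = "fibre_class b (card (fibre b 1))"
      have "1 \<in> ?C" unfolding fibre_class_def using ne by blast
      then have "card ?C \<noteq> 0" unfolding card_eq_0_iff using finite_fibre_class by blast
      moreover have "card ?C < 1 \<or> card ?\<Omega> - 1 < card ?C"
        by (rule fibre_class_homog_bound[OF kh[OF b] n1]) (use rk_lt[OF b] in simp)
      moreover have "card ?C \<le> card ?\<Omega>" by (rule card_mono[OF finite_points fibre_class_subset])
      ultimately have "card ?C = card ?\<Omega>" by linarith
      then have "?C = ?\<Omega>" by (rule card_subset_eq[OF finite_points fibre_class_subset])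
      then have "\<forall>x\<in>?\<Omega>. card (fibre b x) = card (fibre b 1)" unfolding fibre_class_def by blast
      then show ?thesis by blast
    qed
    have "\<exists>b. b \<in> A \<and> (\<forall>c. c \<in> A \<longrightarrow> ?rk c \<le> ?rk b)"
      by (rule ex_has_greatest_nat[of "\<lambda>b. b \<in> A" a ?rk n]) (use a rk_lt in auto)
    then obtain b where b: "b \<in> A" "\<And>c. c \<in> A \<Longrightarrow> ?rk c \<le> ?rk b" by blast
    have "homog (?rk b)"
    proof (rule homog_if_only[OF b(1)])
      fix c assume c: "c \<in> A" "?rk b \<le> ?rk c"
      then have rk: "?rk b = ?rk c" using b(2) by (simp add: le_antisym)
      obtain k where k: "\<forall>x\<in>?\<Omega>. card (fibre b x) = k" using uniform[OF b(1)] by blast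
      obtain l where l: "\<forall>x\<in>?\<Omega>. card (fibre c x) = l" using uniform[OF c(1)] by blast
      obtain g where g: "g permutes ?\<Omega>" "\<And>x y. x \<in> ?\<Omega> \<Longrightarrow> y \<in> ?\<Omega> \<Longrightarrow> c (g x) = c (g y) \<Longrightarrow> b x = b y"
        using uniform_kernels_match[of b k c l, OF bspec[OF k] bspec[OF l] rk] by blast
      have "b \<in> gen (insert c (Sn n))"
        by (rule mem_gen_translate[OF _ _ g]) (use sing(1)[OF b(1)] AS c(1) in blast)+
      then show "c = b" using indep[OF b(1) c(1)] by simp
    qed
    \<comment> \<open>The rank of \<open>b\<close> lies between 1 and \<open>n - 1\<close>, the
      range in which Livingstone-Wagner descends to degree 1.\<close>
    then have "homog 1" by (rule livingstone_wagner) (use rk_pos[OF b(1)] rk_lt[OF b(1)] in simp_all)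
    with n1 show False ..
  next
    case False
    then have d2: "2 \<le> d" using d1 by simp
    have dn: "2 * d \<le> card ?\<Omega>" using dr dnr rk_lt[OF a] by simp
    have type: "d - 1 \<le> card (fibre_class c 1) \<and>
        (?rk c \<le> card ?\<Omega> - d \<longrightarrow> card (fibre_class c 1) = d - 1 \<and> ?rk c = d)"
      if "c \<in> A" "d \<le> ?rk c" for c
      by (rule kernel_type[OF kh[OF that(1)] nd dn d2 least that(2) sing(2)[OF that(1)]])
    have ta: "card (fibre_class a 1) = d - 1" "?rk a = d"
    proof -
      have "?rk a \<le> card ?\<Omega> - d" using dnr rk_lt[OF a] by simp
      then show "card (fibre_class a 1) = d - 1" "?rk a = d" using type[OF a dr] by blast+
    qed
    have "homog (?rk a)"
    proof (rule homog_if_only[OF a])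
      fix b assume b: "b \<in> A" "?rk a \<le> ?rk b"
      have ub: "card (fibre_class a 1) \<le> card (fibre_class b 1)"
        using type[OF b(1)] b(2) ta by linarith
      obtain B where B: "B \<subseteq> fibre_class b 1" "card B = card (fibre_class a 1)"
        using obtain_subset_with_card_n[OF ub] by metis
      \<comment> \<open>\<open>a\<close> merges all points outside its \<open>d - 1\<close>
        singletons, and \<open>b\<close> has at least as many singletons; matching singletons makes
        the kernel of \<open>b \<circ> g\<close> finer than that of \<open>a\<close>.\<close>
      obtain g where g: "g permutes ?\<Omega>" "g ` fibre_class a 1 = B"
        by (rule permutation_image[OF finite_points fibre_class_subset _ B(2)[symmetric]])
          (use B(1) fibre_class_subset in blast)
      have "card (a ` (?\<Omega> - fibre_class a 1)) = 1"
        using card_image_eq_singletons[of a] ta d2 by simp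
      then obtain v where v: "a ` (?\<Omega> - fibre_class a 1) = {v}" by (meson card_1_singletonE)
      have "a \<in> gen (insert b (Sn n))"
      proof (rule mem_gen_translate[OF sing(1)[OF a] _ g(1)])
        show "b \<in> Tn n - Sn n" using AS b(1) by blast
        fix x y assume xy: "x \<in> ?\<Omega>" "y \<in> ?\<Omega>" "b (g x) = b (g y)"
        have inj: "g x = g y \<longleftrightarrow> x = y" using permutes_inj[OF g(1)] by (simp add: inj_eq)
        have g\<Omega>: "g x \<in> ?\<Omega>" "g y \<in> ?\<Omega>" using xy(1,2) permutes_in_image[OF g(1)] by simp_all
        show "a x = a y"
        proof (cases "x \<in> fibre_class a 1 \<or> y \<in> fibre_class a 1")
          case True
          then have "g x \<in> fibre_class b 1 \<or> g y \<in> fibre_class b 1" using g(2) B(1) by blast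
          then have "g x = g y" using xy(3) g\<Omega> unfolding singleton_class_iff by metis
          then show ?thesis using inj by simp
        next
          case False
          then have "a x \<in> {v}" "a y \<in> {v}" using xy(1,2) v by blast+
          then show ?thesis by simp
        qed
      qed
      then show "b = a" using indep[OF a b(1)] by simp
    qed
    with nr show False ..
  qed
qed

theorem theorem8p4:
  fixes n :: nat and A G :: "(nat \<Rightarrow> nat) set"
  assumes "independent n A" and "sym_subgroup n G"
  shows "gen (A \<union> G) - G = gen (A \<union> Sn n) - Sn n \<longleftrightarrow> (\<forall>a\<in>A. Sn_pair n a G)"
proof -
  have A: "A \<subseteq> Tn n - Sn n" using assms(1) by (simp add: independent_def)
  note iff = gen_eq_iff_translates[OF A assms(2)]
  show ?thesis
  proof
    assume "gen (A \<union> G) - G = gen (A \<union> Sn n) - Sn n"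
    then have tr: "\<forall>a\<in>A. \<forall>g\<in>Sn n. \<forall>h\<in>Sn n. g \<circ> a \<circ> h \<in> gen (A \<union> G)" by (simp only: iff)
    show "\<forall>a\<in>A. Sn_pair n a G"
    proof
      fix a assume a: "a \<in> A"
      show "Sn_pair n a G"
        by (rule Sn_pair_if_homog[OF _ assms(2) kernel_homog_if_translates[OF assms tr a] homog_rank[OF assms tr a]])
          (use a A in blast)
    qed
  next
    assume pairs: "\<forall>a\<in>A. Sn_pair n a G"
    show "gen (A \<union> G) - G = gen (A \<union> Sn n) - Sn n"
      unfolding iff
    proof
      fix a assume a: "a \<in> A"
      have aS: "a \<in> Tn n - Sn n" using a A by blast
      have "\<forall>g\<in>Sn n. \<forall>h\<in>Sn n. g \<circ> a \<circ> h \<in> gen (insert a G)"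
        using bspec[OF pairs a] unfolding Sn_pair_iff_translates[OF aS assms(2)] .
      moreover have "gen (insert a G) \<subseteq> gen (A \<union> G)" using a by (intro gen_mono) blast
      ultimately show "\<forall>g\<in>Sn n. \<forall>h\<in>Sn n. g \<circ> a \<circ> h \<in> gen (A \<union> G)" by blast
    qed
  qed
qed

end
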